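(* Let $\Sigma:\ \dot{x}=f(x,u)$ be the infinite network on $X=\ell_\infty(\mathbb{N},(n_i))$ with input value space $U=\ell_\infty(\mathbb{N},(m_i))$ composed of the subsystems $\Sigma_i:\ \dot{x}_i=f_i(x_i,\bar{x}_i,u_i)$, $i\in\mathbb{N}$, as described in the context. Suppose: (i) $\Sigma$ is well-posed and satisfies the boundedness-implies-continuation property. (ii) For each $i\in\mathbb{N}$ there is a continuous function $V_i:\mathbb{R}^{n_i}\to\mathbb{R}_+$, which is $C^1$ outside of $x_i=0$, such that: (L1) there exist $\psi_{i1},\psi_{i2}\in\mathcal{K}_\infty$ with $\psi_{i1}(|x_i|)\le V_i(x_i)\le\psi_{i2}(|x_i|)$ for all $x_i\in\mathbb{R}^{n_i}$; (L2) there exist a monotone, homogeneous aggregation function $\mu_i$, numbers $\gamma_{ij}\in\mathbb{R}_+$ ($j\in\mathbb{N}$) with $\gamma_{ij}=0$ for all $j\notin I_i$, and functions $\gamma_{iu}\in\mathcal{K}$, $\alpha_i\in\mathcal{P}$ such that for all $x=(x_j)_{j\in\mathbb{N}}\in X$ and $u=(u_j)_{j\in\mathbb{N}}\in U$, $$V_i(x_i)>\max\Big\{\mu_i\big((\gamma_{ij}V_j(x_j))_{j\in\mathbb{N}}\big),\ \gamma_{iu}(|u_i|)\Big\}\ \Rightarrow\ \nabla V_i(x_i)f_i(x_i,\bar{x}_i,u_i)\le-\alpha_i(V_i(x_i)).$$ Moreover, there exist $\psi_1,\psi_2\in\mathcal{K}_\infty$ such that $\psi_1\le\psi_{i1}$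 and $\psi_{i2}\le\psi_2$ for all $i\in\mathbb{N}$. (iii) The gain operator $\Gamma_\mu:\ell_\infty^+\to\ell_\infty^+$, $\Gamma_\mu(s):=\big(\mu_i((\gamma_{ij}s_j)_{j\in\mathbb{N}})\big)_{i\in\mathbb{N}}$, is well-defined, equivalently $\|\Gamma_\mu(\mathbf{1})\|_{\ell_\infty}<\infty$; and there is $\gamma^u_{\max}\in\mathcal{K}$ such that $\gamma_{iu}\le\gamma^u_{\max}$ for all $i\in\mathbb{N}$. (iv) The spectral radius condition $r(\Gamma_\mu)<1$ holds. (v) For each $R>0$ there is $L(R)>0$ such that $|V_i(x_i)-V_i(y_i)|\le L(R)|x_i-y_i|$ for all $i\in\mathbb{N}$ and all $x_i,y_i\in B_R(0)\subset\mathbb{R}^{n_i}$. (vi) There exists $\tilde\alpha\in\mathcal{P}$ such that $\alpha_i\ge\tilde\alpha$ for all $i\in\mathbb{N}$. Then there exists $s^0\in\mathrm{int}(\ell_\infty^+)$ such that the function $$V(x):=\sup_{i\in\mathbb{N}}\frac{1}{s^0_i}V_i(x_i)\quad\text{for all } x=(x_i)_{i\in\mathbb{N}}\in X$$ is an ISS Lyapunov function (in an implication form) for $\Sigma$. In particular, $\Sigma$ is ISS. Moreover, $V$ satisfies a Lipschitz condition on every bounded subset of $X$.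
   Context: **Notation.** $\mathbb{R}_+=[0,\infty)$. $\ell_\infty$ is the Banach space of bounded real sequences with norm $\|x\|_{\ell_\infty}=\sup_i|x_i|$; $\ell_\infty^+$ is the cone of sequences in $\ell_\infty$ with all $x_i\ge0$; $\mathrm{int}(\ell_\infty^+)$ is its interior; $x\le y$ in $\ell_\infty$ means $x_i\le y_i$ for all $i$; $\mathbf{1}=(1,1,1,\ldots)$. $B_R(0)$ is the open ball of radius $R$ around $0$. Gradients $\nabla V_i$ are row vectors. Inequalities between functions are pointwise. **Comparison functions.** $\mathcal{P}$: continuous $\alpha:\mathbb{R}_+\to\mathbb{R}_+$ with $\alpha(0)=0$ and $\alpha(r)>0$ for $r>0$. $\mathcal{K}$: strictly increasing functions in $\mathcal{P}$. $\mathcal{K}_\infty$: unbounded functions in $\mathcal{K}$. $\mathcal{KL}$: continuous $\beta:\mathbb{R}_+\times\mathbb{R}_+\to\mathbb{R}_+$ with $\beta(\cdot,t)\in\mathcal{K}$ for each $t\geq 0$ and $\beta(r,\cdot)$ strictly decreasing to $0$ for each $r>0$. **Monotone, homogeneous aggregation function.** A function $\mu:\ell_\infty^+\to[0,\infty]$ such that $\mu(cs)=c\mu(s)$ for all $s\in\ell_\infty^+$, $c\ge0$ (with $0\cdot\infty=0$); $\mu(r)\le\mu(s)$ whenever $r\le s$; and $\mu(r+s)\le\mu(r)+\mu(s)$ for all $r,s\in\ell_\infty^+$ (with $\infty+\infty=\infty$). **Network.** Given are sequences $(n_i),(m_i)$ of positive integers and finite (possibly empty) sets $I_i\subset\mathbb{N}$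 with $i\notin I_i$. The subsystem $\Sigma_i:\ \dot{x}_i=f_i(x_i,\bar{x}_i,u_i)$ has state $x_i\in\mathbb{R}^{n_i}$, internal input $\bar{x}_i=(x_j)_{j\in I_i}\in\mathbb{R}^{N_i}$ with $N_i=\sum_{j\in I_i}n_j$, external input $u_i\in\mathbb{R}^{m_i}$, and continuous right-hand side $f_i:\mathbb{R}^{n_i}\times\mathbb{R}^{N_i}\times\mathbb{R}^{m_i}\to\mathbb{R}^{n_i}$. For every initial state and all essentially bounded inputs $\bar{x}_i(\cdot),u_i(\cdot)$, $\Sigma_i$ has a unique local solution. Arbitrary norms, all denoted $|\cdot|$, are fixed on the spaces $\mathbb{R}^{n_i}$, $\mathbb{R}^{m_i}$. Put $X=\ell_\infty(\mathbb{N},(n_i))=\{(x_i)_{i\in\mathbb{N}}: x_i\in\mathbb{R}^{n_i},\ \sup_i|x_i|<\infty\}$ with $\|x\|_X=\sup_i|x_i|$, and $U=\ell_\infty(\mathbb{N},(m_i))$ with $\|u\|_U=\sup_i|u_i|$. A function on $\mathbb{R}_+$ is piecewise right-continuous if $\mathbb{R}_+$ is the disjoint union of intervals $[0,a_1),[a_1,a_2),[a_2,a_3),\ldots$ on each of which the function is continuous. The class of input functions is $\mathcal{U}=\{u\in L_\infty(\mathbb{R}_+,U): u\text{ piecewise right-continuous}\}$, with $\|u\|_{\mathcal{U}}=\mathrm{ess\,sup}_{t\ge0}\|u(t)\|_U$. The right-hand side of $\Sigma$ is $f:X\times U\to\prod_i\mathbb{R}^{n_i}$, $f(x,u)=(f_i(x_i,\bar{x}_i,u_i))_{i\in\mathbb{N}}$.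 **Solutions.** For $x^0\in X$, $u\in\mathcal{U}$, a solution of $\dot{x}(t)=f(x(t),u(t))$, $x(0)=x^0$ is a function $\lambda:J\to X$, $J=[0,T)$, $0<T\le\infty$, such that $s\mapsto f(\lambda(s),u(s))$ is a locally Bochner-integrable $X$-valued function and $\lambda(t)=x^0+\int_0^tf(\lambda(s),u(s))\,ds$ for all $t\in J$. $\Sigma$ is *well-posed* if local solutions exist and are unique (for all $x^0\in X$, $u\in\mathcal{U}$); the solution is then denoted $\phi(t,x^0,u)$. $\Sigma$ has the *boundedness-implies-continuation property* if every bounded solution defined on a bounded time interval $[0,T)$ can be extended to a solution on a larger time interval. A well-posed $\Sigma$ is *forward complete* if every solution can be extended to $\mathbb{R}_+$. **ISS.** A well-posed $\Sigma$ is *input-to-state stable (ISS)* if it is forward complete and there are $\beta\in\mathcal{KL}$, $\kappa\in\mathcal{K}$ with $\|\phi(t,x,u)\|_X\le\beta(\|x\|_X,t)+\kappa(\|u\|_{\mathcal{U}})$ for all $x\in X$, $u\in\mathcal{U}$, $t\ge0$. **ISS Lyapunov function (in an implication form).** A function $V:X\to\mathbb{R}_+$ that is continuous; for which there are $\psi_1,\psi_2\in\mathcal{K}_\infty$ with $\psi_1(\|x\|_X)\le V(x)\le\psi_2(\|x\|_X)$ for all $x\in X$; and for which there are $\gamma\in\mathcal{K}$, $\alpha\in\mathcal{P}$ such that for all $x\in X$, $u\in\mathcal{U}$: $V(x)>\gamma(\|u\|_{\mathcal{U}})$ implies $\mathrm{D}^+V_u(x)\le-\alpha(V(x))$, where $\mathrm{D}^+V_u(x)=\limsup_{t\to0^+}\frac{V(\phi(t,x,u))-V(x)}{t}$.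 (The $\psi_1,\psi_2$ here need not be those of hypothesis (ii).) **Spectral radius.** $r(\Gamma)=\lim_{n\to\infty}\sup_{s\in\ell_\infty^+,\ \|s\|_{\ell_\infty}=1}\|\Gamma^n(s)\|_{\ell_\infty}^{1/n}$, where $\Gamma^n$ is the $n$-fold composition. *)

theory Defs
  imports "HOL-Analysis.Analysis" "HOL-Probability.Essential_Supremum"
begin

section \<open>Comparison functions\<close>

text \<open>Functions on the half-line are total functions on the reals of which only the
  restriction to \<open>{0..}\<close> matters.\<close>

definition class_P :: "(real \<Rightarrow> real) set" where
  "class_P = {\<alpha>. continuous_on {0..} \<alpha> \<and> \<alpha> 0 = 0 \<and> (\<forall>r>0. \<alpha> r > 0)}"

definition class_K :: "(real \<Rightarrow> real) set" where
  "class_K = {\<alpha> \<in> class_P. strict_mono_on {0..} \<alpha>}"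

definition class_K_inf :: "(real \<Rightarrow> real) set" where
  "class_K_inf = {\<alpha> \<in> class_K. \<forall>C. \<exists>r\<ge>0. \<alpha> r > C}"

definition class_KL :: "(real \<Rightarrow> real \<Rightarrow> real) set" where
  "class_KL = {\<beta>. continuous_on ({0..} \<times> {0..}) (\<lambda>(r, t). \<beta> r t) \<and>
      (\<forall>t\<ge>0. (\<lambda>r. \<beta> r t) \<in> class_K) \<and>
      (\<forall>r>0. strict_antimono_on {0..} (\<beta> r) \<and> (\<beta> r \<longlongrightarrow> 0) at_top)}"


section \<open>Aggregation functions and the spectral radius on the cone of \<open>\<ell>\<^sub>\<infinity>\<close>\<close>

text \<open>The naturals carry the discrete topology, so \<open>nat \<Rightarrow>\<^sub>C real\<close> is the Banach space of
  bounded real sequences with the supremum norm.\<close>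

definition linf_cone :: "(nat \<Rightarrow>\<^sub>C real) set" where
  "linf_cone = {s. \<forall>i. 0 \<le> apply_bcontfun s i}"

definition aggregation_function :: "((nat \<Rightarrow>\<^sub>C real) \<Rightarrow> ennreal) \<Rightarrow> bool" where
  "aggregation_function \<mu> \<longleftrightarrow>
     (\<forall>s\<in>linf_cone. \<forall>c\<ge>0. \<mu> (c *\<^sub>R s) = ennreal c * \<mu> s) \<and>
     (\<forall>r\<in>linf_cone. \<forall>s\<in>linf_cone.
        (\<forall>i. apply_bcontfun r i \<le> apply_bcontfun s i) \<longrightarrow> \<mu> r \<le> \<mu> s) \<and>
     (\<forall>r\<in>linf_cone. \<forall>s\<in>linf_cone. \<mu> (r + s) \<le> \<mu> r + \<mu> s)"

definition aggregated_gain ::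
    "(nat \<Rightarrow> (nat \<Rightarrow>\<^sub>C real) \<Rightarrow> ennreal) \<Rightarrow> (nat \<Rightarrow> nat \<Rightarrow> real) \<Rightarrow> (nat \<Rightarrow> real) \<Rightarrow> nat \<Rightarrow> ennreal" where
  "aggregated_gain \<mu> \<gamma> s i = \<mu> i (Bcontfun (\<lambda>j. \<gamma> i j * s j))"

definition gain_well_defined ::
    "(nat \<Rightarrow> (nat \<Rightarrow>\<^sub>C real) \<Rightarrow> ennreal) \<Rightarrow> (nat \<Rightarrow> nat \<Rightarrow> real) \<Rightarrow> bool" where
  "gain_well_defined \<mu> \<gamma> \<longleftrightarrow>
     (\<forall>s\<in>linf_cone. \<exists>C::real. \<forall>i. aggregated_gain \<mu> \<gamma> (apply_bcontfun s) i \<le> ennreal C)"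

text \<open>Only meaningful under \<^const>\<open>gain_well_defined\<close>.\<close>

definition gain_operator ::
    "(nat \<Rightarrow> (nat \<Rightarrow>\<^sub>C real) \<Rightarrow> ennreal) \<Rightarrow> (nat \<Rightarrow> nat \<Rightarrow> real) \<Rightarrow> (nat \<Rightarrow>\<^sub>C real) \<Rightarrow> (nat \<Rightarrow>\<^sub>C real)" where
  "gain_operator \<mu> \<gamma> s = Bcontfun (\<lambda>i. enn2real (aggregated_gain \<mu> \<gamma> (apply_bcontfun s) i))"

definition cone_spectral_radius :: "((nat \<Rightarrow>\<^sub>C real) \<Rightarrow> (nat \<Rightarrow>\<^sub>C real)) \<Rightarrow> real" where
  "cone_spectral_radius \<Gamma> =
     lim (\<lambda>n. SUP s\<in>{s \<in> linf_cone. norm s = 1}. root n (norm ((\<Gamma> ^^ n) s)))"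


section \<open>Finite-dimensional spaces with varying dimension\<close>

text \<open>A vector of dimension \<open>d\<close> is a real sequence that vanishes from index \<open>d\<close> on. On
  \<open>Rn d\<close> the product topology of \<open>nat \<Rightarrow> real\<close> is the usual topology, so \<^const>\<open>continuous_on\<close>
  has its usual meaning there whichever norm is chosen.\<close>

type_synonym rvec = "nat \<Rightarrow> real"

definition Rn :: "nat \<Rightarrow> rvec set" where
  "Rn d = {v. \<forall>k\<ge>d. v k = 0}"

definition is_norm :: "nat \<Rightarrow> (rvec \<Rightarrow> real) \<Rightarrow> bool" where
  "is_norm d N \<longleftrightarrow>
     (\<forall>v\<in>Rn d. 0 \<le> N v \<and> (N v = 0 \<longleftrightarrow> v = (\<lambda>_. 0))) \<and>
     (\<forall>v\<in>Rn d. \<forall>c. N (\<lambda>k. c * v k) = \<bar>c\<bar> * N v) \<and>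
     (\<forall>v\<in>Rn d. \<forall>w\<in>Rn d. N (\<lambda>k. v k + w k) \<le> N v + N w)"

definition partial_deriv :: "nat \<Rightarrow> (rvec \<Rightarrow> real) \<Rightarrow> rvec \<Rightarrow> real" where
  "partial_deriv k V x = deriv (\<lambda>r. V (x(k := r))) (x k)"

definition C1_off_origin :: "nat \<Rightarrow> (rvec \<Rightarrow> real) \<Rightarrow> bool" where
  "C1_off_origin d V \<longleftrightarrow>
     (\<forall>k<d. (\<forall>x\<in>Rn d - {\<lambda>_. 0}. (\<lambda>r. V (x(k := r))) differentiable (at (x k))) \<and>
            continuous_on (Rn d - {\<lambda>_. 0}) (partial_deriv k V))"

definition gradient_times :: "nat \<Rightarrow> (rvec \<Rightarrow> real) \<Rightarrow> rvec \<Rightarrow> rvec \<Rightarrow> real" where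
  "gradient_times d V x v = (\<Sum>k<d. partial_deriv k V x * v k)"


section \<open>The spaces \<open>\<ell>\<^sub>\<infinity>(\<nat>, (d\<^sub>i))\<close>\<close>

type_synonym seqvec = "nat \<Rightarrow> rvec"

definition linf :: "(nat \<Rightarrow> nat) \<Rightarrow> (nat \<Rightarrow> rvec \<Rightarrow> real) \<Rightarrow> seqvec set" where
  "linf d N = {x. (\<forall>i. x i \<in> Rn (d i)) \<and> bdd_above (range (\<lambda>i. N i (x i)))}"

definition linf_norm :: "(nat \<Rightarrow> rvec \<Rightarrow> real) \<Rightarrow> seqvec \<Rightarrow> real" where
  "linf_norm N x = (SUP i. N i (x i))"

definition diffv :: "seqvec \<Rightarrow> seqvec \<Rightarrow> seqvec" where
  "diffv x y = (\<lambda>i k. x i k - y i k)"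

text \<open>The value 0 outside the carrier is needed because \<^locale>\<open>Metric_space\<close> requires symmetry and
  nonnegativity everywhere.\<close>

definition linf_dist :: "(nat \<Rightarrow> nat) \<Rightarrow> (nat \<Rightarrow> rvec \<Rightarrow> real) \<Rightarrow> seqvec \<Rightarrow> seqvec \<Rightarrow> real" where
  "linf_dist d N x y =
     (if x \<in> linf d N \<and> y \<in> linf d N then linf_norm N (diffv x y) else 0)"

definition linf_metric :: "(nat \<Rightarrow> nat) \<Rightarrow> (nat \<Rightarrow> rvec \<Rightarrow> real) \<Rightarrow> seqvec metric" where
  "linf_metric d N = metric (linf d N, linf_dist d N)"

lemma Metric_space_linf:
  assumes N: "\<And>i. is_norm (d i) (N i)"
  shows "Metric_space (linf d N) (linf_dist d N)"
proof -
  have rn: "(\<lambda>k. v k - w k) \<in> Rn m" if "v \<in> Rn m" "w \<in> Rn m" for v w m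
    using that by (auto simp: Rn_def)
  have neg: "N i (\<lambda>k. v k - w k) = N i (\<lambda>k. w k - v k)" if "v \<in> Rn (d i)" "w \<in> Rn (d i)" for i v w
  proof -
    have "\<forall>c. N i (\<lambda>k. c * (w k - v k)) = \<bar>c\<bar> * N i (\<lambda>k. w k - v k)"
      using N[of i, unfolded is_norm_def, THEN conjunct2, THEN conjunct1] rn[OF that(2,1)]
      by (rule bspec)
    from this[rule_format, of "-1"] show ?thesis by simp
  qed
  have tri: "N i (\<lambda>k. u k - w k) \<le> N i (\<lambda>k. u k - v k) + N i (\<lambda>k. v k - w k)"
    if "u \<in> Rn (d i)" "v \<in> Rn (d i)" "w \<in> Rn (d i)" for i u v w
  proof -
    have "N i (\<lambda>k. (u k - v k) + (v k - w k)) \<le> N i (\<lambda>k. u k - v k) + N i (\<lambda>k. v k - w k)"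
      using N[of i, unfolded is_norm_def, THEN conjunct2, THEN conjunct2,
          THEN bspec, OF rn[OF that(1,2)], THEN bspec, OF rn[OF that(2,3)]] .
    then show ?thesis by simp
  qed
  have nn: "0 \<le> N i v" and z: "N i v = 0 \<longleftrightarrow> v = (\<lambda>_. 0)" if "v \<in> Rn (d i)" for i v
    using N[of i] that unfolding is_norm_def by blast+
  have sub: "N i (\<lambda>k. v k - w k) \<le> N i v + N i w" if "v \<in> Rn (d i)" "w \<in> Rn (d i)" for i v w
  proof -
    have 0: "(\<lambda>_. 0) \<in> Rn (d i)" by (simp add: Rn_def)
    show ?thesis using tri[OF that(1) 0 that(2)] neg[OF 0 that(2)] by simp
  qed
  have bdd: "bdd_above (range (\<lambda>i. N i (diffv x y i)))" if xy: "x \<in> linf d N" "y \<in> linf d N" for x y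
  proof -
    obtain C D where "\<And>i. N i (x i) \<le> C" "\<And>i. N i (y i) \<le> D"
      using xy unfolding linf_def bdd_above_def by blast
    then have "N i (diffv x y i) \<le> C + D" for i
      using sub[of "x i" i "y i"] xy unfolding diffv_def linf_def by (smt (verit) mem_Collect_eq)
    then show ?thesis by (rule bdd_aboveI2)
  qed
  have up: "N i (diffv x y i) \<le> linf_norm N (diffv x y)" if "x \<in> linf d N" "y \<in> linf d N" for x y i
    unfolding linf_norm_def by (rule cSUP_upper[OF UNIV_I bdd[OF that]])
  have mem: "x i \<in> Rn (d i)" if "x \<in> linf d N" for x i using that by (simp add: linf_def)
  have memd: "diffv x y i \<in> Rn (d i)" if "x \<in> linf d N" "y \<in> linf d N" for x y i
    unfolding diffv_def by (intro rn mem that)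
  have pos: "0 \<le> linf_norm N (diffv x y)" if "x \<in> linf d N" "y \<in> linf d N" for x y
    using nn[OF memd[OF that, of 0]] up[OF that, of 0] by linarith
  show ?thesis
  proof
    show "0 \<le> linf_dist d N x y" for x y
      by (auto simp: linf_dist_def intro: pos)
    show "linf_dist d N x y = linf_dist d N y x" for x y
      by (auto simp: linf_dist_def linf_norm_def diffv_def intro!: SUP_cong neg mem)
    show "linf_dist d N x y = 0 \<longleftrightarrow> x = y" if xy: "x \<in> linf d N" "y \<in> linf d N" for x y
    proof
      assume "linf_dist d N x y = 0"
      then have le: "N i (diffv x y i) \<le> 0" for i
        using up[OF xy, of i] xy by (simp add: linf_dist_def)
      have "diffv x y i = (\<lambda>_. 0)" for i
        using le[of i] nn[OF memd[OF xy, of i]] z[OF memd[OF xy, of i]] by simp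
      then have "x i k - y i k = 0" for i k by (simp add: diffv_def fun_eq_iff)
      then show "x = y" by (simp add: fun_eq_iff)
    next
      assume "x = y"
      moreover have "N i (\<lambda>_. 0) = 0" for i using z[of "\<lambda>_. 0" i] by (simp add: Rn_def)
      ultimately show "linf_dist d N x y = 0"
        by (simp add: linf_dist_def linf_norm_def diffv_def)
    qed
    show "linf_dist d N x w \<le> linf_dist d N x y + linf_dist d N y w"
      if xyw: "x \<in> linf d N" "y \<in> linf d N" "w \<in> linf d N" for x y w
    proof -
      have "linf_norm N (diffv x w) \<le> linf_norm N (diffv x y) + linf_norm N (diffv y w)"
        unfolding linf_norm_def[of N "diffv x w"]
      proof (rule cSUP_least)
        fix i
        show "N i (diffv x w i) \<le> linf_norm N (diffv x y) + linf_norm N (diffv y w)"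
          using tri[OF mem[OF xyw(1), of i] mem[OF xyw(2)] mem[OF xyw(3)]]
            up[OF xyw(1,2), of i] up[OF xyw(2,3), of i] by (simp add: diffv_def)
      qed simp
      then show ?thesis using xyw by (simp add: linf_dist_def)
    qed
  qed
qed


section \<open>Bochner integral in \<open>\<ell>\<^sub>\<infinity>(\<nat>, (d\<^sub>i))\<close>\<close>

text \<open>The library's \<^const>\<open>has_bochner_integral\<close> is restricted to second-countable (hence
  separable) types and does not cover these spaces. The definition below is the usual one:
  \<open>g\<close> is strongly measurable, and the integrals of some sequence of integrable simple functions
  that converges to \<open>g\<close> in mean converge to the value. The separate measurability requirement is
  essential, since \<^const>\<open>nn_integral\<close> of a non-measurable function is only a lower integral.\<close>

definition simple_fn_into :: "'t measure \<Rightarrow> seqvec set \<Rightarrow> ('t \<Rightarrow> seqvec) \<Rightarrow> bool" where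
  "simple_fn_into M E s \<longleftrightarrow> simple_function M s \<and> s \<in> space M \<rightarrow> E"

definition strongly_measurable ::
    "'t measure \<Rightarrow> (nat \<Rightarrow> nat) \<Rightarrow> (nat \<Rightarrow> rvec \<Rightarrow> real) \<Rightarrow> ('t \<Rightarrow> seqvec) \<Rightarrow> bool" where
  "strongly_measurable M d N g \<longleftrightarrow>
     g \<in> space M \<rightarrow> linf d N \<and>
     (\<exists>s. (\<forall>m. simple_fn_into M (linf d N) (s m)) \<and>
          (AE t in M. (\<lambda>m. linf_norm N (diffv (g t) (s m t))) \<longlonglongrightarrow> 0))"

definition simple_integral_linf :: "'t measure \<Rightarrow> ('t \<Rightarrow> seqvec) \<Rightarrow> seqvec" where
  "simple_integral_linf M s =
     (\<lambda>i k. \<Sum>y\<in>s ` space M. measure M {t \<in> space M. s t = y} * y i k)"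

definition has_bochner_integral_linf ::
    "'t measure \<Rightarrow> (nat \<Rightarrow> nat) \<Rightarrow> (nat \<Rightarrow> rvec \<Rightarrow> real) \<Rightarrow> ('t \<Rightarrow> seqvec) \<Rightarrow> seqvec \<Rightarrow> bool" where
  "has_bochner_integral_linf M d N g J \<longleftrightarrow>
     strongly_measurable M d N g \<and> J \<in> linf d N \<and>
     (\<exists>s. (\<forall>m. simple_fn_into M (linf d N) (s m) \<and>
               emeasure M {t \<in> space M. s m t \<noteq> (\<lambda>_ _. 0)} < \<infinity>) \<and>
          (\<lambda>m. \<integral>\<^sup>+t. ennreal (linf_norm N (diffv (g t) (s m t))) \<partial>M) \<longlonglongrightarrow> 0 \<and>
          (\<lambda>m. linf_norm N (diffv (simple_integral_linf M (s m)) J)) \<longlonglongrightarrow> 0)"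


section \<open>Infinite networks\<close>

record network =
  state_dim :: "nat \<Rightarrow> nat"
  input_dim :: "nat \<Rightarrow> nat"
  neighbours :: "nat \<Rightarrow> nat set"
  state_norm :: "nat \<Rightarrow> rvec \<Rightarrow> real"
  input_norm :: "nat \<Rightarrow> rvec \<Rightarrow> real"
  rhs :: "nat \<Rightarrow> rvec \<Rightarrow> seqvec \<Rightarrow> rvec \<Rightarrow> rvec"

text \<open>The internal input \<open>(x\<^sub>j)\<^sub>j\<^sub>\<in>\<^sub>I\<close> is a family indexed by all naturals that vanishes outside \<open>I\<close>.\<close>

definition restrict_to :: "nat set \<Rightarrow> seqvec \<Rightarrow> seqvec" where
  "restrict_to I x = (\<lambda>j. if j \<in> I then x j else (\<lambda>_. 0))"

definition internal_inputs :: "network \<Rightarrow> nat \<Rightarrow> seqvec set" where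
  "internal_inputs \<Sigma> i =
     {w. \<forall>j. if j \<in> neighbours \<Sigma> i then w j \<in> Rn (state_dim \<Sigma> j) else w j = (\<lambda>_. 0)}"

definition subsystem_solution ::
    "network \<Rightarrow> nat \<Rightarrow> rvec \<Rightarrow> (real \<Rightarrow> seqvec) \<Rightarrow> (real \<Rightarrow> rvec) \<Rightarrow> ereal \<Rightarrow> (real \<Rightarrow> rvec) \<Rightarrow> bool" where
  "subsystem_solution \<Sigma> i \<xi>0 w v T \<xi> \<longleftrightarrow> 0 < T \<and>
     (\<forall>t. 0 \<le> t \<and> ereal t < T \<longrightarrow> \<xi> t \<in> Rn (state_dim \<Sigma> i) \<and>
        (\<forall>k<state_dim \<Sigma> i.
           integrable (lebesgue_on {0..t}) (\<lambda>s. rhs \<Sigma> i (\<xi> s) (w s) (v s) k) \<and>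
           \<xi> t k = \<xi>0 k + (\<integral>s. rhs \<Sigma> i (\<xi> s) (w s) (v s) k \<partial>lebesgue_on {0..t})))"

text \<open>Boundedness is stated in coordinates, which is the same for every choice of norms because
  only finitely many coordinates of an admissible internal or external input of one subsystem
  are nonzero.\<close>

definition ess_bounded_internal :: "network \<Rightarrow> nat \<Rightarrow> (real \<Rightarrow> seqvec) set" where
  "ess_bounded_internal \<Sigma> i = {w \<in> {0..} \<rightarrow> internal_inputs \<Sigma> i.
     (\<forall>j k. (\<lambda>t. w t j k) \<in> borel_measurable (lebesgue_on {0..})) \<and>
     (\<exists>C. AE t in lebesgue_on {0..}. \<forall>j k. \<bar>w t j k\<bar> \<le> C)}"

definition ess_bounded_external :: "network \<Rightarrow> nat \<Rightarrow> (real \<Rightarrow> rvec) set" where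
  "ess_bounded_external \<Sigma> i = {v \<in> {0..} \<rightarrow> Rn (input_dim \<Sigma> i).
     (\<forall>k. (\<lambda>t. v t k) \<in> borel_measurable (lebesgue_on {0..})) \<and>
     (\<exists>C. AE t in lebesgue_on {0..}. \<forall>k. \<bar>v t k\<bar> \<le> C)}"

definition subsystem_well_posed :: "network \<Rightarrow> nat \<Rightarrow> bool" where
  "subsystem_well_posed \<Sigma> i \<longleftrightarrow>
     (\<forall>\<xi>0\<in>Rn (state_dim \<Sigma> i). \<forall>w\<in>ess_bounded_internal \<Sigma> i. \<forall>v\<in>ess_bounded_external \<Sigma> i.
        (\<exists>T \<xi>. subsystem_solution \<Sigma> i \<xi>0 w v T \<xi>) \<and>
        (\<forall>T1 \<xi>1 T2 \<xi>2. subsystem_solution \<Sigma> i \<xi>0 w v T1 \<xi>1 \<longrightarrow> subsystem_solution \<Sigma> i \<xi>0 w v T2 \<xi>2 \<longrightarrow>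
           (\<forall>t. 0 \<le> t \<and> ereal t < min T1 T2 \<longrightarrow> \<xi>1 t = \<xi>2 t)))"

definition infinite_network :: "network \<Rightarrow> bool" where
  "infinite_network \<Sigma> \<longleftrightarrow> (\<forall>i.
     0 < state_dim \<Sigma> i \<and> 0 < input_dim \<Sigma> i \<and>
     finite (neighbours \<Sigma> i) \<and> i \<notin> neighbours \<Sigma> i \<and>
     is_norm (state_dim \<Sigma> i) (state_norm \<Sigma> i) \<and>
     is_norm (input_dim \<Sigma> i) (input_norm \<Sigma> i) \<and>
     (\<forall>\<xi>\<in>Rn (state_dim \<Sigma> i). \<forall>w\<in>internal_inputs \<Sigma> i. \<forall>v\<in>Rn (input_dim \<Sigma> i).
        rhs \<Sigma> i \<xi> w v \<in> Rn (state_dim \<Sigma> i)) \<and>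
     continuous_on (Rn (state_dim \<Sigma> i) \<times> internal_inputs \<Sigma> i \<times> Rn (input_dim \<Sigma> i))
       (\<lambda>(\<xi>, w, v). rhs \<Sigma> i \<xi> w v) \<and>
     subsystem_well_posed \<Sigma> i)"

abbreviation state_space :: "network \<Rightarrow> seqvec set" where
  "state_space \<Sigma> \<equiv> linf (state_dim \<Sigma>) (state_norm \<Sigma>)"

abbreviation input_space :: "network \<Rightarrow> seqvec set" where
  "input_space \<Sigma> \<equiv> linf (input_dim \<Sigma>) (input_norm \<Sigma>)"

abbreviation normX :: "network \<Rightarrow> seqvec \<Rightarrow> real" where
  "normX \<Sigma> \<equiv> linf_norm (state_norm \<Sigma>)"

abbreviation normU :: "network \<Rightarrow> seqvec \<Rightarrow> real" where
  "normU \<Sigma> \<equiv> linf_norm (input_norm \<Sigma>)"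

abbreviation metricX :: "network \<Rightarrow> seqvec metric" where
  "metricX \<Sigma> \<equiv> linf_metric (state_dim \<Sigma>) (state_norm \<Sigma>)"

abbreviation metricU :: "network \<Rightarrow> seqvec metric" where
  "metricU \<Sigma> \<equiv> linf_metric (input_dim \<Sigma>) (input_norm \<Sigma>)"

definition network_rhs :: "network \<Rightarrow> seqvec \<Rightarrow> seqvec \<Rightarrow> seqvec" where
  "network_rhs \<Sigma> x u = (\<lambda>i. rhs \<Sigma> i (x i) (restrict_to (neighbours \<Sigma> i) x) (u i))"


section \<open>Input functions and solutions\<close>

definition ess_sup_normU :: "network \<Rightarrow> (real \<Rightarrow> seqvec) \<Rightarrow> ereal" where
  "ess_sup_normU \<Sigma> u = esssup (lebesgue_on {0..}) (\<lambda>t. ereal (normU \<Sigma> (u t)))"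

definition piecewise_right_continuous :: "network \<Rightarrow> (real \<Rightarrow> seqvec) \<Rightarrow> bool" where
  "piecewise_right_continuous \<Sigma> u \<longleftrightarrow>
     (\<exists>a::nat \<Rightarrow> real. a 0 = 0 \<and> strict_mono a \<and> (\<Union>k. {a k..<a (Suc k)}) = {0..} \<and>
        (\<forall>k. continuous_map (top_of_set {a k..<a (Suc k)}) (mtopology_of (metricU \<Sigma>)) u))"

definition input_functions :: "network \<Rightarrow> (real \<Rightarrow> seqvec) set" where
  "input_functions \<Sigma> = {u.
     strongly_measurable (lebesgue_on {0..}) (input_dim \<Sigma>) (input_norm \<Sigma>) u \<and>
     ess_sup_normU \<Sigma> u < \<infinity> \<and> piecewise_right_continuous \<Sigma> u}"

definition norm_input :: "network \<Rightarrow> (real \<Rightarrow> seqvec) \<Rightarrow> real" where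
  "norm_input \<Sigma> u = real_of_ereal (ess_sup_normU \<Sigma> u)"

text \<open>\<open>is_solution \<Sigma> x0 u T \<lambda>\<close>: the restriction of \<open>\<lambda>\<close> to \<open>[0, T)\<close> is a solution.\<close>

definition is_solution ::
    "network \<Rightarrow> seqvec \<Rightarrow> (real \<Rightarrow> seqvec) \<Rightarrow> ereal \<Rightarrow> (real \<Rightarrow> seqvec) \<Rightarrow> bool" where
  "is_solution \<Sigma> x0 u T lam \<longleftrightarrow> 0 < T \<and>
     (\<forall>t. 0 \<le> t \<and> ereal t < T \<longrightarrow> lam t \<in> state_space \<Sigma> \<and>
        has_bochner_integral_linf (lebesgue_on {0..t}) (state_dim \<Sigma>) (state_norm \<Sigma>)
          (\<lambda>s. network_rhs \<Sigma> (lam s) (u s)) (diffv (lam t) x0))"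

definition well_posed :: "network \<Rightarrow> bool" where
  "well_posed \<Sigma> \<longleftrightarrow> (\<forall>x0\<in>state_space \<Sigma>. \<forall>u\<in>input_functions \<Sigma>.
     (\<exists>T lam. is_solution \<Sigma> x0 u T lam) \<and>
     (\<forall>T1 lam1 T2 lam2. is_solution \<Sigma> x0 u T1 lam1 \<longrightarrow> is_solution \<Sigma> x0 u T2 lam2 \<longrightarrow>
        (\<forall>t. 0 \<le> t \<and> ereal t < min T1 T2 \<longrightarrow> lam1 t = lam2 t)))"

definition flow :: "network \<Rightarrow> real \<Rightarrow> seqvec \<Rightarrow> (real \<Rightarrow> seqvec) \<Rightarrow> seqvec" where
  "flow \<Sigma> t x0 u = (THE y. \<exists>T lam. is_solution \<Sigma> x0 u T lam \<and> 0 \<le> t \<and> ereal t < T \<and> y = lam t)"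

definition extends_solution ::
    "network \<Rightarrow> seqvec \<Rightarrow> (real \<Rightarrow> seqvec) \<Rightarrow> ereal \<Rightarrow> (real \<Rightarrow> seqvec) \<Rightarrow> ereal \<Rightarrow> bool" where
  "extends_solution \<Sigma> x0 u T lam T' \<longleftrightarrow>
     (\<exists>lam'. is_solution \<Sigma> x0 u T' lam' \<and> (\<forall>t. 0 \<le> t \<and> ereal t < T \<longrightarrow> lam' t = lam t))"

definition bounded_implies_continuation :: "network \<Rightarrow> bool" where
  "bounded_implies_continuation \<Sigma> \<longleftrightarrow>
     (\<forall>x0\<in>state_space \<Sigma>. \<forall>u\<in>input_functions \<Sigma>. \<forall>T lam.
        is_solution \<Sigma> x0 u T lam \<and> T < \<infinity> \<and>
        (\<exists>C. \<forall>t. 0 \<le> t \<and> ereal t < T \<longrightarrow> normX \<Sigma> (lam t) \<le> C) \<longrightarrow>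
        (\<exists>T'>T. extends_solution \<Sigma> x0 u T lam T'))"

definition forward_complete :: "network \<Rightarrow> bool" where
  "forward_complete \<Sigma> \<longleftrightarrow>
     (\<forall>x0\<in>state_space \<Sigma>. \<forall>u\<in>input_functions \<Sigma>. \<forall>T lam.
        is_solution \<Sigma> x0 u T lam \<longrightarrow> extends_solution \<Sigma> x0 u T lam \<infinity>)"


section \<open>Input-to-state stability\<close>

definition iss :: "network \<Rightarrow> bool" where
  "iss \<Sigma> \<longleftrightarrow> well_posed \<Sigma> \<and> forward_complete \<Sigma> \<and>
     (\<exists>\<beta>\<in>class_KL. \<exists>\<kappa>\<in>class_K. \<forall>x\<in>state_space \<Sigma>. \<forall>u\<in>input_functions \<Sigma>. \<forall>t\<ge>0.
        normX \<Sigma> (flow \<Sigma> t x u) \<le> \<beta> (normX \<Sigma> x) t + \<kappa> (norm_input \<Sigma> u))"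

definition upper_right_dini ::
    "network \<Rightarrow> (seqvec \<Rightarrow> real) \<Rightarrow> (real \<Rightarrow> seqvec) \<Rightarrow> seqvec \<Rightarrow> ereal" where
  "upper_right_dini \<Sigma> V u x =
     Limsup (at_right 0) (\<lambda>t. ereal ((V (flow \<Sigma> t x u) - V x) / t))"

definition iss_lyapunov_function :: "network \<Rightarrow> (seqvec \<Rightarrow> real) \<Rightarrow> bool" where
  "iss_lyapunov_function \<Sigma> V \<longleftrightarrow>
     V \<in> state_space \<Sigma> \<rightarrow> {0..} \<and>
     continuous_map (mtopology_of (metricX \<Sigma>)) euclideanreal V \<and>
     (\<exists>\<psi>1\<in>class_K_inf. \<exists>\<psi>2\<in>class_K_inf. \<forall>x\<in>state_space \<Sigma>.
        \<psi>1 (normX \<Sigma> x) \<le> V x \<and> V x \<le> \<psi>2 (normX \<Sigma> x)) \<and>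
     (\<exists>\<gamma>\<in>class_K. \<exists>\<alpha>\<in>class_P. \<forall>x\<in>state_space \<Sigma>. \<forall>u\<in>input_functions \<Sigma>.
        V x > \<gamma> (norm_input \<Sigma> u) \<longrightarrow> upper_right_dini \<Sigma> V u x \<le> ereal (- \<alpha> (V x)))"

end

theory Submission
  imports Defs
begin

text \<open>The function \<open>W x = (SUP i. V\<^sub>i (x\<^sub>i) / s\<^sub>i)\<close> decreases because, at a state \<open>x\<close>, only those
components matter for which \<open>V\<^sub>i (x\<^sub>i)\<close> is close to \<open>s\<^sub>i W x\<close>, and for them the small-gain condition
makes the dissipation inequality applicable. The spectral radius condition provides a sequence
\<open>s \<ge> 1\<close> and a number \<open>c < 1\<close> such that the gain operator maps \<open>s\<close> below \<open>c s\<close>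
(\<open>strict_decay_point\<close>). Since \<open>V\<^sub>j (x\<^sub>j) \<le> s\<^sub>j W x\<close> for all \<open>j\<close>, monotonicity and homogeneity bound
the aggregated gain at index \<open>i\<close> by \<open>c s\<^sub>i W x\<close> (\<open>aggregated_gain_le\<close>). So whenever
\<open>V\<^sub>i (x\<^sub>i)\<close> exceeds \<open>c s\<^sub>i W x\<close> and the input is small compared with \<open>W x\<close>, the value
\<open>V\<^sub>i (x\<^sub>i)\<close> decreases at a rate that is controlled from below by \<open>W x\<close> alone.

The supremum runs over infinitely many indices and need not be attained, so the argument has to be
uniform in \<open>i\<close>. A trajectory is continuous in the supremum norm and the \<open>V\<^sub>i\<close> are equi-Lipschitz on
bounded sets. Hence, on a common short time interval, the components that are within a fixed
fraction of the supremum keep satisfying the dissipation inequality, while the others, which start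
below the supremum by a fixed margin, cannot catch up. This is \<open>W_decay\<close>, the core of the proof.

Trajectories are given by Bochner integrals in a nonseparable space. What is needed of them
is their continuity, for which the modulus of absolute continuity of the integral must be uniform
over the components (\<open>bochner_integral_facts\<close>), and the classical differentiability of each
component between the jumps of the input (\<open>solution_deriv\<close>). The latter allows the ordinary chain
rule for the \<open>C\<^sup>1\<close> functions \<open>V\<^sub>i\<close> (\<open>C1_off_origin_chain\<close>); no nonsmooth calculus enters.

The decay of \<open>W\<close> is established at every time of every solution, not merely at time 0. This
yields the Lyapunov inequality at once, and it also gives input-to-state stability without shifting
solutions and inputs in time: a scalar comparison argument with an explicitly constructed
\<open>\<K>\<L>\<close> function (\<open>class_P_comparison\<close>) bounds \<open>W\<close> along each solution, and this bound
together with the continuation property makes all solutions global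
(\<open>bounded_solutions_imp_global_flow\<close>).\<close>

section \<open>Comparison functions and decay of scalar functions\<close>

text \<open>For \<open>e > 0\<close> the last time at which \<open>v\<close> lies below the line through \<open>(a, v a)\<close> with slope \<open>e\<close>
cannot precede \<open>b\<close>, because the hypothesis extends the estimate a little further. Then \<open>e\<close> tends
to 0.\<close>

lemma dini_nonincreasing:
  fixes v :: "real \<Rightarrow> real"
  assumes ab: "a \<le> b" and cont: "continuous_on {a..b} v"
    and dini: "\<And>t e. a \<le> t \<Longrightarrow> t < b \<Longrightarrow> 0 < e \<Longrightarrow> \<exists>d>0. \<forall>h. 0 < h \<and> h < d \<longrightarrow> v (t + h) \<le> v t + e * h"
  shows "v b \<le> v a"
proof -
  have approx: "v b \<le> v a + e * (b - a)" if e: "0 < e" for e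
  proof -
    define S where "S = {t \<in> {a..b}. v t \<le> v a + e * (t - a)}"
    have "closed S" unfolding S_def
      by (intro continuous_on_closed_Collect_le cont continuous_intros closed_real_atLeastAtMost)
    moreover have "bounded S" by (rule bounded_subset[of "{a..b}"]) (auto simp: S_def)
    ultimately have "compact S" by (simp add: compact_eq_bounded_closed)
    moreover have "a \<in> S" using ab by (simp add: S_def)
    ultimately obtain c where c: "c \<in> S" "\<And>t. t \<in> S \<Longrightarrow> t \<le> c"
      using compact_attains_sup[of S] by blast
    have "c = b"
    proof (rule ccontr)
      assume "c \<noteq> b"
      with c have cb: "a \<le> c" "c < b" by (auto simp: S_def)
      from dini[OF cb e] obtain d where d: "d > 0"
        "\<And>h. 0 < h \<Longrightarrow> h < d \<Longrightarrow> v (c + h) \<le> v c + e * h" by blast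
      define h where "h = min (d / 2) (b - c)"
      have h: "0 < h" "h < d" "c + h \<le> b" using d cb by (auto simp: h_def)
      have "v (c + h) \<le> v a + e * (c + h - a)"
        using d(2)[OF h(1,2)] c(1) by (simp add: S_def algebra_simps)
      then have "c + h \<in> S" using h cb by (simp add: S_def)
      with c(2) h show False by fastforce
    qed
    with c(1) show ?thesis by (simp add: S_def)
  qed
  show ?thesis
  proof (rule field_le_epsilon)
    fix e :: real assume "0 < e"
    \<comment> \<open>the summand 1 keeps the denominator positive when \<open>a = b\<close>\<close>
    define e' where "e' = e / (b - a + 1)"
    have "0 < e'" "e' * (b - a) \<le> e" using \<open>0 < e\<close> ab by (auto simp: e'_def field_simps)
    then show "v b \<le> v a + e" using approx[of e'] by linarith
  qed
qed

lemma class_K_mono: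
  "f \<in> class_K \<Longrightarrow> 0 \<le> x \<Longrightarrow> x \<le> y \<Longrightarrow> f x \<le> f y"
  by (auto simp: class_K_def strict_mono_on_def le_less)

lemma class_K_less:
  "f \<in> class_K \<Longrightarrow> 0 \<le> x \<Longrightarrow> x < y \<Longrightarrow> f x < f y"
  by (auto simp: class_K_def strict_mono_on_def)

lemma class_P_nonneg: "f \<in> class_P \<Longrightarrow> 0 \<le> x \<Longrightarrow> 0 \<le> f x"
  by (cases "x = 0") (auto simp: class_P_def less_imp_le)

lemma class_K_imp_P: "f \<in> class_K \<Longrightarrow> f \<in> class_P"
  by (simp add: class_K_def)

lemma class_K_inf_imp_K: "f \<in> class_K_inf \<Longrightarrow> f \<in> class_K"
  by (simp add: class_K_inf_def)

lemma class_K_scale: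
  assumes "f \<in> class_K" "0 < c" shows "(\<lambda>r. c * f r) \<in> class_K"
  using assms by (auto simp: class_K_def class_P_def strict_mono_on_def intro!: continuous_intros)

lemma class_K_inf_scale:
  assumes "f \<in> class_K_inf" "0 < c" shows "(\<lambda>r. c * f r) \<in> class_K_inf"
proof -
  have "\<exists>r\<ge>0. C < c * f r" for C
  proof -
    obtain r where "r \<ge> 0" "f r > C / c" using assms(1) by (auto simp: class_K_inf_def)
    then show ?thesis using assms(2) by (intro exI[of _ r]) (auto simp: field_simps)
  qed
  then show ?thesis using assms class_K_scale by (auto simp: class_K_inf_def)
qed

lemma class_K_compose:
  assumes f: "f \<in> class_K" and g: "g \<in> class_K"
  shows "(\<lambda>r. f (g r)) \<in> class_K"
proof -
  have g0: "0 \<le> x \<Longrightarrow> 0 \<le> g x" for x using class_P_nonneg[OF class_K_imp_P[OF g]] .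
  have "continuous_on {0..} (\<lambda>r. f (g r))"
    by (rule continuous_on_compose2[of "{0..}" f]) (use f g g0 in \<open>auto simp: class_K_def class_P_def\<close>)
  moreover have "strict_mono_on {0..} (\<lambda>r. f (g r))"
    using class_K_less[OF f] class_K_less[OF g] g0 by (auto simp: strict_mono_on_def)
  ultimately show ?thesis using f g by (auto simp: class_K_def class_P_def)
qed

text \<open>Extended by the identity to the negative half-line, \<open>\<psi>\<close> becomes an increasing bijection of the
whole line. Its inverse is continuous because it is monotone with open range.\<close>

lemma class_K_inf_inverse:
  assumes \<psi>: "\<psi> \<in> class_K_inf"
  obtains \<theta> where "\<theta> \<in> class_K" "\<And>r. 0 \<le> r \<Longrightarrow> \<theta> (\<psi> r) = r" "\<And>r. 0 \<le> r \<Longrightarrow> \<psi> (\<theta> r) = r"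
proof -
  have K: "\<psi> \<in> class_K" using \<psi> by (rule class_K_inf_imp_K)
  \<comment> \<open>the extension by the identity; on the half-line it is \<open>\<psi>\<close>\<close>
  define p where "p r = (if r < 0 then r else \<psi> r)" for r :: real
  have p0: "0 \<le> r \<Longrightarrow> 0 \<le> \<psi> r" for r using class_P_nonneg[OF class_K_imp_P[OF K]] .
  have z: "\<psi> 0 = 0" using K by (simp add: class_K_def class_P_def)
  have smono: "strict_mono p"
  proof (rule strict_monoI)
    fix x y :: real assume "x < y"
    then show "p x < p y"
      using class_K_less[OF K, of x y] p0[of y] by (auto simp: p_def)
  qed
  have ex: "\<exists>r\<ge>0. \<psi> r = y" if "0 \<le> y" for y
  proof -
    obtain b where b: "b \<ge> 0" "\<psi> b > y" using \<psi> by (auto simp: class_K_inf_def)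
    have "continuous_on {0..b} \<psi>"
      by (rule continuous_on_subset[of "{0..}"]) (use K in \<open>auto simp: class_K_def class_P_def\<close>)
    then show ?thesis using IVT'[of \<psi> 0 y b] b that z by auto
  qed
  have "surj p" unfolding surj_def
  proof
    fix y show "\<exists>x. y = p x"
    proof (cases "y < 0")
      case True
      then show ?thesis by (intro exI[of _ y]) (simp add: p_def)
    next
      case False
      then obtain r where "r \<ge> 0" "\<psi> r = y" using ex[of y] by auto
      then show ?thesis by (intro exI[of _ r]) (simp add: p_def)
    qed
  qed
  with smono have bij: "bij p" by (simp add: bij_def strict_mono_imp_inj_on)
  define \<theta> where "\<theta> = inv p"
  have tp: "\<theta> (p x) = x" and pt: "p (\<theta> x) = x" for x
    using bij by (auto simp: \<theta>_def bij_is_inj bij_is_surj surj_f_inv_f)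
  have st: "strict_mono \<theta>"
    unfolding strict_mono_def using smono pt by (metis strict_mono_less)
  have "range \<theta> = UNIV" using tp by (metis surjI)
  then have "continuous_on UNIV \<theta>"
    by (intro continuous_onI_mono) (auto simp: st strict_mono_less_eq)
  moreover have t0: "\<theta> 0 = 0" using tp[of 0] by (simp add: p_def z)
  moreover have "\<theta> r > 0" if "r > 0" for r using st that t0 by (metis strict_mono_less)
  ultimately have tK: "\<theta> \<in> class_K"
    using st continuous_on_subset[of UNIV \<theta> "{0..}"]
    by (simp add: class_K_def class_P_def strict_mono_on_def strict_mono_def)
  show thesis
  proof (rule that[OF tK])
    show "\<theta> (\<psi> r) = r" if "0 \<le> r" for r using tp[of r] that by (simp add: p_def)
    show "\<psi> (\<theta> r) = r" if "0 \<le> r" for r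
      using pt[of r] class_P_nonneg[OF class_K_imp_P[OF tK] that] by (simp add: p_def)
  qed
qed

text \<open>Components of the network dissipate at rates that depend on their own values, which are only known up to
constant factors. The witness is the infimum of \<open>\<alpha> y\<close> plus a penalty for \<open>y\<close> outside
\<open>[a r, b r]\<close>. The penalty makes it Lipschitz in \<open>r\<close> for every \<open>\<alpha>\<close>, and it is positive for \<open>r > 0\<close>
because \<open>\<alpha>\<close> is bounded away from 0 on a compact neighbourhood of \<open>[a r, b r]\<close>.\<close>

lemma class_P_envelope:
  assumes \<alpha>: "\<alpha> \<in> class_P" and ab: "0 < a" "a \<le> b"
  obtains \<alpha>' where "\<alpha>' \<in> class_P" "\<And>r y. 0 \<le> r \<Longrightarrow> a * r \<le> y \<Longrightarrow> y \<le> b * r \<Longrightarrow> \<alpha>' r \<le> \<alpha> y"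
proof -
  define pen where "pen r y = max 0 (max (a * r - y) (y - b * r))" for r y :: real
  define \<alpha>' where "\<alpha>' r = (INF y\<in>{0..}. \<alpha> y + pen r y)" for r
  have nn: "0 \<le> \<alpha> y + pen r y" if "y \<in> {0..}" for r y
    using class_P_nonneg[OF \<alpha>, of y] that by (simp add: pen_def)
  have bb: "bdd_below ((\<lambda>y. \<alpha> y + pen r y) ` {0..})" for r
    by (rule bdd_belowI2[of _ 0]) (rule nn)
  have low: "\<alpha>' r \<le> \<alpha> y + pen r y" if "0 \<le> y" for r y
    unfolding \<alpha>'_def by (rule cINF_lower[OF bb]) (use that in simp)
  have pen_le: "pen r y \<le> pen r' y + b * \<bar>r - r'\<bar>" for r r' y
  proof -
    have "a * r - a * r' \<le> b * \<bar>r - r'\<bar>"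
      using ab mult_right_mono[of a b "\<bar>r - r'\<bar>"] abs_ge_self[of "r - r'"]
        mult_left_mono[of "r - r'" "\<bar>r - r'\<bar>" a] by (simp add: algebra_simps)
    moreover have "b * r' - b * r \<le> b * \<bar>r - r'\<bar>"
      using ab mult_left_mono[of "r' - r" "\<bar>r - r'\<bar>" b] by (simp add: algebra_simps)
    moreover have "0 \<le> b * \<bar>r - r'\<bar>" using ab by simp
    ultimately show ?thesis unfolding pen_def by linarith
  qed
  have lip1: "\<alpha>' r \<le> \<alpha>' r' + b * \<bar>r - r'\<bar>" for r r'
  proof -
    have "\<alpha>' r - b * \<bar>r - r'\<bar> \<le> \<alpha>' r'"
      unfolding \<alpha>'_def[of r']
    proof (rule cINF_greatest)
      fix y :: real assume "y \<in> {0..}"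
      then show "\<alpha>' r - b * \<bar>r - r'\<bar> \<le> \<alpha> y + pen r' y"
        using low[of y r] pen_le[of r y r'] by simp
    qed simp
    then show ?thesis by simp
  qed
  have "b-lipschitz_on {0..} \<alpha>'"
  proof (rule lipschitz_onI)
    show "dist (\<alpha>' x) (\<alpha>' y) \<le> b * dist x y" for x y
      using lip1[of x y] lip1[of y x] by (simp add: dist_real_def abs_minus_commute abs_le_iff)
  qed (use ab in simp)
  then have cont: "continuous_on {0..} \<alpha>'" by (rule lipschitz_on_continuous_on)
  have nonneg: "0 \<le> \<alpha>' r" for r
    unfolding \<alpha>'_def by (rule cINF_greatest) (use nn in auto)
  have "\<alpha>' 0 \<le> 0" using low[of 0 0] \<alpha> by (simp add: pen_def class_P_def)
  with nonneg[of 0] have zero: "\<alpha>' 0 = 0" by simp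
  have pos: "0 < \<alpha>' r" if r: "0 < r" for r
  proof -
    define I where "I = {a * r / 2 .. b * r + a * r / 2}"
    have ar: "0 < a * r" "a * r \<le> b * r" using ab r by auto
    have I: "compact I" "I \<noteq> {}" "I \<subseteq> {0..}" using ar unfolding I_def by auto
    have "continuous_on I \<alpha>"
      by (rule continuous_on_subset[of "{0..}"]) (use \<alpha> I in \<open>auto simp: class_P_def\<close>)
    then obtain z where z: "z \<in> I" "\<And>y. y \<in> I \<Longrightarrow> \<alpha> z \<le> \<alpha> y"
      using continuous_attains_inf[OF I(1,2)] by blast
    have "z > 0" using z(1) ar by (auto simp: I_def)
    then have az: "\<alpha> z > 0" using \<alpha> by (simp add: class_P_def)
    have "min (\<alpha> z) (a * r / 2) \<le> \<alpha>' r"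
      unfolding \<alpha>'_def
    proof (rule cINF_greatest)
      fix y :: real assume y: "y \<in> {0..}"
      show "min (\<alpha> z) (a * r / 2) \<le> \<alpha> y + pen r y"
      proof (cases "y \<in> I")
        case True
        then show ?thesis using z(2)[OF True] by (simp add: pen_def)
      next
        case False
        then have "a * r / 2 \<le> pen r y" by (auto simp: I_def pen_def max_def field_simps)
        then show ?thesis using class_P_nonneg[OF \<alpha>, of y] y by simp
      qed
    qed simp
    then show ?thesis using az ar by linarith
  qed
  show thesis
  proof (rule that)
    show "\<alpha>' \<in> class_P" using cont zero pos by (simp add: class_P_def)
    show "\<alpha>' r \<le> \<alpha> y" if "0 \<le> r" "a * r \<le> y" "y \<le> b * r" for r y
    proof -
      have "0 \<le> y" using that ab by (meson mult_nonneg_nonneg less_imp_le order_trans)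
      then show ?thesis using low[of y r] that by (simp add: pen_def)
    qed
  qed
qed

text \<open>This is the differential inequality \<open>w' \<le> - \<alpha> (w)\<close>, required only where \<open>w\<close> exceeds \<open>g\<close>, for right
difference quotients. There is no error term: the quotients themselves, and not only
their limit superior, satisfy the bound.\<close>

definition decays_above :: "(real \<Rightarrow> real) \<Rightarrow> real \<Rightarrow> real \<Rightarrow> (real \<Rightarrow> real) \<Rightarrow> bool" where
  "decays_above \<alpha> g T w \<longleftrightarrow> (\<forall>t. 0 \<le> t \<and> t < T \<and> g < w t \<longrightarrow>
     (\<exists>d>0. \<forall>h. 0 < h \<and> h < d \<longrightarrow> w (t + h) \<le> w t - h * \<alpha> (w t)))"

lemma decays_aboveD:
  assumes "decays_above \<alpha> g T w" "0 \<le> t" "t < T" "g < w t"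
  obtains d where "d > 0" "\<And>h. 0 < h \<Longrightarrow> h < d \<Longrightarrow> w (t + h) \<le> w t - h * \<alpha> (w t)"
  using assms unfolding decays_above_def by metis

text \<open>After the last time at which \<open>w \<le> g\<close>, the function would be nonincreasing, so it could not climb
above \<open>g\<close> again.\<close>

lemma decays_above_stays_above:
  assumes \<alpha>: "\<alpha> \<in> class_P" and g: "0 \<le> g" and cont: "continuous_on {0..T} w"
    and decay: "decays_above \<alpha> g T w" and T: "g < w T" and s: "0 \<le> s" "s \<le> T"
  shows "g < w s"
proof (rule ccontr)
  assume "\<not> g < w s"
  define S where "S = {t \<in> {0..T}. w t \<le> g}"
  have "closed S" unfolding S_def
    by (intro continuous_on_closed_Collect_le cont continuous_intros closed_real_atLeastAtMost)
  moreover have "bounded S" by (rule bounded_subset[of "{0..T}"]) (auto simp: S_def)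
  ultimately have "compact S" by (simp add: compact_eq_bounded_closed)
  moreover have "s \<in> S" using s \<open>\<not> g < w s\<close> by (simp add: S_def)
  ultimately obtain c where c: "c \<in> S" "\<And>t. t \<in> S \<Longrightarrow> t \<le> c"
    using compact_attains_sup[of S] by blast
  have c1: "0 \<le> c" "c \<le> T" "w c \<le> g" using c(1) by (auto simp: S_def)
  with T have cT: "c < T" by (cases "c = T") auto
  have above: "g < w t" if "c < t" "t \<le> T" for t
    using c(2)[of t] that c1 unfolding S_def by force
  have step: "w T \<le> w c'" if c': "c < c'" "c' < T" for c'
  proof (rule dini_nonincreasing[where v = w])
    show "continuous_on {c'..T} w" using cont by (rule continuous_on_subset) (use c' c1 in auto)
    fix t e :: real assume t: "c' \<le> t" "t < T" and e: "0 < e"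
    have wt: "0 \<le> t" "g < w t" using above[of t] c' t c1 by auto
    obtain d where d: "d > 0" "\<And>h. 0 < h \<Longrightarrow> h < d \<Longrightarrow> w (t + h) \<le> w t - h * \<alpha> (w t)"
      using decays_aboveD[OF decay wt(1) t(2) wt(2)] by blast
    have "0 \<le> \<alpha> (w t)" using wt g by (intro class_P_nonneg[OF \<alpha>]) simp
    then have "w (t + h) \<le> w t + e * h" if "0 < h" "h < d" for h
      using d(2)[OF that] mult_nonneg_nonneg[of h "\<alpha> (w t)"] mult_pos_pos[of e h] that e by linarith
    with d(1) show "\<exists>d>0. \<forall>h. 0 < h \<and> h < d \<longrightarrow> w (t + h) \<le> w t + e * h" by blast
  qed (use c' in simp)
  have "continuous_on {c..T} w" using cont by (rule continuous_on_subset) (use c1 in auto)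
  moreover have "0 < w T - w c" using T c1 by simp
  ultimately obtain d where d: "d > 0"
    "\<And>t. t \<in> {c..T} \<Longrightarrow> dist t c < d \<Longrightarrow> dist (w t) (w c) < w T - w c"
    using cT unfolding continuous_on_iff by (metis atLeastAtMost_iff less_imp_le order_refl)
  define c' where "c' = c + min (d / 2) ((T - c) / 2)"
  have m: "0 < min (d / 2) ((T - c) / 2)" "min (d / 2) ((T - c) / 2) < d"
    "min (d / 2) ((T - c) / 2) < T - c"
    using d cT by (auto simp: min_less_iff_disj)
  have c': "c < c'" "c' < T" "dist c' c < d" using m by (auto simp: c'_def dist_real_def)
  have "w c' < w T" using d(2)[of c'] c' by (auto simp: dist_real_def)
  with step[OF c'(1,2)] show False by simp
qed

text \<open>Up to a constant, \<open>\<eta> r - \<eta> s\<close> is the time that the scalar equation \<open>r' = - min (\<alpha> r) r\<close> needs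
to get from \<open>r\<close> to \<open>s\<close>. The minimum with the identity ensures that 0 is not reached in
finite time: the last conclusion shows that \<open>\<eta>\<close> tends to minus infinity at 0.\<close>

lemma class_P_rate_antiderivative:
  assumes \<alpha>: "\<alpha> \<in> class_P"
  obtains \<eta> :: "real \<Rightarrow> real" where
    "\<And>r. 0 < r \<Longrightarrow> (\<eta> has_real_derivative 1 / min (\<alpha> r) r) (at r)"
    "\<And>r s. 0 < r \<Longrightarrow> r < s \<Longrightarrow> \<eta> r < \<eta> s"
    "\<And>r. 0 < r \<Longrightarrow> r \<le> 1 \<Longrightarrow> \<eta> r \<le> \<eta> 1 + ln r"
proof -
  define f where "f r = 1 / min (\<alpha> r) r" for r
  have pos: "0 < min (\<alpha> r) r" if "0 < r" for r using \<alpha> that by (simp add: class_P_def)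
  have "isCont f r" if r: "0 < r" for r
  proof -
    have "continuous_on {0<..} \<alpha>"
      by (rule continuous_on_subset[of "{0..}"]) (use \<alpha> in \<open>auto simp: class_P_def\<close>)
    then have "isCont \<alpha> r" using r by (simp add: continuous_on_eq_continuous_at)
    then show ?thesis unfolding f_def using pos[OF r] by (intro continuous_intros) auto
  qed
  then have "\<exists>F. \<forall>r::real. 0 < ereal r \<longrightarrow> ereal r < \<infinity> \<longrightarrow> (F has_vector_derivative f r) (at r)"
    by (intro einterval_antiderivative) auto
  then obtain \<eta> where \<eta>: "\<And>r. 0 < r \<Longrightarrow> (\<eta> has_real_derivative f r) (at r)"
    by (auto simp: has_real_derivative_iff_has_vector_derivative)
  show thesis
  proof (rule that[of \<eta>])
    show "\<And>r. 0 < r \<Longrightarrow> (\<eta> has_real_derivative 1 / min (\<alpha> r) r) (at r)"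
      using \<eta> by (simp add: f_def)
    show "\<eta> r < \<eta> s" if "0 < r" "r < s" for r s
    proof (rule DERIV_pos_imp_increasing[OF that(2)])
      fix x assume "r \<le> x" "x \<le> s"
      then show "\<exists>y. DERIV \<eta> x :> y \<and> 0 < y"
        using \<eta>[of x] pos[of x] that by (intro exI[of _ "f x"]) (auto simp: f_def)
    qed
    show "\<eta> r \<le> \<eta> 1 + ln r" if r: "0 < r" "r \<le> 1" for r
    proof -
      have "\<eta> r - ln r \<le> \<eta> 1 - ln 1"
      proof (rule DERIV_nonneg_imp_nondecreasing[OF r(2)])
        fix x assume x: "r \<le> x" "x \<le> 1"
        then have x0: "0 < x" using r by simp
        have "((\<lambda>r. \<eta> r - ln r) has_real_derivative (f x - 1 / x)) (at x)"
          by (auto intro!: derivative_eq_intros \<eta> x0)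
        moreover have "1 / x \<le> f x"
          unfolding f_def using pos[OF x0] x0 by (intro divide_left_mono) auto
        ultimately show "\<exists>y. ((\<lambda>r. \<eta> r - ln r) has_real_derivative y) (at x) \<and> 0 \<le> y"
          by (intro exI[of _ "f x - 1 / x"]) simp
      qed
      then show ?thesis by simp
    qed
  qed
qed

text \<open>The witness \<open>\<beta> r t = \<eta>\<inverse> (\<eta> r - t)\<close> is the flow of the scalar equation \<open>r' = - min (\<alpha> r) r\<close>.
Along \<open>w\<close> the function \<open>\<eta> (w t) + t\<close> is nonincreasing, and inverting \<open>\<eta>\<close> gives the bound.\<close>

lemma class_P_comparison:
  assumes \<alpha>: "\<alpha> \<in> class_P"
  obtains \<beta> where "\<beta> \<in> class_KL"
    "\<And>w T g. 0 \<le> T \<Longrightarrow> 0 \<le> g \<Longrightarrow> continuous_on {0..T} w \<Longrightarrow> decays_above \<alpha> g T w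
       \<Longrightarrow> g < w T \<Longrightarrow> w T \<le> \<beta> (w 0) T"
proof -
  obtain \<eta> :: "real \<Rightarrow> real" where
    deriv: "\<And>r. 0 < r \<Longrightarrow> (\<eta> has_real_derivative 1 / min (\<alpha> r) r) (at r)"
    and mono: "\<And>r s. 0 < r \<Longrightarrow> r < s \<Longrightarrow> \<eta> r < \<eta> s"
    and low: "\<And>r. 0 < r \<Longrightarrow> r \<le> 1 \<Longrightarrow> \<eta> r \<le> \<eta> 1 + ln r"
    using class_P_rate_antiderivative[OF \<alpha>] by blast
  have mono_iff: "\<eta> r < \<eta> s \<longleftrightarrow> r < s" and mono_le: "\<eta> r \<le> \<eta> s \<longleftrightarrow> r \<le> s" if "0 < r" "0 < s" for r s
    using mono[of r s] mono[of s r] that by (cases r s rule: linorder_cases; force)+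
  have cont: "isCont \<eta> r" if "0 < r" for r using DERIV_isCont[OF deriv[OF that]] .
  have tiny: "\<exists>x>0. x \<le> r \<and> \<eta> x \<le> y" if "0 < r" for r y
  proof -
    \<comment> \<open>small enough for the logarithmic bound to push \<open>\<eta>\<close> below \<open>y\<close>\<close>
    define x where "x = min r (min 1 (exp (y - \<eta> 1)))"
    have x: "0 < x" "x \<le> 1" "x \<le> r" "x \<le> exp (y - \<eta> 1)" using that by (auto simp: x_def)
    have "ln x \<le> y - \<eta> 1" using x ln_le_cancel_iff[of x "exp (y - \<eta> 1)"] by simp
    with low[OF x(1,2)] x show ?thesis by (intro exI[of _ x]) simp
  qed
  have ex: "\<exists>x>0. x \<le> r \<and> \<eta> x = y" if r: "0 < r" "y \<le> \<eta> r" for r y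
  proof -
    obtain x where x: "x > 0" "x \<le> r" "\<eta> x \<le> y" using tiny[OF r(1)] by blast
    have "continuous_on {x..r} \<eta>" using x by (auto intro!: continuous_at_imp_continuous_on cont)
    then obtain z where "x \<le> z" "z \<le> r" "\<eta> z = y" using IVT'[of \<eta> x y r] x r by blast
    with x show ?thesis by (intro exI[of _ z]) simp
  qed
  define \<theta> where "\<theta> y = (THE x. 0 < x \<and> \<eta> x = y)" for y
  have \<theta>\<eta>: "\<theta> (\<eta> x) = x" if "0 < x" for x
    unfolding \<theta>_def
  proof (rule the_equality)
    show "y = x" if "0 < y \<and> \<eta> y = \<eta> x" for y
      using mono_le[of x y] mono_le[of y x] that \<open>0 < x\<close> by simp
  qed (use that in simp)
  have \<theta>_le: "0 < \<theta> y" "\<theta> y \<le> r" "\<eta> (\<theta> y) = y" if "0 < r" "y \<le> \<eta> r" for r y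
    using ex[OF that] \<theta>\<eta> by auto
  have \<theta>_cont: "isCont \<theta> (\<eta> x)" if x: "0 < x" for x
  proof (rule isCont_inverse_function[where f = \<eta> and x = x and d = "x / 2"])
    show "0 < x / 2" using x by simp
    show "\<theta> (\<eta> z) = z" if "\<bar>z - x\<bar> \<le> x / 2" for z
    proof -
      have "0 < z" using that x by linarith
      then show ?thesis by (rule \<theta>\<eta>)
    qed
    show "isCont \<eta> z" if "\<bar>z - x\<bar> \<le> x / 2" for z
    proof -
      have "0 < z" using that x by linarith
      then show ?thesis by (rule cont)
    qed
  qed
  define \<beta> where "\<beta> r t = (if r \<le> 0 then 0 else \<theta> (\<eta> r - t))" for r t
  have \<beta>: "0 < \<beta> r t" "\<beta> r t \<le> r" "\<eta> (\<beta> r t) = \<eta> r - t" if "0 < r" "0 \<le> t" for r t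
    using \<theta>_le[of r "\<eta> r - t"] that by (auto simp: \<beta>_def)
  have \<beta>0: "\<beta> 0 t = 0" for t by (simp add: \<beta>_def)
  have joint: "continuous_on ({0..} \<times> {0..}) (\<lambda>(r, t). \<beta> r t)"
    unfolding continuous_on_def
  proof
    fix p :: "real \<times> real" assume "p \<in> {0..} \<times> {0..}"
    then obtain r t where p: "p = (r, t)" "0 \<le> r" "0 \<le> t" by auto
    let ?F = "at p within {0..} \<times> {0..}"
    have fst: "(fst \<longlongrightarrow> r) ?F" and snd: "(snd \<longlongrightarrow> t) ?F"
      using tendsto_fst[OF tendsto_ident_at, of p "{0..} \<times> {0..}"]
        tendsto_snd[OF tendsto_ident_at, of p "{0..} \<times> {0..}"] p by auto
    have dom: "\<forall>\<^sub>F q in ?F. q \<in> {0..} \<times> {0..}" by (simp add: eventually_at_filter)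
    show "((\<lambda>(r, t). \<beta> r t) \<longlongrightarrow> (case p of (r, t) \<Rightarrow> \<beta> r t)) ?F"
    proof (cases "r = 0")
      case True
      have bnd: "0 \<le> \<beta> a b" "\<beta> a b \<le> a" if "0 \<le> a" "0 \<le> b" for a b
        using \<beta>[of a b] that by (cases "a = 0"; simp add: \<beta>0)+
      have "((\<lambda>(r, t). \<beta> r t) \<longlongrightarrow> 0) ?F"
      proof (rule tendsto_sandwich[where f = "\<lambda>_. 0" and h = fst])
        show "\<forall>\<^sub>F q in ?F. 0 \<le> (case q of (r, t) \<Rightarrow> \<beta> r t)"
          using dom by eventually_elim (auto simp: bnd)
        show "\<forall>\<^sub>F q in ?F. (case q of (r, t) \<Rightarrow> \<beta> r t) \<le> fst q"
          using dom by eventually_elim (auto simp: bnd)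
        show "(fst \<longlongrightarrow> 0) ?F" using fst True by simp
      qed simp
      then show ?thesis using True p by (simp add: \<beta>0)
    next
      case False
      then have r: "0 < r" using p by simp
      have "((\<lambda>q. \<eta> (fst q) - snd q) \<longlongrightarrow> \<eta> r - t) ?F"
        by (intro tendsto_diff isCont_tendsto_compose[OF cont[OF r] fst] snd)
      moreover have "isCont \<theta> (\<eta> r - t)"
        using \<theta>_cont[OF \<beta>(1)[OF r p(3)]] \<beta>(3)[OF r p(3)] by simp
      ultimately have "((\<lambda>q. \<theta> (\<eta> (fst q) - snd q)) \<longlongrightarrow> \<theta> (\<eta> r - t)) ?F"
        by (rule isCont_tendsto_compose[rotated])
      moreover have "\<forall>\<^sub>F q in ?F. 0 < fst q" using order_tendstoD(1)[OF fst r] .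
      then have "\<forall>\<^sub>F q in ?F. \<theta> (\<eta> (fst q) - snd q) = (case q of (r, t) \<Rightarrow> \<beta> r t)"
        by eventually_elim (auto simp: \<beta>_def)
      ultimately show ?thesis using p r by (simp add: \<beta>_def[of r] Lim_transform_eventually)
    qed
  qed
  have KL: "\<beta> \<in> class_KL"
    unfolding class_KL_def
  proof (intro CollectI conjI allI impI)
    show "continuous_on ({0..} \<times> {0..}) (\<lambda>(r, t). \<beta> r t)" by (rule joint)
  next
    fix t :: real assume t: "0 \<le> t"
    have "continuous_on {0..} ((\<lambda>(r, t). \<beta> r t) \<circ> (\<lambda>r. (r, t)))"
      by (rule continuous_on_compose)
        (use t in \<open>auto intro!: continuous_intros continuous_on_subset[OF joint]\<close>)
    moreover have "\<beta> r t < \<beta> s t" if "0 \<le> r" "r < s" for r s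
    proof (cases "r = 0")
      case True then show ?thesis using \<beta>[of s t] that t by (simp add: \<beta>0)
    next
      case False
      then have "\<eta> (\<beta> r t) < \<eta> (\<beta> s t)" using \<beta>[of r t] \<beta>[of s t] mono[of r s] that t by simp
      then show ?thesis using mono_iff[OF \<beta>(1) \<beta>(1)] False that t by simp
    qed
    ultimately show "(\<lambda>r. \<beta> r t) \<in> class_K"
      using \<beta>(1) t by (auto simp: class_K_def class_P_def strict_mono_on_def \<beta>0 o_def)
  next
    fix r :: real assume r: "0 < r"
    have dec: "\<beta> r t < \<beta> r s" if "0 \<le> s" "s < t" for s t
    proof -
      have "\<eta> (\<beta> r t) < \<eta> (\<beta> r s)" using \<beta>[OF r, of t] \<beta>[OF r, of s] that by simp
      then show ?thesis using mono_iff[OF \<beta>(1) \<beta>(1)] r that by simp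
    qed
    then show "strict_antimono_on {0..} (\<beta> r)" by (auto simp: monotone_on_def)
    show "(\<beta> r \<longlongrightarrow> 0) at_top"
    proof (rule order_tendstoI)
      fix a :: real assume "a < 0"
      show "\<forall>\<^sub>F t in at_top. a < \<beta> r t"
        using eventually_ge_at_top[of 0] by eventually_elim (use \<beta>(1)[OF r] \<open>a < 0\<close> in force)
    next
      fix a :: real assume a: "0 < a"
      have "\<forall>\<^sub>F t in at_top. t > max 0 (\<eta> r - \<eta> a)" by (rule eventually_gt_at_top)
      then show "\<forall>\<^sub>F t in at_top. \<beta> r t < a"
      proof eventually_elim
        case (elim t)
        then have "0 \<le> t" "\<eta> (\<beta> r t) < \<eta> a" using \<beta>(3)[OF r, of t] by auto
        then show ?case using mono_iff[OF \<beta>(1)[OF r] a] by simp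
      qed
    qed
  qed
  show thesis
  proof (rule that[OF KL])
    fix w :: "real \<Rightarrow> real" and T g :: real
    assume T: "0 \<le> T" and g: "0 \<le> g" and cw: "continuous_on {0..T} w"
      and decay: "decays_above \<alpha> g T w" and wT: "g < w T"
    have above: "g < w t" if "0 \<le> t" "t \<le> T" for t
      using decays_above_stays_above[OF \<alpha> g cw decay wT that] .
    have "\<eta> (w T) + T \<le> \<eta> (w 0) + 0"
    proof (rule dini_nonincreasing[where v = "\<lambda>t. \<eta> (w t) + t", OF T])
      have "continuous_on {0<..} \<eta>" by (auto intro!: continuous_at_imp_continuous_on cont)
      then have "continuous_on {0..T} (\<lambda>t. \<eta> (w t))"
        by (rule continuous_on_compose2[OF _ cw]) (use above g in fastforce)
      then show "continuous_on {0..T} (\<lambda>t. \<eta> (w t) + t)" by (intro continuous_intros)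
    next
      fix t e :: real assume t: "0 \<le> t" "t < T" and e: "0 < e"
      define r where "r = w t"
      define m where "m = min (\<alpha> r) r"
      have r: "g < r" "0 < r" using above[of t] t g by (auto simp: r_def)
      have m: "0 < m" "m \<le> \<alpha> r" using \<alpha> r by (auto simp: m_def class_P_def)
      obtain d where d: "d > 0" "\<And>h. 0 < h \<Longrightarrow> h < d \<Longrightarrow> w (t + h) \<le> r - h * \<alpha> r"
        using decays_aboveD[OF decay t] r unfolding r_def by blast
      have "((\<lambda>h. \<eta> (r - h * m)) has_real_derivative (1 / min (\<alpha> r) r) * (- m)) (at 0)"
        by (rule DERIV_chain2) (auto intro!: derivative_eq_intros simp: deriv[OF r(2)])
      then have "((\<lambda>h. \<eta> (r - h * m)) has_real_derivative - 1) (at 0)"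
        using m(1) unfolding m_def[symmetric] by simp
      then have "((\<lambda>h. (\<eta> (r - h * m) - \<eta> r) / h) \<longlongrightarrow> - 1) (at 0)"
        by (simp add: has_field_derivative_iff)
      then have "\<forall>\<^sub>F h in at 0. (\<eta> (r - h * m) - \<eta> r) / h < - 1 + e"
        by (rule order_tendstoD) (use e in simp)
      then obtain d2 where d2: "d2 > 0"
        "\<And>h. h \<noteq> 0 \<Longrightarrow> \<bar>h\<bar> < d2 \<Longrightarrow> (\<eta> (r - h * m) - \<eta> r) / h < - 1 + e"
        by (auto simp: eventually_at dist_real_def)
      define d3 where "d3 = min d (min d2 (T - t))"
      have "\<eta> (w (t + h)) + (t + h) \<le> \<eta> (w t) + t + e * h" if h: "0 < h" "h < d3" for h
      proof -
        have hd: "h < d" "\<bar>h\<bar> < d2" "t + h \<le> T" using h by (auto simp: d3_def)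
        have "h * m \<le> h * \<alpha> r" using h m by simp
        then have "w (t + h) \<le> r - h * m" using d(2)[OF h(1) hd(1)] by linarith
        moreover have "0 < w (t + h)" using above[of "t + h"] g t h hd by simp
        ultimately have "\<eta> (w (t + h)) \<le> \<eta> (r - h * m)" by (subst mono_le) auto
        moreover have "\<eta> (r - h * m) - \<eta> r < (- 1 + e) * h"
          using d2(2)[of h] h hd by (simp add: divide_less_eq)
        ultimately show ?thesis by (simp add: r_def algebra_simps)
      qed
      moreover have "d3 > 0" using d(1) d2(1) t by (simp add: d3_def)
      ultimately show "\<exists>d>0. \<forall>h. 0 < h \<and> h < d \<longrightarrow> \<eta> (w (t + h)) + (t + h) \<le> \<eta> (w t) + t + e * h"
        by blast
    qed
    moreover have w0: "0 < w 0" "0 < w T" using above[of 0] above[of T] T g by auto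
    ultimately have "\<eta> (w T) \<le> \<eta> (\<beta> (w 0) T)" using \<beta>(3)[OF w0(1) T] by simp
    then show "w T \<le> \<beta> (w 0) T" using mono_le w0 \<beta>(1)[OF w0(1) T] by simp
  qed
qed

lemma class_KL_compose:
  assumes \<beta>: "\<beta> \<in> class_KL" and f: "f \<in> class_K" and g: "g \<in> class_K"
  shows "(\<lambda>r t. f (\<beta> (g r) t)) \<in> class_KL"
proof -
  have g0: "0 \<le> x \<Longrightarrow> 0 \<le> g x" for x using class_P_nonneg[OF class_K_imp_P[OF g]] .
  have gp: "0 < x \<Longrightarrow> 0 < g x" for x using g by (simp add: class_K_def class_P_def)
  have \<beta>K: "0 \<le> t \<Longrightarrow> (\<lambda>r. \<beta> r t) \<in> class_K" for t using \<beta> by (simp add: class_KL_def)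
  have \<beta>0: "0 \<le> \<beta> r t" if "0 \<le> r" "0 \<le> t" for r t
    using class_P_nonneg[OF class_K_imp_P[OF \<beta>K[OF that(2)]] that(1)] .
  have cg: "continuous_on {0..} g" and cf: "continuous_on {0..} f"
    using f g by (auto simp: class_K_def class_P_def)
  have c1: "continuous_on ({0..} \<times> {0..}) (\<lambda>p. (g (fst p), snd p))"
    by (intro continuous_intros continuous_on_compose2[OF cg]) auto
  have "continuous_on ({0..} \<times> {0..}) (\<lambda>p. (\<lambda>(r, t). \<beta> r t) (g (fst p), snd p))"
    by (rule continuous_on_compose2[OF _ c1, of "{0..} \<times> {0..}"])
      (use \<beta> g0 in \<open>auto simp: class_KL_def\<close>)
  then have "continuous_on ({0..} \<times> {0..}) (\<lambda>p. f (\<beta> (g (fst p)) (snd p)))"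
    by (intro continuous_on_compose2[OF cf]) (auto intro!: \<beta>0 g0)
  then have "continuous_on ({0..} \<times> {0..}) (\<lambda>(r, t). f (\<beta> (g r) t))"
    by (simp add: case_prod_beta)
  moreover have "(\<lambda>r. f (\<beta> (g r) t)) \<in> class_K" if "0 \<le> t" for t
    using class_K_compose[OF class_K_compose[OF f \<beta>K[OF that]] g] .
  moreover have "strict_antimono_on {0..} (\<lambda>t. f (\<beta> (g r) t))" if r: "0 < r" for r
  proof -
    have "strict_antimono_on {0..} (\<beta> (g r))" using \<beta> gp[OF r] by (simp add: class_KL_def)
    then show ?thesis
      using class_K_less[OF f] \<beta>0 gp[OF r] by (simp add: monotone_on_def)
  qed
  moreover have "((\<lambda>t. f (\<beta> (g r) t)) \<longlongrightarrow> 0) at_top" if r: "0 < r" for r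
  proof -
    have b: "(\<beta> (g r) \<longlongrightarrow> 0) at_top" using \<beta> gp[OF r] by (simp add: class_KL_def)
    have "\<forall>\<^sub>F t in at_top. \<beta> (g r) t \<in> {0..}"
      using eventually_ge_at_top[of 0] by eventually_elim (use \<beta>0 gp[OF r] in simp)
    with b have "((\<lambda>t. f (\<beta> (g r) t)) \<longlongrightarrow> f 0) at_top"
      by (intro continuous_on_tendsto_compose[OF cf]) auto
    then show ?thesis using f by (simp add: class_K_def class_P_def)
  qed
  ultimately show ?thesis by (simp add: class_KL_def)
qed

section \<open>Spectral radius and a point of strict decay\<close>

text \<open>Fekete's lemma in multiplicative form. Splitting \<open>n = q N + r\<close> gives \<open>a n \<le> a N ^ q * a r\<close>, and
the factor \<open>a r\<close>, which ranges over finitely many values, disappears under the \<open>n\<close>-th root.\<close>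

lemma submultiplicative_root_convergent:
  fixes a :: "nat \<Rightarrow> real"
  assumes nonneg: "\<And>n. 0 \<le> a n" and submult: "\<And>m n. a (m + n) \<le> a m * a n"
  shows "convergent (\<lambda>n. root n (a n))"
proof -
  define \<rho> where "\<rho> = (INF n\<in>{1..}. root n (a n))"
  have r0: "0 \<le> root n (a n)" for n using nonneg[of n] by (cases "n = 0") auto
  have bb: "bdd_below ((\<lambda>n. root n (a n)) ` {1..})" by (rule bdd_belowI2[of _ 0]) (rule r0)
  have \<rho>0: "0 \<le> \<rho>" unfolding \<rho>_def by (rule cINF_greatest) (use r0 in auto)
  have upper: "\<forall>\<^sub>F n in sequentially. root n (a n) < \<rho> + 2 * e" if e: "0 < e" for e
  proof -
    define K where "K = \<rho> + e"
    have K: "0 < K" using \<rho>0 e by (simp add: K_def)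
    obtain N where N: "1 \<le> N" "root N (a N) < K"
      using cINF_less_iff[OF _ bb, of K] e unfolding \<rho>_def[symmetric] K_def by auto
    have aN: "a N \<le> K ^ N"
    proof -
      have "a N = root N (a N) ^ N" using N nonneg by (simp add: real_root_pow_pos2)
      also have "\<dots> \<le> K ^ N" using N r0 by (intro power_mono) auto
      finally show ?thesis .
    qed
    \<comment> \<open>The summand 1 keeps \<open>C\<close> positive, as the convergence of its roots to 1 requires.\<close>
    define C where "C = 1 + (\<Sum>r<N. a r / K ^ r)"
    have Cr: "a r / K ^ r \<le> C" if "r < N" for r
    proof -
      have "a r / K ^ r \<le> (\<Sum>r<N. a r / K ^ r)"
        by (rule member_le_sum) (use that nonneg K in auto)
      then show ?thesis by (simp add: C_def)
    qed
    have C: "0 < C" unfolding C_def using nonneg K by (intro add_pos_nonneg sum_nonneg) auto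
    have mult: "a (q * N + r) \<le> C * K ^ (q * N + r)" if "r < N" for q r
    proof (induction q)
      case 0
      then show ?case using Cr[OF that] K by (simp add: field_simps)
    next
      case (Suc q)
      have "a (Suc q * N + r) \<le> a N * a (q * N + r)"
        using submult[of N "q * N + r"] by (simp add: algebra_simps)
      also have "\<dots> \<le> K ^ N * (C * K ^ (q * N + r))"
        by (intro mult_mono Suc aN nonneg) (use K in auto)
      finally show ?case by (simp add: power_add algebra_simps)
    qed
    have bound: "a n \<le> C * K ^ n" for n
      using mult[of "n mod N" "n div N"] N by simp
    have "(\<lambda>n. root n C * K) \<longlonglongrightarrow> 1 * K" by (intro tendsto_mult LIMSEQ_root_const C tendsto_const)
    then have "\<forall>\<^sub>F n in sequentially. root n C * K < \<rho> + 2 * e"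
      by (rule order_tendstoD) (use e in \<open>simp add: K_def\<close>)
    then show ?thesis
      using eventually_ge_at_top[of 1]
    proof eventually_elim
      case (elim n)
      have "root n (a n) \<le> root n (C * K ^ n)" using bound elim by simp
      also have "\<dots> = root n C * K" using elim K by (simp add: real_root_mult real_root_power_cancel)
      finally show ?case using elim by simp
    qed
  qed
  have "(\<lambda>n. root n (a n)) \<longlonglongrightarrow> \<rho>"
  proof (rule order_tendstoI)
    fix y assume "y < \<rho>"
    show "\<forall>\<^sub>F n in sequentially. y < root n (a n)"
      using eventually_ge_at_top[of 1]
    proof eventually_elim
      case (elim n)
      have "\<rho> \<le> root n (a n)" unfolding \<rho>_def by (rule cINF_lower[OF bb]) (use elim in simp)
      with \<open>y < \<rho>\<close> show ?case by simp
    qed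
  next
    fix y assume "\<rho> < y"
    then have "0 < (y - \<rho>) / 2" by simp
    moreover have "\<rho> + 2 * ((y - \<rho>) / 2) = y" by (simp add: field_simps)
    ultimately show "\<forall>\<^sub>F n in sequentially. root n (a n) < y"
      using upper[of "(y - \<rho>) / 2"] by simp
  qed
  then show ?thesis by (rule convergentI)
qed

definition pointwise_le :: "(nat \<Rightarrow>\<^sub>C real) \<Rightarrow> (nat \<Rightarrow>\<^sub>C real) \<Rightarrow> bool" (infix "\<sqsubseteq>" 50) where
  "r \<sqsubseteq> s \<longleftrightarrow> (\<forall>i. apply_bcontfun r i \<le> apply_bcontfun s i)"

abbreviation one_seq :: "nat \<Rightarrow>\<^sub>C real" where "one_seq \<equiv> const_bcontfun 1"

locale monotone_cone_operator =
  fixes \<Gamma> :: "(nat \<Rightarrow>\<^sub>C real) \<Rightarrow> (nat \<Rightarrow>\<^sub>C real)"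
  assumes cone: "s \<in> linf_cone \<Longrightarrow> \<Gamma> s \<in> linf_cone"
    and monotone: "r \<in> linf_cone \<Longrightarrow> s \<in> linf_cone \<Longrightarrow> r \<sqsubseteq> s \<Longrightarrow> \<Gamma> r \<sqsubseteq> \<Gamma> s"
    and homogeneous: "s \<in> linf_cone \<Longrightarrow> 0 \<le> c \<Longrightarrow> \<Gamma> (c *\<^sub>R s) = c *\<^sub>R \<Gamma> s"
    and subadditive: "r \<in> linf_cone \<Longrightarrow> s \<in> linf_cone \<Longrightarrow> \<Gamma> (r + s) \<sqsubseteq> \<Gamma> r + \<Gamma> s"
begin

lemma pow_cone: "s \<in> linf_cone \<Longrightarrow> (\<Gamma> ^^ n) s \<in> linf_cone"
  by (induction n) (auto intro: cone)

lemma pow_mono: "r \<in> linf_cone \<Longrightarrow> s \<in> linf_cone \<Longrightarrow> r \<sqsubseteq> s \<Longrightarrow> (\<Gamma> ^^ n) r \<sqsubseteq> (\<Gamma> ^^ n) s"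
  by (induction n) (auto intro: monotone pow_cone)

lemma pow_homogeneous: "s \<in> linf_cone \<Longrightarrow> 0 \<le> c \<Longrightarrow> (\<Gamma> ^^ n) (c *\<^sub>R s) = c *\<^sub>R (\<Gamma> ^^ n) s"
  by (induction n) (auto simp: homogeneous pow_cone)

lemma one_cone: "one_seq \<in> linf_cone"
  by (simp add: linf_cone_def const_bcontfun.rep_eq)

lemma scale_one_cone: "0 \<le> c \<Longrightarrow> c *\<^sub>R one_seq \<in> linf_cone"
  by (simp add: linf_cone_def const_bcontfun.rep_eq)

lemma le_norm_one: "s \<sqsubseteq> norm s *\<^sub>R one_seq"
  using norm_bounded[of s] by (auto simp: pointwise_le_def const_bcontfun.rep_eq abs_le_iff)

lemma norm_mono:
  assumes "r \<in> linf_cone" "r \<sqsubseteq> s" shows "norm r \<le> norm s"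
proof (rule norm_bound)
  fix i
  have "0 \<le> apply_bcontfun r i" "apply_bcontfun r i \<le> apply_bcontfun s i"
    using assms by (auto simp: linf_cone_def pointwise_le_def)
  then show "norm (apply_bcontfun r i) \<le> norm s" using norm_bounded[of s i] by simp
qed

lemma norm_one: "norm one_seq = 1"
proof (rule antisym)
  show "norm one_seq \<le> 1" by (rule norm_bound) (simp add: const_bcontfun.rep_eq)
  show "1 \<le> norm one_seq" using norm_bounded[of one_seq 0] by (simp add: const_bcontfun.rep_eq)
qed

lemma norm_pow_le:
  assumes "s \<in> linf_cone" shows "norm ((\<Gamma> ^^ n) s) \<le> norm s * norm ((\<Gamma> ^^ n) one_seq)"
proof -
  have "norm ((\<Gamma> ^^ n) s) \<le> norm ((\<Gamma> ^^ n) (norm s *\<^sub>R one_seq))"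
    by (intro norm_mono pow_cone pow_mono assms scale_one_cone le_norm_one) simp
  then show ?thesis by (simp add: pow_homogeneous one_cone)
qed

text \<open>By monotonicity and homogeneity the supremum over the unit sphere of the cone is attained at the
constant sequence. The norms of its iterates are submultiplicative, so the limit in the
definition of the spectral radius exists.\<close>

lemma spectral_radius_limit:
  "(\<lambda>n. root n (norm ((\<Gamma> ^^ n) one_seq))) \<longlonglongrightarrow> cone_spectral_radius \<Gamma>"
proof -
  have "norm ((\<Gamma> ^^ (m + n)) one_seq) \<le> norm ((\<Gamma> ^^ m) one_seq) * norm ((\<Gamma> ^^ n) one_seq)" for m n
    using norm_pow_le[OF pow_cone[OF one_cone], of m n] by (simp add: funpow_add mult.commute)
  then have "convergent (\<lambda>n. root n (norm ((\<Gamma> ^^ n) one_seq)))"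
    by (intro submultiplicative_root_convergent) auto
  moreover have "(SUP s\<in>{s \<in> linf_cone. norm s = 1}. root n (norm ((\<Gamma> ^^ n) s)))
      = root n (norm ((\<Gamma> ^^ n) one_seq))" for n
  proof (rule cSup_eq_maximum, rule image_eqI[OF refl])
    show "one_seq \<in> {s \<in> linf_cone. norm s = 1}" using one_cone norm_one by simp
    fix y assume "y \<in> (\<lambda>s. root n (norm ((\<Gamma> ^^ n) s))) ` {s \<in> linf_cone. norm s = 1}"
    then obtain s where "s \<in> linf_cone" "norm s = 1" "y = root n (norm ((\<Gamma> ^^ n) s))" by auto
    then show "y \<le> root n (norm ((\<Gamma> ^^ n) one_seq))"
      using norm_pow_le[of s n] by (cases "n = 0") auto
  qed
  ultimately show ?thesis by (simp add: cone_spectral_radius_def convergent_LIMSEQ_iff)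
qed

lemma sum_subadditive:
  fixes c :: "nat \<Rightarrow> real"
  assumes "\<And>k. k < N \<Longrightarrow> 0 \<le> c k" "\<And>k. k < N \<Longrightarrow> v k \<in> linf_cone"
  shows "\<Gamma> (\<Sum>k<N. c k *\<^sub>R v k) \<sqsubseteq> (\<Sum>k<N. c k *\<^sub>R \<Gamma> (v k)) \<and> (\<Sum>k<N. c k *\<^sub>R v k) \<in> linf_cone"
  using assms
proof (induction N)
  case 0
  have "\<Gamma> 0 = 0" using homogeneous[OF one_cone, of 0] by simp
  then show ?case by (simp add: pointwise_le_def linf_cone_def)
next
  case (Suc N)
  let ?S = "\<Sum>k<N. c k *\<^sub>R v k"
  have IH: "\<Gamma> ?S \<sqsubseteq> (\<Sum>k<N. c k *\<^sub>R \<Gamma> (v k))" "?S \<in> linf_cone" using Suc by auto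
  have cv: "c N *\<^sub>R v N \<in> linf_cone" using Suc.prems by (simp add: linf_cone_def)
  have "\<Gamma> (?S + c N *\<^sub>R v N) \<sqsubseteq> \<Gamma> ?S + \<Gamma> (c N *\<^sub>R v N)" by (rule subadditive[OF IH(2) cv])
  then have "\<Gamma> (?S + c N *\<^sub>R v N) \<sqsubseteq> (\<Sum>k<N. c k *\<^sub>R \<Gamma> (v k)) + c N *\<^sub>R \<Gamma> (v N)"
    using IH(1) Suc.prems by (fastforce simp: pointwise_le_def homogeneous intro: order_trans)
  moreover have "?S + c N *\<^sub>R v N \<in> linf_cone" using IH(2) cv by (simp add: linf_cone_def)
  ultimately show ?case by simp
qed

text \<open>For some \<open>N\<close> and \<open>c < 1\<close> the norm of \<open>\<Gamma>\<^sup>N 1\<close> is at most \<open>c\<^sup>N\<close>. The witness is the finite sum of the terms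
\<open>c\<^sup>-\<^sup>k \<Gamma>\<^sup>k 1\<close> for \<open>k < N\<close>. Up to the factor \<open>c\<close>, applying \<open>\<Gamma>\<close> shifts this sum by one place:
the term \<open>1\<close> is lost at the beginning, and the term gained at the end is at most \<open>1\<close> by the
choice of \<open>N\<close>. The estimate of \<open>\<Gamma>\<close> on this finite sum is subadditivity.\<close>

lemma strict_decay_point:
  assumes radius: "cone_spectral_radius \<Gamma> < 1"
  obtains s c where "s \<in> linf_cone" "one_seq \<sqsubseteq> s" "0 < c" "c < 1" "\<Gamma> s \<sqsubseteq> c *\<^sub>R s"
proof -
  obtain c where c: "max 0 (cone_spectral_radius \<Gamma>) < c" "c < 1"
    using dense[of "max 0 (cone_spectral_radius \<Gamma>)" 1] radius by auto
  have "\<forall>\<^sub>F n in sequentially. root n (norm ((\<Gamma> ^^ n) one_seq)) < c"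
    by (rule order_tendstoD(2)[OF spectral_radius_limit]) (use c in simp)
  with eventually_ge_at_top[of 1] have "\<forall>\<^sub>F n in sequentially. 1 \<le> n \<and> root n (norm ((\<Gamma> ^^ n) one_seq)) < c"
    by eventually_elim simp
  then obtain N where N: "1 \<le> N" "root N (norm ((\<Gamma> ^^ N) one_seq)) < c"
    by (auto simp: eventually_sequentially)
  have "norm ((\<Gamma> ^^ N) one_seq) = root N (norm ((\<Gamma> ^^ N) one_seq)) ^ N"
    using N by (simp add: real_root_pow_pos2)
  also have "\<dots> \<le> c ^ N" using N by (intro power_mono) auto
  finally have powN: "norm ((\<Gamma> ^^ N) one_seq) \<le> c ^ N" .
  define v where "v k = inverse c ^ k *\<^sub>R (\<Gamma> ^^ k) one_seq" for k
  define s where "s = (\<Sum>k<N. v k)"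
  have c0: "0 < c" using c by simp
  have s: "\<Gamma> s \<sqsubseteq> (\<Sum>k<N. inverse c ^ k *\<^sub>R (\<Gamma> ^^ Suc k) one_seq)" "s \<in> linf_cone"
    using sum_subadditive[of N "\<lambda>k. inverse c ^ k" "\<lambda>k. (\<Gamma> ^^ k) one_seq"] c0 pow_cone[OF one_cone]
    by (auto simp: s_def v_def)
  have "(\<Sum>k<N. inverse c ^ k *\<^sub>R (\<Gamma> ^^ Suc k) one_seq) = c *\<^sub>R (\<Sum>k<N. v (Suc k))"
    unfolding scaleR_right.sum using c0 by (intro sum.cong) (auto simp: v_def)
  also have "(\<Sum>k<N. v (Suc k)) = s + v N - v 0"
    using sum.lessThan_Suc_shift[of v N] by (simp add: s_def algebra_simps)
  finally have shift: "(\<Sum>k<N. inverse c ^ k *\<^sub>R (\<Gamma> ^^ Suc k) one_seq) = c *\<^sub>R (s + v N - v 0)" .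
  have vk: "0 \<le> apply_bcontfun (v k) i" for k i
    using pow_cone[OF one_cone, of k] c0 by (simp add: v_def linf_cone_def)
  have vN: "apply_bcontfun (v N) i \<le> 1" for i
  proof -
    have "apply_bcontfun ((\<Gamma> ^^ N) one_seq) i \<le> c ^ N"
      using norm_bounded[of "(\<Gamma> ^^ N) one_seq" i] powN by simp
    then show ?thesis using c0 by (simp add: v_def field_simps)
  qed
  have v0: "apply_bcontfun (v 0) i = 1" for i by (simp add: v_def const_bcontfun.rep_eq)
  have sum_apply: "apply_bcontfun (\<Sum>k\<in>A. v k) i = (\<Sum>k\<in>A. apply_bcontfun (v k) i)" if "finite A" for A i
    using that by induction auto
  show thesis
  proof (rule that[OF s(2) _ c0 c(2)])
    show "one_seq \<sqsubseteq> s"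
      unfolding pointwise_le_def
    proof
      fix i
      have "apply_bcontfun (v 0) i \<le> (\<Sum>k<N. apply_bcontfun (v k) i)"
        by (rule member_le_sum) (use N vk in auto)
      then show "apply_bcontfun one_seq i \<le> apply_bcontfun s i"
        by (simp add: s_def sum_apply v0 const_bcontfun.rep_eq)
    qed
    show "\<Gamma> s \<sqsubseteq> c *\<^sub>R s"
      unfolding pointwise_le_def
    proof
      fix i
      have "apply_bcontfun (\<Gamma> s) i \<le> c * (apply_bcontfun s i + apply_bcontfun (v N) i - 1)"
        using s(1) unfolding shift pointwise_le_def by (simp add: v0 plus_bcontfun.rep_eq minus_bcontfun.rep_eq)
      also have "\<dots> \<le> c * apply_bcontfun s i" using vN[of i] c0 by (intro mult_left_mono) auto
      finally show "apply_bcontfun (\<Gamma> s) i \<le> apply_bcontfun (c *\<^sub>R s) i" by simp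
    qed
  qed
qed

end

lemma interior_linf_cone:
  assumes "one_seq \<sqsubseteq> s" shows "s \<in> interior linf_cone"
proof (rule interiorI)
  show "open (ball s 1)" "s \<in> ball s 1" by auto
  show "ball s 1 \<subseteq> linf_cone"
  proof
    fix r assume "r \<in> ball s 1"
    then have "dist (apply_bcontfun s i) (apply_bcontfun r i) < 1" for i
      using dist_bounded[of s i r] by (simp add: dist_commute)
    moreover have "1 \<le> apply_bcontfun s i" for i
      using assms by (simp add: pointwise_le_def const_bcontfun.rep_eq)
    ultimately have "0 \<le> apply_bcontfun r i" for i
      unfolding dist_real_def by (smt (verit))
    then show "r \<in> linf_cone" by (simp add: linf_cone_def)
  qed
qed

section \<open>Norms and the chain rule on finite-dimensional spaces\<close>

lemma Rn_diff: "v \<in> Rn d \<Longrightarrow> w \<in> Rn d \<Longrightarrow> (\<lambda>k. v k - w k) \<in> Rn d"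
  and Rn_scale: "v \<in> Rn d \<Longrightarrow> (\<lambda>k. c * v k) \<in> Rn d"
  and Rn_zero: "(\<lambda>_. 0) \<in> Rn d"
  and Rn_update: "v \<in> Rn d \<Longrightarrow> k < d \<Longrightarrow> v(k := r) \<in> Rn d"
  by (auto simp: Rn_def)

lemma Rn_sum: "(\<And>y. y \<in> A \<Longrightarrow> f y \<in> Rn d) \<Longrightarrow> (\<lambda>k. \<Sum>y\<in>A. c y * f y k) \<in> Rn d"
  by (auto simp: Rn_def)

locale normed_Rn =
  fixes d :: nat and N :: "rvec \<Rightarrow> real"
  assumes norm: "is_norm d N"
begin

lemma nonneg: "v \<in> Rn d \<Longrightarrow> 0 \<le> N v"
  and eq_0: "v \<in> Rn d \<Longrightarrow> N v = 0 \<longleftrightarrow> v = (\<lambda>_. 0)"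
  and scale: "v \<in> Rn d \<Longrightarrow> N (\<lambda>k. c * v k) = \<bar>c\<bar> * N v"
  and triangle: "v \<in> Rn d \<Longrightarrow> w \<in> Rn d \<Longrightarrow> N (\<lambda>k. v k + w k) \<le> N v + N w"
  using norm unfolding is_norm_def by blast+

lemma zero: "N (\<lambda>_. 0) = 0"
  using eq_0[OF Rn_zero] by simp

lemma minus_commute:
  assumes "v \<in> Rn d" "w \<in> Rn d" shows "N (\<lambda>k. v k - w k) = N (\<lambda>k. w k - v k)"
  using scale[OF Rn_diff[OF assms(2,1)], of "-1"] by simp

lemma triangle_diff:
  assumes "u \<in> Rn d" "v \<in> Rn d" "w \<in> Rn d"
  shows "N (\<lambda>k. u k - w k) \<le> N (\<lambda>k. u k - v k) + N (\<lambda>k. v k - w k)"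
  using triangle[OF Rn_diff[OF assms(1,2)] Rn_diff[OF assms(2,3)]] by simp

lemma le_diff:
  assumes "v \<in> Rn d" "w \<in> Rn d" shows "N v \<le> N w + N (\<lambda>k. v k - w k)"
  using triangle[OF assms(2) Rn_diff[OF assms]] by simp

lemma sum_le:
  assumes "finite A" "\<And>y. y \<in> A \<Longrightarrow> f y \<in> Rn d"
  shows "N (\<lambda>k. \<Sum>y\<in>A. c y * f y k) \<le> (\<Sum>y\<in>A. \<bar>c y\<bar> * N (f y))"
  using assms
proof (induction A rule: finite_induct)
  case empty
  then show ?case by (simp add: zero)
next
  case (insert a A)
  have "N (\<lambda>k. c a * f a k + (\<Sum>y\<in>A. c y * f y k)) \<le> N (\<lambda>k. c a * f a k) + N (\<lambda>k. \<Sum>y\<in>A. c y * f y k)"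
    by (intro triangle Rn_scale Rn_sum insert) auto
  then show ?case using insert by (simp add: scale)
qed

lemma le_coordinates:
  obtains C where "\<And>k. 0 \<le> C k" "\<And>v. v \<in> Rn d \<Longrightarrow> N v \<le> (\<Sum>k<d. C k * \<bar>v k\<bar>)"
proof
  define e :: "nat \<Rightarrow> rvec" where "e k = (\<lambda>j. if j = k \<and> k < d then 1 else 0)" for k
  have e: "e k \<in> Rn d" for k by (auto simp: e_def Rn_def)
  show "0 \<le> N (e k)" for k using nonneg[OF e] .
  fix v assume v: "v \<in> Rn d"
  have "(\<Sum>k<d. v k * e k j) = v j" for j
    using v by (cases "j < d") (auto simp: e_def Rn_def if_distrib sum.delta cong: if_cong)
  then have "v = (\<lambda>j. \<Sum>k<d. v k * e k j)" by simp
  then show "N v \<le> (\<Sum>k<d. N (e k) * \<bar>v k\<bar>)"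
    using sum_le[of "{..<d}" e v] e by (simp add: mult.commute)
qed

lemma tendsto:
  assumes lim: "\<And>k. k < d \<Longrightarrow> ((\<lambda>x. f x k) \<longlongrightarrow> v k) F"
    and f: "\<forall>\<^sub>F x in F. f x \<in> Rn d" and v: "v \<in> Rn d"
  shows "((\<lambda>x. N (f x)) \<longlongrightarrow> N v) F" "((\<lambda>x. N (\<lambda>k. f x k - v k)) \<longlongrightarrow> 0) F"
proof -
  obtain C where C: "\<And>k. 0 \<le> C k" "\<And>v. v \<in> Rn d \<Longrightarrow> N v \<le> (\<Sum>k<d. C k * \<bar>v k\<bar>)"
    using le_coordinates by blast
  let ?b = "\<lambda>x. \<Sum>k<d. C k * \<bar>f x k - v k\<bar>"
  have "(?b \<longlongrightarrow> (\<Sum>k<d. C k * \<bar>v k - v k\<bar>)) F"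
    by (intro tendsto_intros lim) auto
  then have b: "(?b \<longlongrightarrow> 0) F" by simp
  show d0: "((\<lambda>x. N (\<lambda>k. f x k - v k)) \<longlongrightarrow> 0) F"
  proof (rule tendsto_sandwich[OF _ _ tendsto_const b])
    show "\<forall>\<^sub>F x in F. 0 \<le> N (\<lambda>k. f x k - v k)"
      using f by eventually_elim (intro nonneg Rn_diff v)
    show "\<forall>\<^sub>F x in F. N (\<lambda>k. f x k - v k) \<le> ?b x"
      using f by eventually_elim (use C(2)[OF Rn_diff[OF _ v]] in simp)
  qed
  have "((\<lambda>x. N (f x) - N v) \<longlongrightarrow> 0) F"
  proof (rule Lim_null_comparison[OF _ d0])
    show "\<forall>\<^sub>F x in F. norm (N (f x) - N v) \<le> N (\<lambda>k. f x k - v k)"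
      using f
    proof eventually_elim
      case (elim x)
      show ?case using le_diff[OF elim v] le_diff[OF v elim] minus_commute[OF elim v] by simp
    qed
  qed
  then show "((\<lambda>x. N (f x)) \<longlongrightarrow> N v) F" by (simp add: LIM_zero_iff)
qed

text \<open>This is the nontrivial half of the equivalence of norms: \<open>N\<close> has a positive minimum on the unit
sphere of the maximum norm, which is compact in the product topology.\<close>

lemma coordinate_le:
  obtains C where "0 < C" "\<And>v k. v \<in> Rn d \<Longrightarrow> \<bar>v k\<bar> \<le> C * N v"
proof -
  define B :: "rvec set" where "B = (\<Pi>\<^sub>E k\<in>UNIV. if k < d then {-1..1} else {0})"
  define S where "S = (\<Union>k\<in>{..<d}. {v \<in> B. 1 \<le> \<bar>v k\<bar>})"
  have "compactin (product_topology (\<lambda>_. euclideanreal) UNIV) B"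
    unfolding B_def by (subst compactin_PiE) auto
  then have B: "compact B" by (simp add: euclidean_product_topology)
  have "closed {v :: rvec. 1 \<le> \<bar>v k\<bar>}" for k
    by (intro closed_Collect_le continuous_intros continuous_on_product_coordinates)
  then have "compact (B \<inter> {v. 1 \<le> \<bar>v k\<bar>})" for k by (rule compact_Int_closed[OF B])
  then have S: "compact S" unfolding S_def by (intro compact_UN) (auto simp: Collect_conj_eq)
  have "v \<in> Rn d" if "v \<in> B" for v
    unfolding Rn_def
  proof (intro CollectI allI impI)
    fix k assume "d \<le> k"
    then show "v k = 0" using PiE_mem[OF that[unfolded B_def], of k] by simp
  qed
  then have SR: "S \<subseteq> Rn d" by (auto simp: S_def)
  have "((\<lambda>w. w k) \<longlongrightarrow> v k) (at v within S)" for v :: rvec and k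
  proof -
    have "((\<lambda>w. w k) \<longlongrightarrow> v k) (at v)"
      using continuous_on_product_coordinates[where i = k and 'b = real]
      unfolding continuous_on_def by (rule bspec) simp
    then show ?thesis by (rule tendsto_within_subset) simp
  qed
  moreover have "\<forall>\<^sub>F w in at v within S. w \<in> Rn d" for v
    unfolding eventually_at_filter by (rule always_eventually) (use SR in auto)
  ultimately have cN: "continuous_on S N"
    unfolding continuous_on_def using SR by (intro ballI tendsto(1)) auto
  obtain m where m: "0 < m" "\<And>v. v \<in> S \<Longrightarrow> m \<le> N v"
  proof (cases "S = {}")
    case True
    then show ?thesis using that[of 1] by simp
  next
    case False
    obtain z where z: "z \<in> S" "\<And>v. v \<in> S \<Longrightarrow> N z \<le> N v"
      using continuous_attains_inf[OF S False cN] by blast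
    have "z \<noteq> (\<lambda>_. 0)" using z(1) by (auto simp: S_def)
    then have "0 < N z" using nonneg[of z] eq_0[of z] SR z(1) by fastforce
    then show ?thesis using that z by blast
  qed
  show thesis
  proof (rule that)
    show "0 < 1 / m" using m by simp
    fix v :: rvec and k assume v: "v \<in> Rn d"
    show "\<bar>v k\<bar> \<le> 1 / m * N v"
    proof (cases "v = (\<lambda>_. 0)")
      case True
      then show ?thesis by (simp add: zero)
    next
      case False
      define M where "M = Max ((\<lambda>k. \<bar>v k\<bar>) ` {..<d})"
      obtain j where "v j \<noteq> 0" using False by auto
      then have j: "j < d" using v not_less unfolding Rn_def by blast
      have Mk: "\<bar>v k\<bar> \<le> M" if "k < d" for k unfolding M_def using that by (intro Max_ge) auto
      have M0: "0 < M" using Mk[OF j] \<open>v j \<noteq> 0\<close> by simp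
      have "M \<in> (\<lambda>k. \<bar>v k\<bar>) ` {..<d}" unfolding M_def using j by (intro Max_in) auto
      then obtain l where l: "l < d" "M = \<bar>v l\<bar>" by auto
      define w where "w = (\<lambda>k. (1 / M) * v k)"
      have "\<bar>w k\<bar> \<le> 1" if "k < d" for k
        using Mk[OF that] M0 by (simp add: w_def abs_mult divide_le_eq)
      moreover have "w k = 0" if "\<not> k < d" for k using that v by (simp add: w_def Rn_def)
      ultimately have "w \<in> B" unfolding B_def by (intro PiE_I) (auto simp: abs_le_iff minus_le_iff)
      moreover have "1 \<le> \<bar>w l\<bar>" using l M0 by (simp add: w_def)
      ultimately have "w \<in> S" using l by (auto simp: S_def)
      then have "m \<le> N w" by (rule m)
      also have "N w = N v / M" unfolding w_def scale[OF v] using M0 by simp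
      finally have "M \<le> 1 / m * N v" using M0 m by (simp add: field_simps)
      moreover have "\<bar>v k\<bar> \<le> M" using Mk[of k] v M0 by (cases "k < d") (auto simp: Rn_def)
      ultimately show ?thesis by simp
    qed
  qed
qed

end

lemma MVT_segment:
  fixes f f' :: "real \<Rightarrow> real"
  assumes "\<And>x. x \<in> closed_segment a b \<Longrightarrow> (f has_real_derivative f' x) (at x)"
  shows "\<exists>\<xi>\<in>closed_segment a b. f b - f a = (b - a) * f' \<xi>"
proof (cases a b rule: linorder_cases)
  case less
  then obtain z where "a < z" "z < b" "f b - f a = (b - a) * f' z"
    using MVT2[of a b f f'] assms by (auto simp: closed_segment_eq_real_ivl)
  then show ?thesis using less by (intro bexI[of _ z]) (auto simp: closed_segment_eq_real_ivl)
next
  case greater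
  then obtain z where "b < z" "z < a" "f a - f b = (a - b) * f' z"
    using MVT2[of b a f f'] assms by (auto simp: closed_segment_eq_real_ivl)
  then show ?thesis using greater
    by (intro bexI[of _ z]) (auto simp: closed_segment_eq_real_ivl algebra_simps)
qed simp

lemma C1_off_origin_partial:
  assumes "C1_off_origin d V" "x \<in> Rn d" "k < d" "x(k := r) \<noteq> (\<lambda>_. 0)"
  shows "((\<lambda>r. V (x(k := r))) has_real_derivative partial_deriv k V (x(k := r))) (at r)"
proof -
  have "(\<lambda>s. V ((x(k := r))(k := s))) differentiable at ((x(k := r)) k)"
    using assms Rn_update[of x d k r] unfolding C1_off_origin_def by blast
  then have "(\<lambda>s. V (x(k := s))) field_differentiable at r"
    by (simp add: real_differentiable_def field_differentiable_def)
  then show ?thesis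
    by (simp add: partial_deriv_def field_differentiable_derivI)
qed

text \<open>The increment of \<open>V\<close> is telescoped by changing one coordinate at a time, and each step is handled
by the mean value theorem. The segments avoid the origin for \<open>t\<close> close to \<open>\<tau>\<close>, because their points
have a nonzero coordinate \<open>k0\<close>, chosen with \<open>y \<tau> k0 \<noteq> 0\<close>. Continuity of the partial derivatives then
identifies the limit.\<close>

lemma C1_off_origin_chain:
  assumes C1: "C1_off_origin d V"
    and y: "\<forall>\<^sub>F t in at \<tau>. y t \<in> Rn d" "y \<tau> \<in> Rn d" "y \<tau> \<noteq> (\<lambda>_. 0)"
    and deriv: "\<And>k. k < d \<Longrightarrow> ((\<lambda>t. y t k) has_real_derivative y' k) (at \<tau>)"
  shows "((\<lambda>t. V (y t)) has_real_derivative gradient_times d V (y \<tau>) y') (at \<tau>)"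
proof -
  obtain k0 where k0: "y \<tau> k0 \<noteq> 0" using y(3) by auto
  then have k0d: "k0 < d" using y(2) not_less unfolding Rn_def by blast
  \<comment> \<open>hybrid points: the first \<open>j\<close> coordinates are already moved to time \<open>t\<close>\<close>
  define z where "z j t = (\<lambda>k. if k < j then y t k else y \<tau> k)" for j t
  have lim: "((\<lambda>t. y t k) \<longlongrightarrow> y \<tau> k) (at \<tau>)" for k
  proof (cases "k < d")
    case True
    then show ?thesis using DERIV_isCont[OF deriv[OF True]] by (simp add: isCont_def)
  next
    case False
    then have "\<forall>\<^sub>F t in at \<tau>. y t k = 0"
      using y(1) by (auto elim!: eventually_mono simp: Rn_def)
    then have "((\<lambda>t. y t k) \<longlongrightarrow> 0) (at \<tau>)" by (rule tendsto_eventually)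
    then show ?thesis using y(2) False by (simp add: Rn_def)
  qed
  have near: "\<forall>\<^sub>F t in at \<tau>. \<bar>y t k0 - y \<tau> k0\<bar> < \<bar>y \<tau> k0\<bar>"
    using tendstoD[OF lim, of "\<bar>y \<tau> k0\<bar>" k0] k0 by (simp add: dist_real_def)
  have step: "((\<lambda>t. (V (z (Suc j) t) - V (z j t)) / (t - \<tau>)) \<longlongrightarrow> partial_deriv j V (y \<tau>) * y' j) (at \<tau>)"
    if j: "j < d" for j
  proof -
    have pt: "(z j t)(j := r) \<in> Rn d \<and> (z j t)(j := r) \<noteq> (\<lambda>_. 0) \<and>
        (\<forall>k. \<bar>((z j t)(j := r)) k - y \<tau> k\<bar> \<le> \<bar>y t k - y \<tau> k\<bar>)"
      if r: "r \<in> closed_segment (y \<tau> j) (y t j)" and t: "y t \<in> Rn d" "\<bar>y t k0 - y \<tau> k0\<bar> < \<bar>y \<tau> k0\<bar>" for t r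
    proof -
      have close: "\<bar>((z j t)(j := r)) k - y \<tau> k\<bar> \<le> \<bar>y t k - y \<tau> k\<bar>" for k
        using r by (auto simp: z_def closed_segment_eq_real_ivl split: if_splits)
      have "(z j t)(j := r) \<in> Rn d" using t y(2) j by (auto simp: z_def Rn_def)
      moreover have "((z j t)(j := r)) k0 \<noteq> 0" using close[of k0] t(2) by auto
      ultimately show ?thesis using close by (auto dest: fun_cong[of _ _ k0])
    qed
    have "\<exists>\<xi>. \<xi> \<in> closed_segment (y \<tau> j) (y t j) \<and>
        V (z (Suc j) t) - V (z j t) = (y t j - y \<tau> j) * partial_deriv j V ((z j t)(j := \<xi>))"
      if t: "y t \<in> Rn d" "\<bar>y t k0 - y \<tau> k0\<bar> < \<bar>y \<tau> k0\<bar>" for t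
    proof -
      have zR: "z j t \<in> Rn d" using t y(2) by (auto simp: z_def Rn_def)
      have ends: "z (Suc j) t = (z j t)(j := y t j)" "z j t = (z j t)(j := y \<tau> j)"
        by (auto simp: z_def fun_eq_iff less_Suc_eq)
      have "\<exists>\<xi>\<in>closed_segment (y \<tau> j) (y t j). V ((z j t)(j := y t j)) - V ((z j t)(j := y \<tau> j)) =
          (y t j - y \<tau> j) * partial_deriv j V ((z j t)(j := \<xi>))"
        using pt[OF _ t] by (intro MVT_segment C1_off_origin_partial[OF C1 zR j]) auto
      then show ?thesis using ends by metis
    qed
    then obtain \<xi> where \<xi>: "\<And>t. y t \<in> Rn d \<Longrightarrow> \<bar>y t k0 - y \<tau> k0\<bar> < \<bar>y \<tau> k0\<bar> \<Longrightarrow>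
        \<xi> t \<in> closed_segment (y \<tau> j) (y t j) \<and>
        V (z (Suc j) t) - V (z j t) = (y t j - y \<tau> j) * partial_deriv j V ((z j t)(j := \<xi> t))"
      by metis
    let ?p = "\<lambda>t. (z j t)(j := \<xi> t)"
    have ev: "\<forall>\<^sub>F t in at \<tau>. ?p t \<in> Rn d - {\<lambda>_. 0} \<and> (\<forall>k. \<bar>?p t k - y \<tau> k\<bar> \<le> \<bar>y t k - y \<tau> k\<bar>)"
      using y(1) near by eventually_elim (use \<xi> pt in auto)
    have "((\<lambda>t. ?p t k) \<longlongrightarrow> y \<tau> k) (at \<tau>)" for k
    proof (rule metric_tendsto_imp_tendsto[OF lim])
      show "\<forall>\<^sub>F t in at \<tau>. dist (?p t k) (y \<tau> k) \<le> dist (y t k) (y \<tau> k)"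
        using ev by eventually_elim (unfold dist_real_def, blast)
    qed
    then have "limitin (product_topology (\<lambda>_. euclideanreal) UNIV) ?p (y \<tau>) (at \<tau>)"
      by (auto simp: limitin_componentwise)
    then have plim: "(?p \<longlongrightarrow> y \<tau>) (at \<tau>)" by (simp add: euclidean_product_topology)
    have cont: "continuous_on (Rn d - {\<lambda>_. 0}) (partial_deriv j V)"
      using C1 j by (simp add: C1_off_origin_def)
    have "((\<lambda>t. partial_deriv j V (?p t)) \<longlongrightarrow> partial_deriv j V (y \<tau>)) (at \<tau>)"
    proof (rule continuous_on_tendsto_compose[OF cont plim])
      show "y \<tau> \<in> Rn d - {\<lambda>_. 0}" using y by simp
      show "\<forall>\<^sub>F t in at \<tau>. ?p t \<in> Rn d - {\<lambda>_. 0}" using ev by eventually_elim blast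
    qed
    moreover have "((\<lambda>t. (y t j - y \<tau> j) / (t - \<tau>)) \<longlongrightarrow> y' j) (at \<tau>)"
      using deriv[OF j] by (simp add: has_field_derivative_iff)
    ultimately have "((\<lambda>t. partial_deriv j V (?p t) * ((y t j - y \<tau> j) / (t - \<tau>))) \<longlongrightarrow>
        partial_deriv j V (y \<tau>) * y' j) (at \<tau>)" by (rule tendsto_mult)
    moreover have "\<forall>\<^sub>F t in at \<tau>. partial_deriv j V (?p t) * ((y t j - y \<tau> j) / (t - \<tau>)) =
        (V (z (Suc j) t) - V (z j t)) / (t - \<tau>)"
      using y(1) near by eventually_elim (simp add: \<xi>)
    ultimately show ?thesis by (rule Lim_transform_eventually)
  qed
  have "((\<lambda>t. \<Sum>j<d. (V (z (Suc j) t) - V (z j t)) / (t - \<tau>)) \<longlongrightarrow> gradient_times d V (y \<tau>) y') (at \<tau>)"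
    unfolding gradient_times_def by (intro tendsto_sum step) simp
  moreover have "\<forall>\<^sub>F t in at \<tau>. (\<Sum>j<d. (V (z (Suc j) t) - V (z j t)) / (t - \<tau>)) = (V (y t) - V (y \<tau>)) / (t - \<tau>)"
    using y(1)
  proof eventually_elim
    case (elim t)
    have "z d t = y t" "z 0 t = y \<tau>" using elim y(2) by (auto simp: z_def Rn_def fun_eq_iff)
    then have "(\<Sum>j<d. V (z (Suc j) t) - V (z j t)) = V (y t) - V (y \<tau>)"
      using sum_lessThan_telescope[of "\<lambda>j. V (z j t)" d] by simp
    then show ?case by (simp add: sum_divide_distrib[symmetric])
  qed
  ultimately show ?thesis
    unfolding has_field_derivative_iff by (rule Lim_transform_eventually)
qed

section \<open>Bochner integrals in bounded sequences of vectors\<close>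

text \<open>On all sequences \<open>N\<close> need not be continuous, but its composition with the truncation to the
first \<open>d\<close> coordinates is.\<close>

lemma (in normed_Rn) borel_measurable:
  assumes f: "\<And>x. x \<in> space M \<Longrightarrow> f x \<in> Rn d" and m: "\<And>k. (\<lambda>x. f x k) \<in> borel_measurable M"
  shows "(\<lambda>x. N (f x)) \<in> borel_measurable M"
proof -
  define cut :: "rvec \<Rightarrow> rvec" where "cut v = (\<lambda>k. if k < d then v k else 0)" for v
  have cut: "cut v \<in> Rn d" for v by (simp add: cut_def Rn_def)
  have "continuous_on UNIV (\<lambda>v. N (cut v))"
    unfolding continuous_on_def
  proof
    fix v :: rvec
    have "((\<lambda>w. w k) \<longlongrightarrow> v k) (at v)" for k
      using continuous_on_product_coordinates[where i = k and 'b = real]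
      unfolding continuous_on_def by (rule bspec) simp
    then have "((\<lambda>w. cut w k) \<longlongrightarrow> cut v k) (at v)" for k by (simp add: cut_def)
    then show "((\<lambda>w. N (cut w)) \<longlongrightarrow> N (cut v)) (at v)"
      by (intro tendsto(1) always_eventually allI cut)
  qed
  then have [measurable]: "(\<lambda>v. N (cut v)) \<in> borel_measurable borel"
    by (rule borel_measurable_continuous_onI)
  have [measurable]: "f \<in> borel_measurable M"
    using m by (rule measurable_coordinatewise_then_product)
  have "(\<lambda>x. N (cut (f x))) \<in> borel_measurable M" by measurable
  moreover have "cut (f x) = f x" if "x \<in> space M" for x
    using f[OF that] by (auto simp: cut_def Rn_def fun_eq_iff)
  ultimately show ?thesis by (simp cong: measurable_cong)
qed

locale linf_space =
  fixes d :: "nat \<Rightarrow> nat" and N :: "nat \<Rightarrow> rvec \<Rightarrow> real"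
  assumes norms: "is_norm (d i) (N i)"
begin

sublocale comp: normed_Rn "d i" "N i" for i
  by unfold_locales (rule norms)

lemma component: "x \<in> linf d N \<Longrightarrow> x i \<in> Rn (d i)"
  by (simp add: linf_def)

lemma upper: "x \<in> linf d N \<Longrightarrow> N i (x i) \<le> linf_norm N x"
  unfolding linf_norm_def by (intro cSUP_upper) (auto simp: linf_def)

lemma least: "(\<And>i. N i (x i) \<le> C) \<Longrightarrow> linf_norm N x \<le> C"
  unfolding linf_norm_def by (intro cSUP_least) auto

lemma memI: "(\<And>i. x i \<in> Rn (d i)) \<Longrightarrow> (\<And>i. N i (x i) \<le> C) \<Longrightarrow> x \<in> linf d N"
  unfolding linf_def by (auto intro!: bdd_aboveI2[of _ _ C])

lemma norm_nonneg: "x \<in> linf d N \<Longrightarrow> 0 \<le> linf_norm N x"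
  using upper[of x 0] comp.nonneg[OF component, of x 0] by linarith

lemma diff_mem:
  assumes "x \<in> linf d N" "y \<in> linf d N" shows "diffv x y \<in> linf d N"
proof (rule memI)
  show "diffv x y i \<in> Rn (d i)" for i
    unfolding diffv_def by (intro Rn_diff component assms)
  show "N i (diffv x y i) \<le> linf_norm N x + linf_norm N y" for i
    using comp.triangle_diff[OF component[OF assms(1)] Rn_zero component[OF assms(2)], of i]
      upper[OF assms(1), of i] upper[OF assms(2), of i]
      comp.minus_commute[OF Rn_zero component[OF assms(2)], of i] by (simp add: diffv_def)
qed

lemma diff_component: "x \<in> linf d N \<Longrightarrow> y \<in> linf d N \<Longrightarrow> N i (\<lambda>k. x i k - y i k) \<le> linf_norm N (diffv x y)"
  using upper[OF diff_mem, of x y i] by (simp add: diffv_def)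

lemma norm_diff_commute:
  assumes "x \<in> linf d N" "y \<in> linf d N"
  shows "linf_norm N (diffv x y) = linf_norm N (diffv y x)"
  unfolding linf_norm_def diffv_def using comp.minus_commute[OF component component, OF assms] by simp

lemma norm_triangle:
  assumes "x \<in> linf d N" "y \<in> linf d N" shows "linf_norm N x \<le> linf_norm N y + linf_norm N (diffv x y)"
proof (rule least)
  fix i
  show "N i (x i) \<le> linf_norm N y + linf_norm N (diffv x y)"
    using comp.le_diff[OF component[OF assms(1)] component[OF assms(2)], of i]
      diff_component[OF assms, of i] upper[OF assms(2), of i] by simp
qed

end

lemma simple_function_sum:
  fixes F :: "'b \<Rightarrow> real"
  assumes s: "simple_function M s" and fin: "finite_measure M" and A: "A \<in> sets M"
  shows "integrable M (\<lambda>t. indicator A t * F (s t))"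
    and "(\<integral>t. indicator A t * F (s t) \<partial>M) = (\<Sum>y\<in>s ` space M. measure M {t \<in> A. s t = y} * F y)"
proof -
  interpret finite_measure M by (rule fin)
  have lv: "{t \<in> A. s t = y} \<in> sets M" for y
  proof -
    have "{t \<in> A. s t = y} = A \<inter> (s -` {y} \<inter> space M)" using sets.sets_into_space[OF A] by auto
    then show ?thesis using A simple_functionD(2)[OF s, of "{y}"] by simp
  qed
  have fin_im: "finite (s ` space M)" using s by (simp add: simple_function_def)
  have int: "integrable M (\<lambda>t. indicator {t \<in> A. s t = y} t * F y)" for y
    using lv[of y] by (intro integrable_mult_left integrable_real_indicator) (auto simp: less_top[symmetric])
  have eq: "indicator A t * F (s t) = (\<Sum>y\<in>s ` space M. indicator {t \<in> A. s t = y} t * F y)"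
    if "t \<in> space M" for t
  proof -
    have "(\<Sum>y\<in>s ` space M. indicator {t \<in> A. s t = y} t * F y)
        = (\<Sum>y\<in>s ` space M. if y = s t then indicator A t * F y else 0)"
      by (intro sum.cong) (auto simp: indicator_def)
    then show ?thesis using that fin_im by (simp add: sum.delta')
  qed
  show "integrable M (\<lambda>t. indicator A t * F (s t))"
    by (subst Bochner_Integration.integrable_cong[OF refl eq]) (auto intro!: int)
  have "(\<integral>t. indicator A t * F (s t) \<partial>M) = (\<integral>t. (\<Sum>y\<in>s ` space M. indicator {t \<in> A. s t = y} t * F y) \<partial>M)"
    by (rule Bochner_Integration.integral_cong[OF refl eq])
  also have "\<dots> = (\<Sum>y\<in>s ` space M. \<integral>t. indicator {t \<in> A. s t = y} t * F y \<partial>M)"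
    by (rule Bochner_Integration.integral_sum) (rule int)
  also have "\<dots> = (\<Sum>y\<in>s ` space M. measure M {t \<in> A. s t = y} * F y)"
    using lv by (intro sum.cong) (auto simp: less_top[symmetric])
  finally show "(\<integral>t. indicator A t * F (s t) \<partial>M) = (\<Sum>y\<in>s ` space M. measure M {t \<in> A. s t = y} * F y)" .
qed

lemma borel_measurable_AE_lebesgue_on:
  fixes f g :: "real \<Rightarrow> real"
  assumes S: "S \<in> sets lebesgue" and f: "f \<in> borel_measurable (lebesgue_on S)"
    and ae: "AE t in lebesgue_on S. f t = g t"
  shows "g \<in> borel_measurable (lebesgue_on S)"
proof -
  have "AE t in lebesgue. t \<in> S \<longrightarrow> f t = g t" using ae S by (simp add: AE_restrict_space_iff)
  then have "AE t in lebesgue. (if t \<in> S then f t else 0) = (if t \<in> S then g t else 0)"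
    by eventually_elim auto
  with borel_measurable_if_I[OF f S] have "(\<lambda>t. if t \<in> S then g t else 0) \<in> borel_measurable lebesgue"
    by (rule borel_measurable_AE)
  then show ?thesis by (rule borel_measurable_if_D)
qed

context linf_space begin

text \<open>An almost everywhere limit of measurable functions is measurable because Lebesgue measure is
complete; coordinates converge because \<open>N i\<close> dominates them.\<close>

lemma strongly_measurable_coordinate:
  fixes S :: "real set"
  assumes S: "S \<in> sets lebesgue" and g: "strongly_measurable (lebesgue_on S) d N g"
  shows "(\<lambda>t. g t i k) \<in> borel_measurable (lebesgue_on S)"
proof -
  let ?M = "lebesgue_on S"
  obtain s where s: "\<And>m. simple_fn_into ?M (linf d N) (s m)"
    "AE t in ?M. (\<lambda>m. linf_norm N (diffv (g t) (s m t))) \<longlonglongrightarrow> 0" and gm: "g \<in> space ?M \<rightarrow> linf d N"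
    using g unfolding strongly_measurable_def by blast
  obtain C where C: "0 < C" "\<And>v k. v \<in> Rn (d i) \<Longrightarrow> \<bar>v k\<bar> \<le> C * N i v"
    using comp.coordinate_le[of i] by blast
  have sm: "(\<lambda>t. s m t i k) \<in> borel_measurable ?M" for m
    using s(1)[of m] unfolding simple_fn_into_def
    by (intro borel_measurable_simple_function simple_function_compose1[of ?M "s m" "\<lambda>y. y i k"]) auto
  have "AE t in ?M. t \<in> space ?M" by (rule AE_space)
  with s(2) have "AE t in ?M. lim (\<lambda>m. s m t i k) = g t i k"
  proof eventually_elim
    case (elim t)
    have mem: "g t \<in> linf d N" "s m t \<in> linf d N" for m
      using gm s(1) elim(2) by (auto simp: simple_fn_into_def)
    have "(\<lambda>m. C * linf_norm N (diffv (g t) (s m t))) \<longlonglongrightarrow> C * 0"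
      by (intro tendsto_mult elim(1) tendsto_const)
    then have b: "(\<lambda>m. C * linf_norm N (diffv (g t) (s m t))) \<longlonglongrightarrow> 0" by simp
    have "(\<lambda>m. s m t i k - g t i k) \<longlonglongrightarrow> 0"
    proof (rule Lim_null_comparison[OF _ b], rule eventuallyI)
      fix m
      have "\<bar>g t i k - s m t i k\<bar> \<le> C * N i (\<lambda>k. g t i k - s m t i k)"
        by (intro C(2)[of "\<lambda>k. g t i k - s m t i k"] Rn_diff component mem)
      also have "\<dots> \<le> C * linf_norm N (diffv (g t) (s m t))"
        using C(1) diff_component[OF mem, of i m] by simp
      finally show "norm (s m t i k - g t i k) \<le> C * linf_norm N (diffv (g t) (s m t))"
        by (simp add: abs_minus_commute)
    qed
    then have "(\<lambda>m. s m t i k) \<longlonglongrightarrow> g t i k" by (simp add: LIM_zero_iff)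
    then show ?case by (rule limI)
  qed
  then show ?thesis
    by (rule borel_measurable_AE_lebesgue_on[OF S, rotated]) (rule borel_measurable_lim_metric, rule sm)
qed

text \<open>The first two conclusions identify the integral coordinatewise with Lebesgue integrals. The third is absolute
continuity of the integral with a modulus that is the same for all components; it is what makes solutions continuous
in the supremum norm. Its constant \<open>K\<close> bounds the values of one simple function \<open>s p\<close> that is close
to \<open>g\<close> in mean. For a simple function the norm of the integral is at most the integral of the norm
by the triangle inequality, whichever norm \<open>N i\<close> is, and simple functions \<open>s m\<close> carry the estimate over to \<open>g\<close>.\<close>

lemma bochner_integral_facts:
  fixes S :: "real set"
  assumes S: "S \<in> lmeasurable" and g: "has_bochner_integral_linf (lebesgue_on S) d N g J"
  shows "integrable (lebesgue_on S) (\<lambda>t. g t i k)"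
    and "J i k = (\<integral>t. g t i k \<partial>lebesgue_on S)"
    and "0 < e \<Longrightarrow> \<exists>K. \<forall>A\<in>sets (lebesgue_on S). \<forall>i.
      N i (\<lambda>k. \<integral>t. indicator A t * g t i k \<partial>lebesgue_on S) \<le> K * measure (lebesgue_on S) A + e"
proof -
  let ?M = "lebesgue_on S"
  interpret finite_measure ?M using S by (rule finite_measure_lebesgue_on)
  have S': "S \<in> sets lebesgue" using S by (rule fmeasurableD)
  obtain s where s: "\<And>m. simple_fn_into ?M (linf d N) (s m)"
    and R0: "(\<lambda>m. \<integral>\<^sup>+t. ennreal (linf_norm N (diffv (g t) (s m t))) \<partial>?M) \<longlonglongrightarrow> 0"
    and J0: "(\<lambda>m. linf_norm N (diffv (simple_integral_linf ?M (s m)) J)) \<longlonglongrightarrow> 0"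
    and meas: "strongly_measurable ?M d N g" and J: "J \<in> linf d N"
    using g unfolding has_bochner_integral_linf_def by blast
  define R where "R m = (\<integral>\<^sup>+t. ennreal (linf_norm N (diffv (g t) (s m t))) \<partial>?M)" for m
  have sf: "simple_function ?M (s m)" and sl: "t \<in> space ?M \<Longrightarrow> s m t \<in> linf d N" for m t
    using s[of m] by (auto simp: simple_fn_into_def)
  have gl: "t \<in> space ?M \<Longrightarrow> g t \<in> linf d N" for t
    using meas by (auto simp: strongly_measurable_def)
  note gm [measurable] = strongly_measurable_coordinate[OF S' meas]
  have sm [measurable]: "(\<lambda>t. s m t i k) \<in> borel_measurable ?M" for m i k
    by (intro borel_measurable_simple_function simple_function_compose1[OF sf])
  have s_int: "integrable ?M (\<lambda>t. indicator A t * s m t i k)" if "A \<in> sets ?M" for A m i k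
    using simple_function_sum(1)[OF sf finite_measure_axioms that, where F = "\<lambda>y. y i k"] .
  have s_int': "integrable ?M (\<lambda>t. s m t i k)" for m i k
    using s_int[OF sets.top, of m i k] by (rule Bochner_Integration.integrable_cong[THEN iffD1, rotated 2]) auto
  have Nm: "(\<lambda>t. N i (\<lambda>k. f t i k - h t i k)) \<in> borel_measurable ?M"
    if "\<And>k. (\<lambda>t. f t i k) \<in> borel_measurable ?M" "\<And>k. (\<lambda>t. h t i k) \<in> borel_measurable ?M"
      "\<And>t. t \<in> space ?M \<Longrightarrow> f t \<in> linf d N" "\<And>t. t \<in> space ?M \<Longrightarrow> h t \<in> linf d N" for f h i
    using that by (intro comp.borel_measurable Rn_diff component borel_measurable_diff)
  \<comment> \<open>Mean errors are added componentwise: additivity of the integral needs measurable integrands.\<close>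
  have NR: "(\<integral>\<^sup>+t. ennreal (N i (\<lambda>k. g t i k - s m t i k)) \<partial>?M) \<le> R m" for i m
    unfolding R_def by (intro nn_integral_mono ennreal_leI diff_component gl sl)
  have coord: "\<exists>C>0. \<forall>v k. v \<in> Rn (d i) \<longrightarrow> \<bar>v k\<bar> \<le> C * N i v" for i
    using comp.coordinate_le[of i] by metis
  have L1: "(\<integral>\<^sup>+t. ennreal (norm (s m t i k - g t i k)) \<partial>?M) \<le> ennreal C * R m"
    if C: "0 < C" "\<And>v k. v \<in> Rn (d i) \<Longrightarrow> \<bar>v k\<bar> \<le> C * N i v" for C i k m
  proof -
    have "(\<integral>\<^sup>+t. ennreal (norm (s m t i k - g t i k)) \<partial>?M)
        \<le> (\<integral>\<^sup>+t. ennreal C * ennreal (N i (\<lambda>k. g t i k - s m t i k)) \<partial>?M)"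
    proof (rule nn_integral_mono)
      fix t assume t: "t \<in> space ?M"
      have r: "(\<lambda>k. g t i k - s m t i k) \<in> Rn (d i)" by (intro Rn_diff component gl sl t)
      show "ennreal (norm (s m t i k - g t i k)) \<le> ennreal C * ennreal (N i (\<lambda>k. g t i k - s m t i k))"
        using C(2)[OF r, of k] C(1) comp.nonneg[OF r]
        by (simp add: abs_minus_commute ennreal_mult[symmetric] ennreal_leI)
    qed
    also have "\<dots> = ennreal C * (\<integral>\<^sup>+t. ennreal (N i (\<lambda>k. g t i k - s m t i k)) \<partial>?M)"
      using Nm[OF gm sm gl sl, of i m] by (intro nn_integral_cmult) measurable
    also have "\<dots> \<le> ennreal C * R m" by (intro mult_left_mono NR) simp
    finally show ?thesis .
  qed
  have g_int: "integrable ?M (\<lambda>t. g t i k)" for i k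
  proof -
    obtain C where C: "0 < C" "\<And>v k. v \<in> Rn (d i) \<Longrightarrow> \<bar>v k\<bar> \<le> C * N i v" using coord by blast
    have "\<forall>\<^sub>F m in sequentially. R m < 1" using R0 unfolding R_def by (rule order_tendstoD) simp
    then obtain m where m: "R m < 1" by (auto simp: eventually_sequentially)
    have "(\<integral>\<^sup>+t. ennreal (norm (s m t i k - g t i k)) \<partial>?M) < \<infinity>"
    proof -
      have "R m < \<infinity>" using m by (rule less_trans) simp
      then have "ennreal C * R m < \<infinity>" by (simp add: ennreal_mult_less_top)
      with L1[OF C, of m k] show ?thesis by (rule le_less_trans)
    qed
    then have "integrable ?M (\<lambda>t. s m t i k - g t i k)" by (intro integrableI_bounded) auto
    from Bochner_Integration.integrable_diff[OF s_int'[of m i k] this] show ?thesis by simp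
  qed
  show "integrable ?M (\<lambda>t. g t i k)" by (rule g_int)
  have lim: "(\<lambda>m. \<integral>t. indicator A t * s m t i k \<partial>?M) \<longlonglongrightarrow> (\<integral>t. indicator A t * g t i k \<partial>?M)"
    if A: "A \<in> sets ?M" for A i k
  proof (rule tendsto_L1_int)
    obtain C where C: "0 < C" "\<And>v k. v \<in> Rn (d i) \<Longrightarrow> \<bar>v k\<bar> \<le> C * N i v" using coord by blast
    show "integrable ?M (\<lambda>t. indicator A t * s m t i k)" for m by (rule s_int[OF A])
    show "integrable ?M (\<lambda>t. indicator A t * g t i k)"
      using integrable_mult_indicator[OF A g_int[of i k]] by simp
    have "(\<lambda>m. ennreal C * R m) \<longlonglongrightarrow> ennreal C * 0"
      using R0 unfolding R_def[symmetric] by (intro ennreal_tendsto_cmult) auto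
    then have CR: "(\<lambda>m. ennreal C * R m) \<longlonglongrightarrow> 0" by simp
    show "(\<lambda>m. \<integral>\<^sup>+t. ennreal (norm (indicator A t * s m t i k - indicator A t * g t i k)) \<partial>?M) \<longlonglongrightarrow> 0"
    proof (rule tendsto_sandwich[OF _ _ tendsto_const CR])
      have "(\<integral>\<^sup>+t. ennreal (norm (indicator A t * s m t i k - indicator A t * g t i k)) \<partial>?M)
          \<le> (\<integral>\<^sup>+t. ennreal (norm (s m t i k - g t i k)) \<partial>?M)" for m
        by (intro nn_integral_mono ennreal_leI) (auto simp: indicator_def)
      then show "\<forall>\<^sub>F m in sequentially. (\<integral>\<^sup>+t. ennreal (norm (indicator A t * s m t i k - indicator A t * g t i k)) \<partial>?M)
          \<le> ennreal C * R m"
        by (intro always_eventually allI order_trans[OF _ L1[OF C]])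
    qed simp
  qed
  show "J i k = (\<integral>t. g t i k \<partial>?M)"
  proof -
    obtain C where C: "0 < C" "\<And>v k. v \<in> Rn (d i) \<Longrightarrow> \<bar>v k\<bar> \<le> C * N i v" using coord by blast
    have eq: "simple_integral_linf ?M (s m) i k = (\<integral>t. s m t i k \<partial>?M)" for m i k
    proof -
      have "(\<integral>t. s m t i k \<partial>?M) = (\<integral>t. indicator (space ?M) t * s m t i k \<partial>?M)"
        by (rule Bochner_Integration.integral_cong) auto
      also have "\<dots> = simple_integral_linf ?M (s m) i k"
        unfolding simple_integral_linf_def
        using simple_function_sum(2)[OF sf[of m] finite_measure_axioms sets.top, where F = "\<lambda>y. y i k"] by simp
      finally show ?thesis by simp
    qed
    have SL: "simple_integral_linf ?M (s m) \<in> linf d N" for m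
    proof (rule memI)
      have y: "y \<in> linf d N" if "y \<in> s m ` space ?M" for y using that sl by auto
      show "simple_integral_linf ?M (s m) i \<in> Rn (d i)" for i
        unfolding simple_integral_linf_def using y by (intro Rn_sum component) auto
      show "N i (simple_integral_linf ?M (s m) i)
          \<le> (\<Sum>y\<in>s m ` space ?M. measure ?M {t \<in> space ?M. s m t = y} * linf_norm N y)" for i
      proof -
        have "N i (simple_integral_linf ?M (s m) i)
            \<le> (\<Sum>y\<in>s m ` space ?M. \<bar>measure ?M {t \<in> space ?M. s m t = y}\<bar> * N i (y i))"
          unfolding simple_integral_linf_def
          using y sf[of m]
          by (intro comp.sum_le[where f = "\<lambda>y. y i"]) (simp_all add: simple_function_def component)
        also have "\<dots> \<le> (\<Sum>y\<in>s m ` space ?M. measure ?M {t \<in> space ?M. s m t = y} * linf_norm N y)"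
          using y upper by (intro sum_mono mult_mono) (simp_all add: comp.nonneg component)
        finally show ?thesis .
      qed
    qed
    have CJ: "(\<lambda>m. C * linf_norm N (diffv (simple_integral_linf ?M (s m)) J)) \<longlonglongrightarrow> 0"
      using tendsto_mult[OF tendsto_const J0, of C] by simp
    have "(\<lambda>m. simple_integral_linf ?M (s m) i k - J i k) \<longlonglongrightarrow> 0"
    proof (rule Lim_null_comparison[OF _ CJ], rule eventuallyI)
      fix m
      have "\<bar>simple_integral_linf ?M (s m) i k - J i k\<bar> \<le> C * N i (\<lambda>k. simple_integral_linf ?M (s m) i k - J i k)"
        by (intro C(2)[of "\<lambda>k. simple_integral_linf ?M (s m) i k - J i k"] Rn_diff component SL J)
      also have "\<dots> \<le> C * linf_norm N (diffv (simple_integral_linf ?M (s m)) J)"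
        using C(1) diff_component[OF SL J, of i m] by simp
      finally show "norm (simple_integral_linf ?M (s m) i k - J i k)
          \<le> C * linf_norm N (diffv (simple_integral_linf ?M (s m)) J)" by simp
    qed
    then have "(\<lambda>m. \<integral>t. s m t i k \<partial>?M) \<longlonglongrightarrow> J i k" by (simp add: LIM_zero_iff eq)
    moreover have "(\<integral>t. indicator (space ?M) t * f t \<partial>?M) = (\<integral>t. f t \<partial>?M)" for f :: "real \<Rightarrow> real"
      by (rule Bochner_Integration.integral_cong) auto
    then have "(\<lambda>m. \<integral>t. s m t i k \<partial>?M) \<longlonglongrightarrow> (\<integral>t. g t i k \<partial>?M)"
      using lim[OF sets.top, of i k] by simp
    ultimately show ?thesis by (rule LIMSEQ_unique)
  qed
  assume e: "0 < e"
  show "\<exists>K. \<forall>A\<in>sets ?M. \<forall>i. N i (\<lambda>k. \<integral>t. indicator A t * g t i k \<partial>?M) \<le> K * measure ?M A + e"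
  proof -
    have small: "\<forall>\<^sub>F m in sequentially. R m < ennreal (e / 2)"
      using R0 unfolding R_def by (rule order_tendstoD) (use e in simp)
    then obtain p where p: "R p < ennreal (e / 2)" by (auto simp: eventually_sequentially)
    define K where "K = Max (insert 0 ((\<lambda>y. linf_norm N y) ` s p ` space ?M))"
    have finK: "finite (insert 0 ((\<lambda>y. linf_norm N y) ` s p ` space ?M))"
      using sf[of p] by (simp add: simple_function_def)
    have K: "N i (s p t i) \<le> K" if "t \<in> space ?M" for t i
    proof -
      have "linf_norm N (s p t) \<le> K" unfolding K_def using that by (intro Max_ge finK) auto
      then show ?thesis using upper[OF sl[OF that, of p], of i] by linarith
    qed
    show ?thesis
    proof (intro exI[of _ K] ballI allI)
      fix A i assume A: "A \<in> sets ?M"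
      have AS: "A \<subseteq> space ?M" using sets.sets_into_space[OF A] .
      have step: "N i (\<lambda>k. \<integral>t. indicator A t * s m t i k \<partial>?M) \<le> K * measure ?M A + e"
        if m: "R m < ennreal (e / 2)" for m
      proof -
        let ?D = "\<lambda>t. N i (\<lambda>k. s m t i k - s p t i k)"
        have yl: "y \<in> linf d N" if "y \<in> s m ` space ?M" for y using that sl by auto
        have D_simple: "simple_function ?M ?D"
          by (rule simple_function_compose2[OF sf sf, of "\<lambda>a b. N i (\<lambda>k. a i k - b i k)"])
        have D_nonneg: "0 \<le> ?D t" if "t \<in> space ?M" for t
          by (intro comp.nonneg Rn_diff component sl that)
        have "integrable ?M (\<lambda>t. indicator (space ?M) t * ?D t)"
          using simple_function_sum(1)[OF D_simple finite_measure_axioms sets.top, where F = "\<lambda>y. y"] .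
        then have D_int: "integrable ?M ?D"
          by (rule Bochner_Integration.integrable_cong[THEN iffD1, rotated 2]) auto
        have AK: "integrable ?M (\<lambda>t. indicator A t * K)"
          using A by (intro integrable_mult_left integrable_real_indicator) (auto simp: less_top[symmetric])
        have D_le: "(\<integral>t. ?D t \<partial>?M) \<le> e"
        proof -
          have "ennreal (\<integral>t. ?D t \<partial>?M) = (\<integral>\<^sup>+t. ennreal (?D t) \<partial>?M)"
            by (rule nn_integral_eq_integral[symmetric, OF D_int]) (rule AE_I2, rule D_nonneg)
          also have "\<dots> \<le> (\<integral>\<^sup>+t. ennreal (N i (\<lambda>k. g t i k - s m t i k)) + ennreal (N i (\<lambda>k. g t i k - s p t i k)) \<partial>?M)"
          proof (rule nn_integral_mono)
            fix t assume t: "t \<in> space ?M"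
            note c = component[OF sl[OF t, of m], of i] component[OF gl[OF t], of i] component[OF sl[OF t, of p], of i]
            have "?D t \<le> N i (\<lambda>k. g t i k - s m t i k) + N i (\<lambda>k. g t i k - s p t i k)"
              using comp.triangle_diff[OF c] comp.minus_commute[OF c(1,2)] by simp
            then show "ennreal (?D t) \<le> ennreal (N i (\<lambda>k. g t i k - s m t i k)) + ennreal (N i (\<lambda>k. g t i k - s p t i k))"
              using comp.nonneg[OF Rn_diff[OF c(2,1)]] comp.nonneg[OF Rn_diff[OF c(2,3)]]
              by (subst ennreal_plus[symmetric]) (assumption | rule ennreal_leI)+
          qed
          also have "\<dots> = (\<integral>\<^sup>+t. ennreal (N i (\<lambda>k. g t i k - s m t i k)) \<partial>?M)
              + (\<integral>\<^sup>+t. ennreal (N i (\<lambda>k. g t i k - s p t i k)) \<partial>?M)"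
            by (intro nn_integral_add measurable_compose[OF _ measurable_ennreal] Nm gm sm gl sl)
          also have "\<dots> \<le> ennreal (e / 2) + ennreal (e / 2)"
            by (intro add_mono order_trans[OF NR less_imp_le[OF m]] order_trans[OF NR less_imp_le[OF p]])
          also have "\<dots> = ennreal e" using e by (simp add: ennreal_plus[symmetric] del: ennreal_plus)
          finally show ?thesis using e by simp
        qed
        have "N i (\<lambda>k. \<integral>t. indicator A t * s m t i k \<partial>?M)
            = N i (\<lambda>k. \<Sum>y\<in>s m ` space ?M. measure ?M {t \<in> A. s m t = y} * y i k)"
          using simple_function_sum(2)[OF sf[of m] finite_measure_axioms A, where F = "\<lambda>y. y i k" for k] by simp
        also have "\<dots> \<le> (\<Sum>y\<in>s m ` space ?M. \<bar>measure ?M {t \<in> A. s m t = y}\<bar> * N i (y i))"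
          using yl sf[of m]
          by (intro comp.sum_le[where f = "\<lambda>y. y i"]) (simp_all add: simple_function_def component)
        also have "\<dots> = (\<integral>t. indicator A t * N i (s m t i) \<partial>?M)"
          using simple_function_sum(2)[OF sf[of m] finite_measure_axioms A, where F = "\<lambda>y. N i (y i)"] by simp
        also have "\<dots> \<le> (\<integral>t. indicator A t * K + ?D t \<partial>?M)"
        proof (rule integral_mono)
          show "integrable ?M (\<lambda>t. indicator A t * N i (s m t i))"
            using simple_function_sum(1)[OF sf[of m] finite_measure_axioms A, where F = "\<lambda>y. N i (y i)"] .
          show "integrable ?M (\<lambda>t. indicator A t * K + ?D t)"
            by (intro Bochner_Integration.integrable_add AK D_int)
          fix t assume t: "t \<in> space ?M"
          have "N i (s m t i) \<le> K + ?D t"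
            using comp.le_diff[OF component[OF sl[OF t, of m], of i] component[OF sl[OF t, of p], of i]] K[OF t, of i] by simp
          then show "indicator A t * N i (s m t i) \<le> indicator A t * K + ?D t"
            using D_nonneg[OF t] by (auto simp: indicator_def)
        qed
        also have "\<dots> = K * measure ?M A + (\<integral>t. ?D t \<partial>?M)"
          using Bochner_Integration.integral_add[OF AK D_int] Int_absorb2[OF AS] by (simp add: mult.commute)
        finally show ?thesis using D_le by simp
      qed
      have "(\<lambda>m. N i (\<lambda>k. \<integral>t. indicator A t * s m t i k \<partial>?M)) \<longlonglongrightarrow> N i (\<lambda>k. \<integral>t. indicator A t * g t i k \<partial>?M)"
      proof (rule comp.tendsto(1))
        have z: "x i k = 0" if "x \<in> linf d N" "d i \<le> k" for x k
          using component[OF that(1), of i] that(2) by (simp add: Rn_def)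
        show "(\<lambda>m. \<integral>t. indicator A t * s m t i k \<partial>?M) \<longlonglongrightarrow> (\<integral>t. indicator A t * g t i k \<partial>?M)" for k
          by (rule lim[OF A])
        have "(\<integral>t. indicator A t * s m t i k \<partial>?M) = 0" if "d i \<le> k" for k m
        proof -
          have "indicator A t * s m t i k = 0" if "t \<in> space ?M" for t
            using z[OF sl[OF that, of m] \<open>d i \<le> k\<close>] by simp
          then show ?thesis by (intro integral_eq_zero_AE AE_I2)
        qed
        then show "\<forall>\<^sub>F m in sequentially. (\<lambda>k. \<integral>t. indicator A t * s m t i k \<partial>?M) \<in> Rn (d i)"
          unfolding Rn_def by (intro always_eventually allI CollectI impI)
        have "(\<integral>t. indicator A t * g t i k \<partial>?M) = 0" if "d i \<le> k" for k
        proof -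
          have "indicator A t * g t i k = 0" if "t \<in> space ?M" for t
            using z[OF gl[OF that] \<open>d i \<le> k\<close>] by simp
          then show ?thesis by (intro integral_eq_zero_AE AE_I2)
        qed
        then show "(\<lambda>k. \<integral>t. indicator A t * g t i k \<partial>?M) \<in> Rn (d i)"
          unfolding Rn_def by (intro allI CollectI impI)
      qed
      then show "N i (\<lambda>k. \<integral>t. indicator A t * g t i k \<partial>?M) \<le> K * measure ?M A + e"
      proof (rule tendsto_upperbound)
        show "\<forall>\<^sub>F m in sequentially. N i (\<lambda>k. \<integral>t. indicator A t * s m t i k \<partial>?M) \<le> K * measure ?M A + e"
          using small by (rule eventually_mono) (rule step)
      qed simp
    qed
  qed
qed

end

section \<open>Solutions of the network\<close>

context linf_space begin

sublocale M: Metric_space "linf d N" "linf_dist d N"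
  by (rule Metric_space_linf) (rule norms)

lemma continuous_map_linf_iff:
  fixes S :: "real set"
  shows "continuous_map (top_of_set S) (mtopology_of (linf_metric d N)) f \<longleftrightarrow>
    f \<in> S \<rightarrow> linf d N \<and>
    (\<forall>s\<in>S. \<forall>e>0. \<exists>\<delta>>0. \<forall>r\<in>S. \<bar>r - s\<bar> < \<delta> \<longrightarrow> linf_norm N (diffv (f r) (f s)) < e)"
    (is "?C \<longleftrightarrow> ?E")
proof -
  have C: "?C \<longleftrightarrow> (\<forall>s\<in>S. \<forall>e>0. \<exists>U. openin (top_of_set S) U \<and> s \<in> U \<and> (\<forall>r\<in>U. f r \<in> M.mball (f s) e))"
    by (simp add: linf_metric_def M.continuous_map_to_metric)
  show ?thesis
  proof
    assume L: ?C
    have mem: "f \<in> S \<rightarrow> linf d N"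
      using continuous_map_funspace[OF L] by (simp add: linf_metric_def)
    have "\<exists>\<delta>>0. \<forall>r\<in>S. \<bar>r - s\<bar> < \<delta> \<longrightarrow> linf_norm N (diffv (f r) (f s)) < e" if s: "s \<in> S" and e: "0 < e" for s e
    proof -
      obtain U where U: "openin (top_of_set S) U" "s \<in> U" "\<And>r. r \<in> U \<Longrightarrow> f r \<in> M.mball (f s) e"
        using C L s e by meson
      obtain \<delta> where \<delta>: "\<delta> > 0" "ball s \<delta> \<inter> S \<subseteq> U"
        using U(1,2) unfolding openin_contains_ball by blast
      have "linf_norm N (diffv (f r) (f s)) < e" if r: "r \<in> S" "\<bar>r - s\<bar> < \<delta>" for r
      proof -
        have m: "f s \<in> linf d N" "f r \<in> linf d N" using mem s r by auto
        have "r \<in> U" using \<delta>(2) r by (auto simp: dist_real_def abs_minus_commute)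
        then have "linf_dist d N (f s) (f r) < e" using U(3) by simp
        then have "linf_norm N (diffv (f s) (f r)) < e" using m by (simp add: linf_dist_def)
        then show ?thesis using norm_diff_commute[OF m] by simp
      qed
      with \<delta>(1) show ?thesis by blast
    qed
    with mem show ?E by blast
  next
    assume R: ?E
    show ?C unfolding C
    proof (intro ballI allI impI)
      fix s and e :: real assume s: "s \<in> S" and e: "0 < e"
      then obtain \<delta> where \<delta>: "\<delta> > 0" "\<And>r. r \<in> S \<Longrightarrow> \<bar>r - s\<bar> < \<delta> \<Longrightarrow> linf_norm N (diffv (f r) (f s)) < e"
        using R by blast
      show "\<exists>U. openin (top_of_set S) U \<and> s \<in> U \<and> (\<forall>r\<in>U. f r \<in> M.mball (f s) e)"
      proof (intro exI[of _ "S \<inter> ball s \<delta>"] conjI ballI)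
        show "openin (top_of_set S) (S \<inter> ball s \<delta>)" by auto
        show "s \<in> S \<inter> ball s \<delta>" using s \<delta> by simp
        fix r assume r: "r \<in> S \<inter> ball s \<delta>"
        then have "linf_norm N (diffv (f r) (f s)) < e"
          by (intro \<delta>(2)) (auto simp: dist_real_def abs_minus_commute)
        moreover have "f r \<in> linf d N" "f s \<in> linf d N" using R r s by auto
        ultimately show "f r \<in> M.mball (f s) e"
          using norm_diff_commute[of "f r" "f s"] by (simp add: linf_dist_def)
      qed
    qed
  qed
qed

lemma continuous_map_linf_coordinate:
  fixes S :: "real set"
  assumes f: "continuous_map (top_of_set S) (mtopology_of (linf_metric d N)) f"
  shows "continuous_on S (\<lambda>s. f s i k)"
  unfolding continuous_on_iff
proof (intro ballI allI impI)
  fix s and e :: real assume s: "s \<in> S" and e: "0 < e"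
  note F = f[unfolded continuous_map_linf_iff]
  obtain C where C: "0 < C" "\<And>v k. v \<in> Rn (d i) \<Longrightarrow> \<bar>v k\<bar> \<le> C * N i v"
    using comp.coordinate_le[of i] by blast
  obtain \<delta> where \<delta>: "\<delta> > 0" "\<And>r. r \<in> S \<Longrightarrow> \<bar>r - s\<bar> < \<delta> \<Longrightarrow> linf_norm N (diffv (f r) (f s)) < e / C"
    using F s divide_pos_pos[OF e C(1)] by blast
  have "dist (f r i k) (f s i k) < e" if r: "r \<in> S" "dist r s < \<delta>" for r
  proof -
    have mem: "f r \<in> linf d N" "f s \<in> linf d N" using F r s by auto
    have "\<bar>f r i k - f s i k\<bar> \<le> C * N i (\<lambda>k. f r i k - f s i k)"
      using C(2)[OF Rn_diff[OF component[OF mem(1)] component[OF mem(2)]]] .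
    also have "\<dots> \<le> C * linf_norm N (diffv (f r) (f s))"
      using C(1) diff_component[OF mem] by simp
    also have "\<dots> < e" using \<delta>(2)[of r] r C(1) by (simp add: dist_real_def field_simps)
    finally show ?thesis by (simp add: dist_real_def)
  qed
  with \<delta>(1) show "\<exists>\<delta>>0. \<forall>r\<in>S. dist r s < \<delta> \<longrightarrow> dist (f r i k) (f s i k) < e" by blast
qed

end

lemma lebesgue_on_indicator:
  fixes f :: "real \<Rightarrow> real"
  assumes "0 \<le> t" "t \<le> b"
  shows "(\<integral>s. indicator {0..t} s * f s \<partial>lebesgue_on {0..b}) = (\<integral>s. f s \<partial>lebesgue_on {0..t})"
proof -
  have "(\<integral>s. indicator {0..t} s * f s \<partial>lebesgue_on {0..b}) = (\<integral>s. indicator {0..b} s *\<^sub>R (indicator {0..t} s * f s) \<partial>lebesgue)"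
    by (rule integral_restrict_space) simp
  also have "\<dots> = (\<integral>s. indicator {0..t} s *\<^sub>R f s \<partial>lebesgue)"
    by (rule Bochner_Integration.integral_cong) (use assms in \<open>auto simp: indicator_def\<close>)
  also have "\<dots> = (\<integral>s. f s \<partial>lebesgue_on {0..t})"
    by (rule integral_restrict_space[symmetric]) simp
  finally show ?thesis .
qed

locale admissible_network =
  fixes \<Sigma> :: network
  assumes network: "infinite_network \<Sigma>"
begin

sublocale X: linf_space "state_dim \<Sigma>" "state_norm \<Sigma>"
  using network by unfold_locales (simp add: infinite_network_def)

sublocale U: linf_space "input_dim \<Sigma>" "input_norm \<Sigma>"
  using network by unfold_locales (simp add: infinite_network_def)

lemma solution_state: "is_solution \<Sigma> x0 u T lam \<Longrightarrow> 0 \<le> t \<Longrightarrow> ereal t < T \<Longrightarrow> lam t \<in> state_space \<Sigma>"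
  by (simp add: is_solution_def)

lemma solution_bochner:
  "is_solution \<Sigma> x0 u T lam \<Longrightarrow> 0 \<le> t \<Longrightarrow> ereal t < T \<Longrightarrow>
    has_bochner_integral_linf (lebesgue_on {0..t}) (state_dim \<Sigma>) (state_norm \<Sigma>)
      (\<lambda>s. network_rhs \<Sigma> (lam s) (u s)) (diffv (lam t) x0)"
  by (simp add: is_solution_def)

lemma solution_integral:
  assumes "is_solution \<Sigma> x0 u T lam" "0 \<le> t" "ereal t < T"
  shows "integrable (lebesgue_on {0..t}) (\<lambda>s. network_rhs \<Sigma> (lam s) (u s) i k)"
    and "lam t i k = x0 i k + (\<integral>s. network_rhs \<Sigma> (lam s) (u s) i k \<partial>lebesgue_on {0..t})"
  using X.bochner_integral_facts(1,2)[OF _ solution_bochner[OF assms], of i k]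
  by (simp_all add: diffv_def)

lemma solution_initial:
  assumes "is_solution \<Sigma> x0 u T lam" shows "lam 0 = x0"
proof -
  have "0 < T" using assms by (simp add: is_solution_def)
  then have "lam 0 i k = x0 i k" for i k
    using solution_integral[OF assms, of 0 i k] lebesgue_integral_eq_integral[of "{0..0::real}" "\<lambda>s. network_rhs \<Sigma> (lam s) (u s) i k"]
    by (simp add: zero_ereal_def[symmetric])
  then show ?thesis by (simp add: fun_eq_iff)
qed

text \<open>The constant is taken from the absolute continuity of a single integral, the one over \<open>[0, b]\<close>, of
which the increments of the solution are partial integrals.\<close>

lemma solution_equicontinuous:
  assumes sol: "is_solution \<Sigma> x0 u T lam" and b: "0 \<le> b" "ereal b < T" and e: "0 < e"
  obtains K where "\<And>t t'. 0 \<le> t \<Longrightarrow> t \<le> t' \<Longrightarrow> t' \<le> b \<Longrightarrow> normX \<Sigma> (diffv (lam t') (lam t)) \<le> K * (t' - t) + e"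
proof -
  let ?g = "\<lambda>s. network_rhs \<Sigma> (lam s) (u s)"
  let ?M = "lebesgue_on {0..b}"
  obtain K where K: "\<And>A i. A \<in> sets ?M \<Longrightarrow>
      state_norm \<Sigma> i (\<lambda>k. \<integral>t. indicator A t * ?g t i k \<partial>?M) \<le> K * measure ?M A + e"
    using X.bochner_integral_facts(3)[OF _ solution_bochner[OF sol b] e] by auto
  show thesis
  proof (rule that, rule X.least)
    fix t t' i assume t: "0 \<le> t" "t \<le> t'" "t' \<le> b"
    let ?A = "{t<..t'}"
    have T: "ereal t < T" "ereal t' < T" using t b(2) by (meson ereal_less_eq(3) le_less_trans order_trans)+
    have A: "?A \<in> sets ?M" using t by (simp add: sets_restrict_space_iff) auto
    have int: "integrable ?M (\<lambda>s. indicator {0..r} s * ?g s i k)" if "r \<le> b" for r k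
    proof -
      have "{0..r} \<in> sets ?M" using that by (simp add: sets_restrict_space_iff)
      then show ?thesis
        using integrable_mult_indicator[OF _ solution_integral(1)[OF sol b, of i k]] by simp
    qed
    have "diffv (lam t') (lam t) i k = (\<integral>s. indicator ?A s * ?g s i k \<partial>?M)" for k
    proof -
      have "lam t' i k - lam t i k = (\<integral>s. indicator {0..t'} s * ?g s i k \<partial>?M) - (\<integral>s. indicator {0..t} s * ?g s i k \<partial>?M)"
        using solution_integral(2)[OF sol _ T(1), of i k] solution_integral(2)[OF sol _ T(2), of i k] t
        by (simp add: lebesgue_on_indicator)
      also have "\<dots> = (\<integral>s. indicator {0..t'} s * ?g s i k - indicator {0..t} s * ?g s i k \<partial>?M)"
        using int t by (intro Bochner_Integration.integral_diff[symmetric]) auto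
      also have "\<dots> = (\<integral>s. indicator ?A s * ?g s i k \<partial>?M)"
        by (rule Bochner_Integration.integral_cong) (use t in \<open>auto simp: indicator_def\<close>)
      finally show ?thesis by (simp add: diffv_def)
    qed
    then have "diffv (lam t') (lam t) i = (\<lambda>k. \<integral>s. indicator ?A s * ?g s i k \<partial>?M)" by (rule ext)
    moreover have "measure ?M ?A = t' - t"
    proof -
      have "measure ?M ?A = measure lebesgue ?A" by (rule measure_restrict_space) (use t in auto)
      then show ?thesis using t by simp
    qed
    ultimately show "state_norm \<Sigma> i (diffv (lam t') (lam t) i) \<le> K * (t' - t) + e"
      using K[OF A, of i] by simp
  qed
qed

lemma solution_continuous:
  assumes sol: "is_solution \<Sigma> x0 u T lam"
  shows "continuous_map (top_of_set {t. 0 \<le> t \<and> ereal t < T}) (mtopology_of (metricX \<Sigma>)) lam"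
  unfolding X.continuous_map_linf_iff
proof (intro conjI ballI allI impI)
  show "lam \<in> {t. 0 \<le> t \<and> ereal t < T} \<rightarrow> state_space \<Sigma>" using solution_state[OF sol] by auto
  fix s and e :: real assume s: "s \<in> {t. 0 \<le> t \<and> ereal t < T}" and e: "0 < e"
  then obtain b where b: "s < b" "ereal b < T" using ereal_dense2[of "ereal s" T] by auto
  with s have b0: "0 \<le> b" by simp
  obtain K where K: "\<And>t t'. 0 \<le> t \<Longrightarrow> t \<le> t' \<Longrightarrow> t' \<le> b \<Longrightarrow> normX \<Sigma> (diffv (lam t') (lam t)) \<le> K * (t' - t) + e / 2"
    using solution_equicontinuous[OF sol b0 b(2), of "e / 2"] e by auto
  define \<delta> where "\<delta> = min (b - s) (e / (2 * (\<bar>K\<bar> + 1)))"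
  have \<delta>: "0 < \<delta>" using b e by (simp add: \<delta>_def)
  have "normX \<Sigma> (diffv (lam r) (lam s)) < e" if r: "r \<in> {t. 0 \<le> t \<and> ereal t < T}" "\<bar>r - s\<bar> < \<delta>" for r
  proof -
    have "K * \<bar>r - s\<bar> \<le> (\<bar>K\<bar> + 1) * \<bar>r - s\<bar>" by (intro mult_right_mono) auto
    also have "\<dots> < e / 2" using r(2) by (simp add: \<delta>_def field_simps)
    finally have small: "K * \<bar>r - s\<bar> + e / 2 < e" by simp
    have rb: "r \<le> b" using r(2) unfolding \<delta>_def by linarith
    show ?thesis
    proof (cases "s \<le> r")
      case True
      then show ?thesis using K[of s r] small s rb by simp
    next
      case False
      then have "normX \<Sigma> (diffv (lam s) (lam r)) < e" using K[of r s] small r b by simp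
      then show ?thesis
        using X.norm_diff_commute[OF solution_state[OF sol] solution_state[OF sol], of s r] r s by simp
    qed
  qed
  with \<delta> show "\<exists>\<delta>>0. \<forall>r\<in>{t. 0 \<le> t \<and> ereal t < T}. \<bar>r - s\<bar> < \<delta> \<longrightarrow> normX \<Sigma> (diffv (lam r) (lam s)) < e"
    by blast
qed

lemma input_space_value: "u \<in> input_functions \<Sigma> \<Longrightarrow> 0 \<le> s \<Longrightarrow> u s \<in> input_space \<Sigma>"
  by (auto simp: input_functions_def strongly_measurable_def)

lemma input_right_continuous:
  assumes u: "u \<in> input_functions \<Sigma>" and s: "0 \<le> s"
  obtains b where "s < b" "continuous_map (top_of_set {s..<b}) (mtopology_of (metricU \<Sigma>)) u"
proof -
  obtain a :: "nat \<Rightarrow> real" where a: "(\<Union>k. {a k..<a (Suc k)}) = {0..}"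
    "\<And>k. continuous_map (top_of_set {a k..<a (Suc k)}) (mtopology_of (metricU \<Sigma>)) u"
    using u unfolding input_functions_def piecewise_right_continuous_def by blast
  have "s \<in> (\<Union>k. {a k..<a (Suc k)})" unfolding a(1) using s by simp
  then obtain k where k: "s \<in> {a k..<a (Suc k)}" by blast
  have "continuous_map (top_of_set {s..<a (Suc k)}) (mtopology_of (metricU \<Sigma>)) u"
    by (rule continuous_map_from_subtopology_mono[OF a(2)[of k]]) (use k in auto)
  then show thesis using that[of "a (Suc k)"] k by simp
qed

text \<open>By right continuity a value beyond the essential supremum would persist on an interval of positive
length. So the essential bound holds at every time.\<close>

lemma input_norm_le:
  assumes u: "u \<in> input_functions \<Sigma>" and s: "0 \<le> s"
  shows "normU \<Sigma> (u s) \<le> norm_input \<Sigma> u"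
proof -
  have le: "ereal (normU \<Sigma> (u s)) \<le> ess_sup_normU \<Sigma> u" if s: "0 \<le> s" for s
  proof (rule ccontr)
    assume "\<not> ?thesis"
    then obtain c where c: "ess_sup_normU \<Sigma> u < ereal c" "c < normU \<Sigma> (u s)"
      using ereal_dense2[of "ess_sup_normU \<Sigma> u" "ereal (normU \<Sigma> (u s))"] by (auto simp: not_le)
    obtain b where b: "s < b" "continuous_map (top_of_set {s..<b}) (mtopology_of (metricU \<Sigma>)) u"
      using input_right_continuous[OF u s] .
    have "s \<in> {s..<b}" "0 < normU \<Sigma> (u s) - c" using b c by auto
    then obtain \<delta> where \<delta>: "\<delta> > 0"
      "\<And>r. r \<in> {s..<b} \<Longrightarrow> \<bar>r - s\<bar> < \<delta> \<Longrightarrow> normU \<Sigma> (diffv (u r) (u s)) < normU \<Sigma> (u s) - c"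
      using b(2) unfolding U.continuous_map_linf_iff by meson
    define b' where "b' = min b (s + \<delta>)"
    have b': "s < b'" using b \<delta> by (simp add: b'_def)
    have big: "ess_sup_normU \<Sigma> u < ereal (normU \<Sigma> (u r))" if r: "r \<in> {s..<b'}" for r
    proof -
      have mem: "u s \<in> input_space \<Sigma>" "u r \<in> input_space \<Sigma>"
        using input_space_value[OF u] s r by auto
      have "normU \<Sigma> (diffv (u r) (u s)) < normU \<Sigma> (u s) - c"
        using \<delta>(2)[of r] r by (simp add: b'_def)
      then have "c < normU \<Sigma> (u r)"
        using U.norm_triangle[OF mem] U.norm_diff_commute[OF mem] by simp
      with c(1) show ?thesis using less_trans[of _ "ereal c"] by simp
    qed
    have "AE r in lebesgue_on {0..}. ereal (normU \<Sigma> (u r)) \<le> ess_sup_normU \<Sigma> u"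
      unfolding ess_sup_normU_def by (rule esssup_AE)
    then have "AE r in lebesgue. r \<in> {0..} \<longrightarrow> ereal (normU \<Sigma> (u r)) \<le> ess_sup_normU \<Sigma> u"
      by (simp add: AE_restrict_space_iff)
    then have "AE r in lebesgue. r \<notin> {s..<b'}"
      by eventually_elim (use big s in fastforce)
    then have "{s..<b'} \<in> null_sets lebesgue" by (subst AE_iff_null_sets) auto
    then have "emeasure lebesgue {s..<b'} = 0" by auto
    then show False using b' by (simp add: emeasure_lborel_Ico)
  qed
  have "ess_sup_normU \<Sigma> u < \<infinity>" using u by (simp add: input_functions_def)
  then have "\<bar>ess_sup_normU \<Sigma> u\<bar> \<noteq> \<infinity>" using le[OF s] by (cases "ess_sup_normU \<Sigma> u") auto
  then have "ereal (norm_input \<Sigma> u) = ess_sup_normU \<Sigma> u"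
    by (simp add: norm_input_def ereal_real)
  then show ?thesis using le[OF s] by (metis ereal_less_eq(3))
qed

lemma norm_input_nonneg: "u \<in> input_functions \<Sigma> \<Longrightarrow> 0 \<le> norm_input \<Sigma> u"
  using input_norm_le[of u 0] U.norm_nonneg[OF input_space_value, of u 0] by simp

lemma restricted_state_internal_input:
  "x \<in> state_space \<Sigma> \<Longrightarrow> restrict_to (neighbours \<Sigma> i) x \<in> internal_inputs \<Sigma> i"
  using X.component by (auto simp: restrict_to_def internal_inputs_def)

lemma rhs_continuous:
  fixes S :: "real set"
  assumes lam: "continuous_map (top_of_set S) (mtopology_of (metricX \<Sigma>)) lam"
    and u: "continuous_map (top_of_set S) (mtopology_of (metricU \<Sigma>)) u"
  shows "continuous_on S (\<lambda>s. network_rhs \<Sigma> (lam s) (u s) i k)"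
proof -
  let ?D = "Rn (state_dim \<Sigma> i) \<times> internal_inputs \<Sigma> i \<times> Rn (input_dim \<Sigma> i)"
  let ?p = "\<lambda>s. (lam s i, restrict_to (neighbours \<Sigma> i) (lam s), u s i)"
  have f: "continuous_on ?D (\<lambda>(\<xi>, w, v). rhs \<Sigma> i \<xi> w v)"
    using network by (simp add: infinite_network_def)
  have mem: "lam s \<in> state_space \<Sigma>" "u s \<in> input_space \<Sigma>" if "s \<in> S" for s
    using lam u that unfolding X.continuous_map_linf_iff U.continuous_map_linf_iff by auto
  note c = X.continuous_map_linf_coordinate[OF lam]
  have "continuous_on S (\<lambda>s. restrict_to (neighbours \<Sigma> i) (lam s) j k)" for j k
    by (cases "j \<in> neighbours \<Sigma> i") (simp_all add: restrict_to_def c)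
  then have "continuous_on S ?p"
    by (intro continuous_on_Pair continuous_on_coordinatewise_then_product c
        U.continuous_map_linf_coordinate[OF u])
  then have "continuous_on S (\<lambda>s. (\<lambda>(\<xi>, w, v). rhs \<Sigma> i \<xi> w v) (?p s))"
    by (rule continuous_on_compose2[OF f])
      (use mem X.component U.component restricted_state_internal_input in auto)
  then have "continuous_on S (\<lambda>s. rhs \<Sigma> i (lam s i) (restrict_to (neighbours \<Sigma> i) (lam s)) (u s i))"
    by simp
  then show ?thesis unfolding network_rhs_def by (rule continuous_on_product_then_coordinatewise)
qed

text \<open>Between two jumps of the input the integrand is continuous in each coordinate, and the fundamental
theorem of calculus applies.\<close>

lemma solution_deriv:
  assumes sol: "is_solution \<Sigma> x0 u T lam" and \<tau>: "0 \<le> \<tau>" and b: "ereal b \<le> T"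
    and u: "continuous_map (top_of_set {\<tau>..<b}) (mtopology_of (metricU \<Sigma>)) u"
    and t: "\<tau> < t" "t < b"
  shows "((\<lambda>t. lam t i k) has_real_derivative network_rhs \<Sigma> (lam t) (u t) i k) (at t)"
proof -
  let ?g = "\<lambda>s. network_rhs \<Sigma> (lam s) (u s) i k"
  obtain c where c: "t < c" "c < b" using dense[OF t(2)] by blast
  have T: "ereal s < T" if "s < b" for s using that b by (meson ereal_less(2) less_ereal.simps(1) less_le_trans)
  have "continuous_on {\<tau>..<b} ?g"
    by (intro rhs_continuous[OF _ u] continuous_map_from_subtopology_mono[OF solution_continuous[OF sol]])
      (use \<tau> T in auto)
  then have g: "continuous_on {\<tau>..c} ?g" by (rule continuous_on_subset) (use c in auto)
  have lam: "lam s i k = lam \<tau> i k + integral {\<tau>..s} ?g" if s: "\<tau> \<le> s" "s \<le> c" for s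
  proof -
    have sT: "ereal \<tau> < T" "ereal s < T" using T s c by auto
    have "0 \<le> s" using s \<tau> by simp
    note I = solution_integral[OF sol this sT(2), of i k] solution_integral[OF sol \<tau> sT(1), of i k]
    have "integral {0..\<tau>} ?g + integral {\<tau>..s} ?g = integral {0..s} ?g"
      using s \<tau> I(1) by (intro Henstock_Kurzweil_Integration.integral_combine integrable_on_lebesgue_on) auto
    then show ?thesis using I lebesgue_integral_eq_integral[OF I(1)] lebesgue_integral_eq_integral[OF I(3)] by simp
  qed
  have "((\<lambda>s. integral {\<tau>..s} ?g) has_real_derivative ?g t) (at t within {\<tau>..c})"
    by (rule integral_has_real_derivative[OF g]) (use t c in auto)
  then have "((\<lambda>s. integral {\<tau>..s} ?g) has_real_derivative ?g t) (at t)"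
    using t c by (simp add: at_within_Icc_at)
  then have D: "((\<lambda>s. lam \<tau> i k + integral {\<tau>..s} ?g) has_real_derivative ?g t) (at t)"
    by (auto intro!: derivative_eq_intros)
  show ?thesis
  proof (rule has_field_derivative_transform_within_open[OF D, of "{\<tau><..<c}"])
    show "lam \<tau> i k + integral {\<tau>..s} ?g = lam s i k" if "s \<in> {\<tau><..<c}" for s
      by (rule lam[symmetric]) (use that in auto)
  qed (use t c in auto)
qed

lemma flow_eq_solution:
  assumes wp: "well_posed \<Sigma>" and x0: "x0 \<in> state_space \<Sigma>" and u: "u \<in> input_functions \<Sigma>"
    and sol: "is_solution \<Sigma> x0 u T lam" and t: "0 \<le> t" "ereal t < T"
  shows "flow \<Sigma> t x0 u = lam t"
  unfolding flow_def
proof (rule the_equality)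
  show "\<exists>T lam'. is_solution \<Sigma> x0 u T lam' \<and> 0 \<le> t \<and> ereal t < T \<and> lam t = lam' t"
    using sol t by blast
  fix y assume "\<exists>T lam. is_solution \<Sigma> x0 u T lam \<and> 0 \<le> t \<and> ereal t < T \<and> y = lam t"
  then obtain T' lam' where s': "is_solution \<Sigma> x0 u T' lam'" "ereal t < T'" "y = lam' t" by blast
  have "\<forall>t. 0 \<le> t \<and> ereal t < min T' T \<longrightarrow> lam' t = lam t"
    using wp x0 u sol s'(1) unfolding well_posed_def by blast
  then show "y = lam t" using s' t by simp
qed

end

section \<open>Input-to-state stability from decay along solutions\<close>

lemma is_solution_cong:
  assumes sol: "is_solution \<Sigma> x0 u T lam" and eq: "\<And>t. 0 \<le> t \<Longrightarrow> ereal t < T' \<Longrightarrow> lam' t = lam t"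
    and T: "0 < T'" "T' \<le> T"
  shows "is_solution \<Sigma> x0 u T' lam'"
  unfolding is_solution_def
proof (intro conjI allI impI T(1))
  fix t assume t: "0 \<le> t \<and> ereal t < T'"
  then have tT: "0 \<le> t" "ereal t < T" using T by auto
  show "lam' t \<in> state_space \<Sigma>" using sol tT eq[of t] t by (simp add: is_solution_def)
  let ?M = "lebesgue_on {0..t}"
  let ?g = "\<lambda>lam s. network_rhs \<Sigma> (lam s) (u s)"
  have g: "?g lam' s = ?g lam s" if "s \<in> space ?M" for s
  proof -
    have "0 \<le> s" "ereal s < T'" using that t by (auto intro: le_less_trans[of _ "ereal t"])
    then show ?thesis using eq by simp
  qed
  have J: "diffv (lam' t) x0 = diffv (lam t) x0" using eq t by simp
  have "has_bochner_integral_linf ?M (state_dim \<Sigma>) (state_norm \<Sigma>) (?g lam) (diffv (lam t) x0)"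
    using sol tT by (simp add: is_solution_def)
  moreover have "?g lam' \<in> space ?M \<rightarrow> A \<longleftrightarrow> ?g lam \<in> space ?M \<rightarrow> A" for A
    using g by (simp add: Pi_iff)
  moreover have "(AE s in ?M. (\<lambda>m. normX \<Sigma> (diffv (?g lam' s) (sq m s))) \<longlonglongrightarrow> 0) \<longleftrightarrow>
      (AE s in ?M. (\<lambda>m. normX \<Sigma> (diffv (?g lam s) (sq m s))) \<longlonglongrightarrow> 0)" for sq :: "nat \<Rightarrow> real \<Rightarrow> seqvec"
    by (rule AE_cong) (simp only: g)
  moreover have "(\<integral>\<^sup>+s. ennreal (normX \<Sigma> (diffv (?g lam' s) (h s))) \<partial>?M) =
      (\<integral>\<^sup>+s. ennreal (normX \<Sigma> (diffv (?g lam s) (h s))) \<partial>?M)" for h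
    by (rule nn_integral_cong) (simp only: g)
  ultimately show "has_bochner_integral_linf ?M (state_dim \<Sigma>) (state_norm \<Sigma>) (?g lam') (diffv (lam' t) x0)"
    unfolding has_bochner_integral_linf_def strongly_measurable_def J by simp
qed

lemma class_KL_time_mono:
  assumes \<beta>: "\<beta> \<in> class_KL" and "0 \<le> r" "0 \<le> t" shows "\<beta> r t \<le> \<beta> r 0"
proof (cases "r = 0")
  case True
  have "(\<lambda>r. \<beta> r t) \<in> class_P" "(\<lambda>r. \<beta> r 0) \<in> class_P"
    using \<beta> assms(3) by (auto simp: class_KL_def class_K_def)
  then show ?thesis using True by (simp add: class_P_def)
next
  case False
  then have "strict_antimono_on {0..} (\<beta> r)" using \<beta> assms(2) by (simp add: class_KL_def)
  then show ?thesis using assms(3) by (cases "t = 0") (auto simp: monotone_on_def intro: less_imp_le)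
qed

context admissible_network begin

text \<open>Being a solution on \<open>[0, T)\<close> is a condition on the compact subintervals \<open>[0, t]\<close>, and by uniqueness
the flow agrees with any local solution there.\<close>

lemma flow_is_solution:
  assumes wp: "well_posed \<Sigma>" and x0: "x0 \<in> state_space \<Sigma>" and u: "u \<in> input_functions \<Sigma>"
    and T: "0 < T" and ex: "\<And>t. 0 \<le> t \<Longrightarrow> ereal t < T \<Longrightarrow> \<exists>T' lam. is_solution \<Sigma> x0 u T' lam \<and> ereal t < T'"
  shows "is_solution \<Sigma> x0 u T (\<lambda>t. flow \<Sigma> t x0 u)"
  unfolding is_solution_def
proof (intro conjI allI impI T)
  fix t assume t: "0 \<le> t \<and> ereal t < T"
  then obtain T' lam where sol: "is_solution \<Sigma> x0 u T' lam" "ereal t < T'" using ex by blast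
  have "is_solution \<Sigma> x0 u T' (\<lambda>t. flow \<Sigma> t x0 u)"
    by (rule is_solution_cong[OF sol(1)])
      (use sol in \<open>auto simp: is_solution_def intro!: flow_eq_solution[OF wp x0 u sol(1)]\<close>)
  then show "flow \<Sigma> t x0 u \<in> state_space \<Sigma>"
    "has_bochner_integral_linf (lebesgue_on {0..t}) (state_dim \<Sigma>) (state_norm \<Sigma>)
      (\<lambda>s. network_rhs \<Sigma> (flow \<Sigma> s x0 u) (u s)) (diffv (flow \<Sigma> t x0 u) x0)"
    using t sol(2) by (auto simp: is_solution_def)
qed

text \<open>The flow is a solution up to the supremum of all lifetimes. If that supremum were
finite, the bound would permit a continuation beyond it.\<close>

lemma bounded_solutions_imp_global_flow:
  assumes wp: "well_posed \<Sigma>" and bic: "bounded_implies_continuation \<Sigma>"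
    and x0: "x0 \<in> state_space \<Sigma>" and u: "u \<in> input_functions \<Sigma>"
    and bound: "\<And>T lam t. is_solution \<Sigma> x0 u T lam \<Longrightarrow> 0 \<le> t \<Longrightarrow> ereal t < T \<Longrightarrow> normX \<Sigma> (lam t) \<le> C"
  shows "is_solution \<Sigma> x0 u \<infinity> (\<lambda>t. flow \<Sigma> t x0 u)"
proof -
  define S where "S = {T. \<exists>lam. is_solution \<Sigma> x0 u T lam}"
  define T where "T = Sup S"
  obtain T0 lam0 where s0: "is_solution \<Sigma> x0 u T0 lam0" using wp x0 u unfolding well_posed_def by blast
  then have "0 < T0" "T0 \<le> T" by (auto simp: is_solution_def T_def S_def intro: Sup_upper)
  then have "0 < T" by simp
  then have sol: "is_solution \<Sigma> x0 u T (\<lambda>t. flow \<Sigma> t x0 u)"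
  proof (rule flow_is_solution[OF wp x0 u])
    fix t assume "ereal t < T"
    then show "\<exists>T' lam. is_solution \<Sigma> x0 u T' lam \<and> ereal t < T'"
      unfolding T_def less_Sup_iff S_def by blast
  qed
  have "T = \<infinity>"
  proof (rule ccontr)
    assume "T \<noteq> \<infinity>"
    then have "T < \<infinity>" by simp
    with sol bound have "is_solution \<Sigma> x0 u T (\<lambda>t. flow \<Sigma> t x0 u) \<and> T < \<infinity> \<and>
        (\<exists>C. \<forall>t. 0 \<le> t \<and> ereal t < T \<longrightarrow> normX \<Sigma> (flow \<Sigma> t x0 u) \<le> C)" by blast
    then obtain T' where T': "T < T'" "extends_solution \<Sigma> x0 u T (\<lambda>t. flow \<Sigma> t x0 u) T'"
      using bic x0 u unfolding bounded_implies_continuation_def by blast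
    then have "T' \<in> S" by (auto simp: S_def extends_solution_def)
    then have "T' \<le> T" unfolding T_def by (rule Sup_upper)
    with T'(1) show False by simp
  qed
  with sol show ?thesis by simp
qed

end

text \<open>Decay is required at every time of every solution. This spares the translation of solutions and
inputs in time that would lead from decay at time 0 to decay at later times.\<close>

locale decay_along_solutions = admissible_network \<Sigma> for \<Sigma> +
  fixes W :: "seqvec \<Rightarrow> real" and \<psi>1 \<psi>2 \<gamma> \<alpha> :: "real \<Rightarrow> real"
  assumes well_posed: "well_posed \<Sigma>"
    and W_continuous: "continuous_map (mtopology_of (metricX \<Sigma>)) euclideanreal W"
    and classes: "\<psi>1 \<in> class_K_inf" "\<psi>2 \<in> class_K_inf" "\<gamma> \<in> class_K" "\<alpha> \<in> class_P"
    and W_bounds: "x \<in> state_space \<Sigma> \<Longrightarrow> \<psi>1 (normX \<Sigma> x) \<le> W x \<and> W x \<le> \<psi>2 (normX \<Sigma> x)"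
    and decay: "\<lbrakk>x0 \<in> state_space \<Sigma>; u \<in> input_functions \<Sigma>; is_solution \<Sigma> x0 u T lam; 0 \<le> t; ereal t < T;
        \<gamma> (norm_input \<Sigma> u) < W (lam t)\<rbrakk> \<Longrightarrow>
      \<exists>d>0. \<forall>h. 0 < h \<and> h < d \<longrightarrow> W (lam (t + h)) \<le> W (lam t) - h * \<alpha> (W (lam t))"
begin

lemma W_nonneg: "x \<in> state_space \<Sigma> \<Longrightarrow> 0 \<le> W x"
  using W_bounds[of x] class_P_nonneg[OF class_K_imp_P[OF class_K_inf_imp_K[OF classes(1)]] X.norm_nonneg]
  by (meson order_trans)

lemma lyapunov: "iss_lyapunov_function \<Sigma> W"
proof -
  have "upper_right_dini \<Sigma> W u x \<le> ereal (- \<alpha> (W x))"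
    if x: "x \<in> state_space \<Sigma>" and u: "u \<in> input_functions \<Sigma>" and W: "\<gamma> (norm_input \<Sigma> u) < W x" for x u
  proof -
    obtain T lam where sol: "is_solution \<Sigma> x u T lam" using well_posed x u unfolding well_posed_def by blast
    have lam0: "lam 0 = x" by (rule solution_initial[OF sol])
    have T: "0 < T" using sol by (simp add: is_solution_def)
    then obtain b where b: "0 < b" "ereal b < T" using ereal_dense2[of 0 T] by (auto simp: zero_ereal_def)
    obtain d where d: "d > 0" "\<And>h. 0 < h \<Longrightarrow> h < d \<Longrightarrow> W (lam h) \<le> W x - h * \<alpha> (W x)"
      using decay[OF x u sol, of 0] T W by (auto simp: lam0 zero_ereal_def)
    have "\<forall>\<^sub>F t in at_right 0. ereal ((W (flow \<Sigma> t x u) - W x) / t) \<le> ereal (- \<alpha> (W x))"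
      unfolding eventually_at_right_field
    proof (intro exI[of _ "min b d"] conjI allI impI)
      fix t :: real assume t: "0 < t" "t < min b d"
      then have "ereal t < T" using b(2) less_trans[of "ereal t" "ereal b" T] by simp
      then have "flow \<Sigma> t x u = lam t" using t by (intro flow_eq_solution[OF well_posed x u sol]) auto
      then show "ereal ((W (flow \<Sigma> t x u) - W x) / t) \<le> ereal (- \<alpha> (W x))"
        using d(2)[of t] t by (simp add: divide_le_eq algebra_simps)
    qed (use b d in simp)
    then show ?thesis unfolding upper_right_dini_def by (rule Limsup_bounded)
  qed
  then have "\<forall>x\<in>state_space \<Sigma>. \<forall>u\<in>input_functions \<Sigma>.
      \<gamma> (norm_input \<Sigma> u) < W x \<longrightarrow> upper_right_dini \<Sigma> W u x \<le> ereal (- \<alpha> (W x))" by simp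
  then show ?thesis
    unfolding iss_lyapunov_function_def
    by (intro conjI W_continuous bexI[of _ \<psi>1] bexI[of _ \<psi>2] bexI[of _ \<gamma>] bexI[of _ \<alpha>] classes)
      (simp_all add: W_nonneg W_bounds)
qed

text \<open>The comparison lemma bounds \<open>W\<close> along a solution by the maximum of a decaying term and the gain of
the input. Inverting \<open>\<psi>1\<close> turns this into a bound on the norm; a \<open>\<K>\<close> function of a maximum is at
most the sum of its values. The same bound, taken at time 0, is uniform in time and gives global existence.\<close>

lemma iss:
  assumes bic: "bounded_implies_continuation \<Sigma>" shows "iss \<Sigma>"
proof -
  obtain \<beta> where \<beta>: "\<beta> \<in> class_KL"
    "\<And>w T g. 0 \<le> T \<Longrightarrow> 0 \<le> g \<Longrightarrow> continuous_on {0..T} w \<Longrightarrow> decays_above \<alpha> g T w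
       \<Longrightarrow> g < w T \<Longrightarrow> w T \<le> \<beta> (w 0) T"
    using class_P_comparison[OF classes(4)] by blast
  obtain \<theta> where \<theta>: "\<theta> \<in> class_K" "\<And>r. 0 \<le> r \<Longrightarrow> \<theta> (\<psi>1 r) = r" "\<And>r. 0 \<le> r \<Longrightarrow> \<psi>1 (\<theta> r) = r"
    by (rule class_K_inf_inverse[OF classes(1)], rule that) simp_all
  note \<psi>2 = class_K_inf_imp_K[OF classes(2)]
  have nn: "0 \<le> r \<Longrightarrow> 0 \<le> f r" if "f \<in> class_K" for f r
    using class_P_nonneg[OF class_K_imp_P[OF that]] .
  have \<beta>K: "(\<lambda>r. \<beta> r t) \<in> class_K" if "0 \<le> t" for t using \<beta>(1) that by (simp add: class_KL_def)
  have estimate: "normX \<Sigma> (lam t) \<le> \<theta> (\<beta> (\<psi>2 (normX \<Sigma> x)) t) + \<theta> (\<gamma> (norm_input \<Sigma> u))"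
    if x: "x \<in> state_space \<Sigma>" and u: "u \<in> input_functions \<Sigma>" and sol: "is_solution \<Sigma> x u T lam"
      and t: "0 \<le> t" "ereal t < T" for x u T lam t
  proof -
    let ?w = "\<lambda>s. W (lam s)"
    let ?g = "\<gamma> (norm_input \<Sigma> u)"
    let ?b = "\<beta> (\<psi>2 (normX \<Sigma> x)) t"
    have mem: "lam t \<in> state_space \<Sigma>" by (rule solution_state[OF sol t])
    have g: "0 \<le> ?g" by (intro nn[OF classes(3)] norm_input_nonneg u)
    have nx: "0 \<le> normX \<Sigma> x" "0 \<le> normX \<Sigma> (lam t)" by (intro X.norm_nonneg x mem)+
    have b: "0 \<le> ?b" by (intro nn[OF \<beta>K] nn[OF \<psi>2] t nx)
    have sT: "ereal s < T" if "s \<le> t" for s using that t(2) by (meson ereal_less_eq(3) le_less_trans)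
    have "continuous_map (top_of_set {0..t}) (mtopology_of (metricX \<Sigma>)) lam"
      by (rule continuous_map_from_subtopology_mono[OF solution_continuous[OF sol]]) (use sT in auto)
    then have "continuous_map (top_of_set {0..t}) euclideanreal (W \<circ> lam)"
      using W_continuous by (rule continuous_map_compose)
    then have cw: "continuous_on {0..t} ?w" by (simp add: o_def)
    have "decays_above \<alpha> ?g t ?w"
      unfolding decays_above_def
    proof (intro allI impI)
      fix s assume s: "0 \<le> s \<and> s < t \<and> ?g < ?w s"
      then show "\<exists>d>0. \<forall>h. 0 < h \<and> h < d \<longrightarrow> ?w (s + h) \<le> ?w s - h * \<alpha> (?w s)"
        using sT by (intro decay[OF x u sol]) auto
    qed
    then have w: "?g < ?w t \<Longrightarrow> ?w t \<le> \<beta> (?w 0) t" by (rule \<beta>(2)[OF t(1) g cw])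
    have "?w 0 = W x" by (simp add: solution_initial[OF sol])
    then have "\<beta> (?w 0) t \<le> ?b"
      using class_K_mono[OF \<beta>K[OF t(1)]] W_nonneg[OF x] W_bounds[OF x] by simp
    with w have "?w t \<le> max ?b ?g" by fastforce
    then have "\<psi>1 (normX \<Sigma> (lam t)) \<le> max ?b ?g" using W_bounds[OF mem] by linarith
    then have "\<theta> (\<psi>1 (normX \<Sigma> (lam t))) \<le> \<theta> (max ?b ?g)"
      by (intro class_K_mono[OF \<theta>(1)] nn[OF class_K_inf_imp_K[OF classes(1)]] nx)
    also have "\<dots> \<le> \<theta> ?b + \<theta> ?g"
      using nn[OF \<theta>(1) b] nn[OF \<theta>(1) g] by (simp add: max_def)
    finally show ?thesis using \<theta>(2)[OF nx(2)] by simp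
  qed
  have global: "is_solution \<Sigma> x u \<infinity> (\<lambda>t. flow \<Sigma> t x u)"
    if x: "x \<in> state_space \<Sigma>" and u: "u \<in> input_functions \<Sigma>" for x u
  proof (rule bounded_solutions_imp_global_flow[OF well_posed bic x u])
    fix T lam t assume sol: "is_solution \<Sigma> x u T lam" and t: "0 \<le> t" "ereal t < T"
    have n: "0 \<le> \<psi>2 (normX \<Sigma> x)" by (intro nn[OF \<psi>2] X.norm_nonneg x)
    have "\<theta> (\<beta> (\<psi>2 (normX \<Sigma> x)) t) \<le> \<theta> (\<beta> (\<psi>2 (normX \<Sigma> x)) 0)"
      by (intro class_K_mono[OF \<theta>(1)] class_KL_time_mono[OF \<beta>(1)] nn[OF \<beta>K] n t)
    then show "normX \<Sigma> (lam t) \<le> \<theta> (\<beta> (\<psi>2 (normX \<Sigma> x)) 0) + \<theta> (\<gamma> (norm_input \<Sigma> u))"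
      using estimate[OF x u sol t] by linarith
  qed
  have "forward_complete \<Sigma>"
    unfolding forward_complete_def extends_solution_def
  proof (intro ballI allI impI)
    fix x u T lam assume xu: "x \<in> state_space \<Sigma>" "u \<in> input_functions \<Sigma>" and "is_solution \<Sigma> x u T lam"
    then show "\<exists>lam'. is_solution \<Sigma> x u \<infinity> lam' \<and> (\<forall>t. 0 \<le> t \<and> ereal t < T \<longrightarrow> lam' t = lam t)"
      using global[OF xu] flow_eq_solution[OF well_posed xu]
      by (intro exI[of _ "\<lambda>t. flow \<Sigma> t x u"]) simp
  qed
  moreover have "normX \<Sigma> (flow \<Sigma> t x u) \<le> \<theta> (\<beta> (\<psi>2 (normX \<Sigma> x)) t) + \<theta> (\<gamma> (norm_input \<Sigma> u))"
    if "x \<in> state_space \<Sigma>" "u \<in> input_functions \<Sigma>" "0 \<le> t" for x u t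
    using estimate[OF that(1,2) global[OF that(1,2)] that(3)] by simp
  ultimately show ?thesis
    unfolding iss_def
    by (intro conjI well_posed bexI[of _ "\<lambda>r t. \<theta> (\<beta> (\<psi>2 r) t)"] bexI[of _ "\<lambda>r. \<theta> (\<gamma> r)"]
        class_KL_compose[OF \<beta>(1) \<theta>(1) \<psi>2] class_K_compose[OF \<theta>(1) classes(3)]) simp_all
qed

end

section \<open>The small-gain Lyapunov function\<close>

lemma bounded_sequence_bcontfun:
  fixes f :: "nat \<Rightarrow> real"
  assumes "\<And>i. \<bar>f i\<bar> \<le> C" shows "f \<in> bcontfun"
  using assms by (intro bcontfun_normI[of _ C]) (auto simp: continuous_on_discrete)

lemma finite_support_bcontfun:
  fixes f :: "nat \<Rightarrow> real"
  assumes "finite A" "\<And>i. i \<notin> A \<Longrightarrow> f i = 0" shows "f \<in> bcontfun"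
proof (rule bounded_sequence_bcontfun)
  fix i show "\<bar>f i\<bar> \<le> (\<Sum>j\<in>A. \<bar>f j\<bar>)"
    using assms member_le_sum[of i A "\<lambda>j. \<bar>f j\<bar>"] by (cases "i \<in> A") (auto intro: sum_nonneg)
qed

text \<open>Each row of gains has finite support, so the weighted sequences to which \<open>\<mu> i\<close> is applied are
bounded and the operator \<^const>\<open>Bcontfun\<close> in the aggregated gain is never applied outside its
domain.\<close>

locale finite_gain =
  fixes \<mu> :: "nat \<Rightarrow> (nat \<Rightarrow>\<^sub>C real) \<Rightarrow> ennreal" and \<gamma> :: "nat \<Rightarrow> nat \<Rightarrow> real" and I :: "nat \<Rightarrow> nat set"
  assumes aggregation: "aggregation_function (\<mu> i)"
    and gain_nonneg: "0 \<le> \<gamma> i j"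
    and neighbours: "finite (I i)" "j \<notin> I i \<Longrightarrow> \<gamma> i j = 0"
begin

lemma weighted_apply: "apply_bcontfun (Bcontfun (\<lambda>j. \<gamma> i j * f j)) j = \<gamma> i j * f j"
  by (subst Bcontfun_inverse) (auto intro: finite_support_bcontfun[OF neighbours(1)[of i]] simp: neighbours(2))

lemma weighted_cone: "(\<And>j. 0 \<le> f j) \<Longrightarrow> Bcontfun (\<lambda>j. \<gamma> i j * f j) \<in> linf_cone"
  by (simp add: linf_cone_def weighted_apply gain_nonneg)

lemma weighted_scale: "Bcontfun (\<lambda>j. \<gamma> i j * (c * f j)) = c *\<^sub>R Bcontfun (\<lambda>j. \<gamma> i j * f j)"
  by (rule bcontfun_eqI) (simp add: weighted_apply)

lemma weighted_add:
  "Bcontfun (\<lambda>j. \<gamma> i j * (f j + g j)) = Bcontfun (\<lambda>j. \<gamma> i j * f j) + Bcontfun (\<lambda>j. \<gamma> i j * g j)"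
  by (rule bcontfun_eqI) (simp only: weighted_apply plus_bcontfun.rep_eq, simp add: distrib_left)

lemma aggregated_gain_mono:
  assumes "\<And>j. 0 \<le> f j" "\<And>j. f j \<le> g j"
  shows "aggregated_gain \<mu> \<gamma> f i \<le> aggregated_gain \<mu> \<gamma> g i"
proof -
  have "0 \<le> g j" for j using assms[of j] by linarith
  then show ?thesis
    unfolding aggregated_gain_def using aggregation[of i] assms
    by (auto simp: aggregation_function_def weighted_cone weighted_apply gain_nonneg mult_left_mono)
qed

lemma aggregated_gain_scale:
  assumes "\<And>j. 0 \<le> f j" "0 \<le> c"
  shows "aggregated_gain \<mu> \<gamma> (\<lambda>j. c * f j) i = ennreal c * aggregated_gain \<mu> \<gamma> f i"
  unfolding aggregated_gain_def weighted_scale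
  using aggregation[of i] assms weighted_cone[of f i] by (auto simp: aggregation_function_def)

lemma aggregated_gain_add:
  assumes "\<And>j. 0 \<le> f j" "\<And>j. 0 \<le> g j"
  shows "aggregated_gain \<mu> \<gamma> (\<lambda>j. f j + g j) i \<le> aggregated_gain \<mu> \<gamma> f i + aggregated_gain \<mu> \<gamma> g i"
  unfolding aggregated_gain_def weighted_add
  using aggregation[of i] assms weighted_cone[of f i] weighted_cone[of g i]
  by (auto simp: aggregation_function_def)

lemma gain_operator_apply:
  assumes wd: "gain_well_defined \<mu> \<gamma>" and s: "s \<in> linf_cone"
  shows "ennreal (apply_bcontfun (gain_operator \<mu> \<gamma> s) i) = aggregated_gain \<mu> \<gamma> (apply_bcontfun s) i"
    and "0 \<le> apply_bcontfun (gain_operator \<mu> \<gamma> s) i"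
proof -
  obtain C where C: "\<And>i. aggregated_gain \<mu> \<gamma> (apply_bcontfun s) i \<le> ennreal C"
    using wd s unfolding gain_well_defined_def by blast
  have "enn2real (aggregated_gain \<mu> \<gamma> (apply_bcontfun s) i) \<le> \<bar>C\<bar>" for i
    using enn2real_mono[OF order_trans[OF C[of i], of "ennreal \<bar>C\<bar>"]] by (simp add: ennreal_leI)
  then have "(\<lambda>i. enn2real (aggregated_gain \<mu> \<gamma> (apply_bcontfun s) i)) \<in> bcontfun"
    by (intro bounded_sequence_bcontfun[of _ "\<bar>C\<bar>"]) simp
  then have eq: "apply_bcontfun (gain_operator \<mu> \<gamma> s) i = enn2real (aggregated_gain \<mu> \<gamma> (apply_bcontfun s) i)"
    by (simp add: gain_operator_def Bcontfun_inverse)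
  have "aggregated_gain \<mu> \<gamma> (apply_bcontfun s) i < \<infinity>"
    using le_less_trans[OF C[of i]] by simp
  then show "ennreal (apply_bcontfun (gain_operator \<mu> \<gamma> s) i) = aggregated_gain \<mu> \<gamma> (apply_bcontfun s) i"
    by (simp add: eq ennreal_enn2real)
  show "0 \<le> apply_bcontfun (gain_operator \<mu> \<gamma> s) i" by (simp add: eq)
qed

lemma monotone_cone_operator_gain:
  assumes wd: "gain_well_defined \<mu> \<gamma>" shows "monotone_cone_operator (gain_operator \<mu> \<gamma>)"
proof
  note G = gain_operator_apply[OF wd]
  have pos: "0 \<le> apply_bcontfun s j" if "s \<in> linf_cone" for s j using that by (simp add: linf_cone_def)
  show "gain_operator \<mu> \<gamma> s \<in> linf_cone" if "s \<in> linf_cone" for s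
    using G(2)[OF that] by (simp add: linf_cone_def)
  show "gain_operator \<mu> \<gamma> r \<sqsubseteq> gain_operator \<mu> \<gamma> s" if "r \<in> linf_cone" "s \<in> linf_cone" "r \<sqsubseteq> s" for r s
    unfolding pointwise_le_def
  proof
    fix i
    have "ennreal (apply_bcontfun (gain_operator \<mu> \<gamma> r) i) \<le> ennreal (apply_bcontfun (gain_operator \<mu> \<gamma> s) i)"
      unfolding G(1)[OF that(1)] G(1)[OF that(2)]
      using that by (intro aggregated_gain_mono pos) (auto simp: pointwise_le_def)
    then show "apply_bcontfun (gain_operator \<mu> \<gamma> r) i \<le> apply_bcontfun (gain_operator \<mu> \<gamma> s) i"
      using G(2)[OF that(2)] by simp
  qed
  show "gain_operator \<mu> \<gamma> (c *\<^sub>R s) = c *\<^sub>R gain_operator \<mu> \<gamma> s" if s: "s \<in> linf_cone" and c: "0 \<le> c" for s c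
  proof (rule bcontfun_eqI)
    fix i
    have cs: "c *\<^sub>R s \<in> linf_cone" using s c by (simp add: linf_cone_def)
    have "ennreal (apply_bcontfun (gain_operator \<mu> \<gamma> (c *\<^sub>R s)) i)
        = ennreal c * ennreal (apply_bcontfun (gain_operator \<mu> \<gamma> s) i)"
      unfolding G(1)[OF cs] G(1)[OF s] using aggregated_gain_scale[OF pos[OF s] c] by simp
    also have "\<dots> = ennreal (c * apply_bcontfun (gain_operator \<mu> \<gamma> s) i)"
      using c G(2)[OF s] by (simp add: ennreal_mult)
    finally show "apply_bcontfun (gain_operator \<mu> \<gamma> (c *\<^sub>R s)) i = apply_bcontfun (c *\<^sub>R gain_operator \<mu> \<gamma> s) i"
      using c G(2)[OF s, of i] G(2)[OF cs, of i] by simp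
  qed
  show "gain_operator \<mu> \<gamma> (r + s) \<sqsubseteq> gain_operator \<mu> \<gamma> r + gain_operator \<mu> \<gamma> s"
    if r: "r \<in> linf_cone" and s: "s \<in> linf_cone" for r s
    unfolding pointwise_le_def
  proof
    fix i
    have rs: "r + s \<in> linf_cone" using r s by (simp add: linf_cone_def plus_bcontfun.rep_eq)
    have "ennreal (apply_bcontfun (gain_operator \<mu> \<gamma> (r + s)) i)
        \<le> ennreal (apply_bcontfun (gain_operator \<mu> \<gamma> r) i) + ennreal (apply_bcontfun (gain_operator \<mu> \<gamma> s) i)"
      unfolding G(1)[OF rs] G(1)[OF r] G(1)[OF s]
      using aggregated_gain_add[of "apply_bcontfun r" "apply_bcontfun s" i] pos[OF r] pos[OF s] by (simp add: plus_bcontfun.rep_eq)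
    also have "\<dots> = ennreal (apply_bcontfun (gain_operator \<mu> \<gamma> r) i + apply_bcontfun (gain_operator \<mu> \<gamma> s) i)"
      using G(2)[OF r] G(2)[OF s] by simp
    finally show "apply_bcontfun (gain_operator \<mu> \<gamma> (r + s)) i \<le> apply_bcontfun (gain_operator \<mu> \<gamma> r + gain_operator \<mu> \<gamma> s) i"
      using G(2)[OF r, of i] G(2)[OF s, of i] by (simp add: plus_bcontfun.rep_eq ennreal_le_iff del: ennreal_plus)
  qed
qed

end

text \<open>The subsystem data are required here with bounds that are common to all indices, and \<open>S\<close> is a point at which the
gain operator contracts by the factor \<open>c\<close>. The normalization \<open>1 \<le> S i\<close> makes an error \<open>\<epsilon>\<close> in \<open>V i\<close> cost at most
\<open>\<epsilon>\<close> in \<open>W\<close>.\<close>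

locale small_gain_network =
  admissible_network \<Sigma> + finite_gain \<mu> \<gamma> "neighbours \<Sigma>" for \<Sigma> \<mu> \<gamma> +
  fixes V :: "nat \<Rightarrow> rvec \<Rightarrow> real" and \<psi>1 \<psi>2 \<gamma>max \<alpha>min :: "real \<Rightarrow> real"
    and S :: "nat \<Rightarrow> real" and Smax c :: real
  assumes V_continuous: "continuous_on (Rn (state_dim \<Sigma> i)) (V i)"
    and V_C1: "C1_off_origin (state_dim \<Sigma> i) (V i)"
    and classes: "\<psi>1 \<in> class_K_inf" "\<psi>2 \<in> class_K_inf" "\<gamma>max \<in> class_K" "\<alpha>min \<in> class_P"
    and V_bounds: "\<xi> \<in> Rn (state_dim \<Sigma> i) \<Longrightarrow>
      \<psi>1 (state_norm \<Sigma> i \<xi>) \<le> V i \<xi> \<and> V i \<xi> \<le> \<psi>2 (state_norm \<Sigma> i \<xi>)"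
    and V_Lipschitz: "0 < R \<Longrightarrow> \<exists>L>0. \<forall>i. \<forall>\<xi>\<in>Rn (state_dim \<Sigma> i). \<forall>\<eta>\<in>Rn (state_dim \<Sigma> i).
      state_norm \<Sigma> i \<xi> < R \<longrightarrow> state_norm \<Sigma> i \<eta> < R \<longrightarrow>
      \<bar>V i \<xi> - V i \<eta>\<bar> \<le> L * state_norm \<Sigma> i (\<lambda>k. \<xi> k - \<eta> k)"
    and dissipation: "\<lbrakk>x \<in> state_space \<Sigma>; u \<in> input_space \<Sigma>;
        max (aggregated_gain \<mu> \<gamma> (\<lambda>j. V j (x j)) i) (ennreal (\<gamma>max (input_norm \<Sigma> i (u i)))) < ennreal (V i (x i))\<rbrakk> \<Longrightarrow>
      gradient_times (state_dim \<Sigma> i) (V i) (x i)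
        (rhs \<Sigma> i (x i) (restrict_to (neighbours \<Sigma> i) x) (u i)) \<le> - \<alpha>min (V i (x i))"
    and S: "1 \<le> S i" "S i \<le> Smax"
    and c: "0 < c" "c < 1"
    and decay_point: "aggregated_gain \<mu> \<gamma> S i \<le> ennreal (c * S i)"
begin

definition W :: "seqvec \<Rightarrow> real" where "W x = (SUP i. 1 / S i * V i (x i))"

lemma S_pos: "0 < S i"
  using S(1)[of i] by simp

lemma Smax_ge_1: "1 \<le> Smax"
  using S[of 0] by simp

lemma \<psi>_nonneg: "0 \<le> r \<Longrightarrow> 0 \<le> \<psi>1 r" "0 \<le> r \<Longrightarrow> 0 \<le> \<psi>2 r"
  using class_P_nonneg class_K_imp_P class_K_inf_imp_K classes by blast+

lemma V_nonneg: "\<xi> \<in> Rn (state_dim \<Sigma> i) \<Longrightarrow> 0 \<le> V i \<xi>"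
  using V_bounds[of \<xi> i] \<psi>_nonneg(1)[OF X.comp.nonneg[of \<xi> i]] by linarith

lemma V_le: assumes x: "x \<in> state_space \<Sigma>" shows "V i (x i) \<le> \<psi>2 (normX \<Sigma> x)"
proof -
  have "V i (x i) \<le> \<psi>2 (state_norm \<Sigma> i (x i))" using V_bounds[OF X.component[OF x]] by simp
  also have "\<dots> \<le> \<psi>2 (normX \<Sigma> x)"
    by (intro class_K_mono[OF class_K_inf_imp_K[OF classes(2)]] X.comp.nonneg X.component X.upper x)
  finally show ?thesis .
qed

lemma V_le_W: assumes x: "x \<in> state_space \<Sigma>" shows "V i (x i) \<le> S i * W x"
proof -
  have "1 / S i * V i (x i) \<le> \<psi>2 (normX \<Sigma> x)" for i
  proof -
    have "1 / S i * V i (x i) \<le> 1 * V i (x i)"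
      using S(1)[of i] by (intro mult_right_mono V_nonneg X.component x) simp
    then show ?thesis using V_le[OF x, of i] by simp
  qed
  then have "bdd_above (range (\<lambda>i. 1 / S i * V i (x i)))" by (rule bdd_aboveI2)
  then have "1 / S i * V i (x i) \<le> W x" unfolding W_def by (intro cSUP_upper) auto
  then show ?thesis using S_pos[of i] by (simp add: field_simps)
qed

lemma W_le: "(\<And>i. V i (x i) \<le> S i * C) \<Longrightarrow> W x \<le> C"
  unfolding W_def by (rule cSUP_least) (use S_pos in \<open>auto simp: field_simps\<close>)

lemma W_nonneg: assumes "x \<in> state_space \<Sigma>" shows "0 \<le> W x"
proof -
  have "0 \<le> S 0 * W x" using V_le_W[OF assms, of 0] V_nonneg[OF X.component[OF assms], of 0] by linarith
  then show ?thesis using S_pos[of 0] by (simp add: zero_le_mult_iff)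
qed

lemma W_bounds:
  assumes x: "x \<in> state_space \<Sigma>"
  shows "1 / Smax * \<psi>1 (normX \<Sigma> x) \<le> W x \<and> W x \<le> \<psi>2 (normX \<Sigma> x)"
proof
  obtain \<theta> where \<theta>: "\<theta> \<in> class_K" "\<And>r. 0 \<le> r \<Longrightarrow> \<theta> (\<psi>1 r) = r" "\<And>r. 0 \<le> r \<Longrightarrow> \<psi>1 (\<theta> r) = r"
    by (rule class_K_inf_inverse[OF classes(1)], rule that) simp_all
  have SW: "0 \<le> Smax * W x" using Smax_ge_1 W_nonneg[OF x] by simp
  have "state_norm \<Sigma> i (x i) \<le> \<theta> (Smax * W x)" for i
  proof -
    have n: "0 \<le> state_norm \<Sigma> i (x i)" by (intro X.comp.nonneg X.component x)
    have "\<psi>1 (state_norm \<Sigma> i (x i)) \<le> S i * W x"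
      using V_bounds[OF X.component[OF x], of i] V_le_W[OF x, of i] by linarith
    also have "\<dots> \<le> Smax * W x" using S(2) W_nonneg[OF x] by (rule mult_right_mono)
    finally have "\<theta> (\<psi>1 (state_norm \<Sigma> i (x i))) \<le> \<theta> (Smax * W x)"
      by (intro class_K_mono[OF \<theta>(1)] \<psi>_nonneg n)
    then show ?thesis using \<theta>(2)[OF n] by simp
  qed
  then have "normX \<Sigma> x \<le> \<theta> (Smax * W x)" by (rule X.least)
  then have "\<psi>1 (normX \<Sigma> x) \<le> \<psi>1 (\<theta> (Smax * W x))"
    by (intro class_K_mono[OF class_K_inf_imp_K[OF classes(1)]] X.norm_nonneg x)
  then show "1 / Smax * \<psi>1 (normX \<Sigma> x) \<le> W x"
    using \<theta>(3)[OF SW] Smax_ge_1 by (simp add: field_simps)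
  show "W x \<le> \<psi>2 (normX \<Sigma> x)"
  proof (rule W_le)
    fix i
    have "1 * \<psi>2 (normX \<Sigma> x) \<le> S i * \<psi>2 (normX \<Sigma> x)"
      by (intro mult_right_mono S \<psi>_nonneg X.norm_nonneg x)
    then show "V i (x i) \<le> S i * \<psi>2 (normX \<Sigma> x)" using V_le[OF x, of i] by simp
  qed
qed

lemma V_Lipschitz_on_ball:
  assumes "0 < R"
  obtains L where "0 < L" "\<And>x y i. x \<in> state_space \<Sigma> \<Longrightarrow> y \<in> state_space \<Sigma> \<Longrightarrow> normX \<Sigma> x < R \<Longrightarrow>
    normX \<Sigma> y < R \<Longrightarrow> \<bar>V i (x i) - V i (y i)\<bar> \<le> L * normX \<Sigma> (diffv x y)"
proof -
  obtain L where L: "0 < L" "\<And>i \<xi> \<eta>. \<xi> \<in> Rn (state_dim \<Sigma> i) \<Longrightarrow> \<eta> \<in> Rn (state_dim \<Sigma> i) \<Longrightarrow>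
      state_norm \<Sigma> i \<xi> < R \<Longrightarrow> state_norm \<Sigma> i \<eta> < R \<Longrightarrow>
      \<bar>V i \<xi> - V i \<eta>\<bar> \<le> L * state_norm \<Sigma> i (\<lambda>k. \<xi> k - \<eta> k)"
    using V_Lipschitz[OF assms] by blast
  show thesis
  proof (rule that[OF L(1)])
    fix x y i assume xy: "x \<in> state_space \<Sigma>" "y \<in> state_space \<Sigma>" "normX \<Sigma> x < R" "normX \<Sigma> y < R"
    have "\<bar>V i (x i) - V i (y i)\<bar> \<le> L * state_norm \<Sigma> i (\<lambda>k. x i k - y i k)"
      using X.upper[OF xy(1), of i] X.upper[OF xy(2), of i] xy by (intro L(2) X.component) auto
    also have "\<dots> \<le> L * normX \<Sigma> (diffv x y)"
      using L(1) X.diff_component[OF xy(1,2)] by simp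
    finally show "\<bar>V i (x i) - V i (y i)\<bar> \<le> L * normX \<Sigma> (diffv x y)" .
  qed
qed

lemma W_Lipschitz_on_ball:
  assumes "0 < R"
  obtains L where "0 < L" "\<And>x y. x \<in> state_space \<Sigma> \<Longrightarrow> y \<in> state_space \<Sigma> \<Longrightarrow> normX \<Sigma> x < R \<Longrightarrow>
    normX \<Sigma> y < R \<Longrightarrow> \<bar>W x - W y\<bar> \<le> L * normX \<Sigma> (diffv x y)"
proof -
  obtain L where L: "0 < L" "\<And>x y i. x \<in> state_space \<Sigma> \<Longrightarrow> y \<in> state_space \<Sigma> \<Longrightarrow> normX \<Sigma> x < R \<Longrightarrow>
    normX \<Sigma> y < R \<Longrightarrow> \<bar>V i (x i) - V i (y i)\<bar> \<le> L * normX \<Sigma> (diffv x y)"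
    using V_Lipschitz_on_ball[OF assms] by blast
  have one_sided: "W x \<le> W y + L * normX \<Sigma> (diffv x y)"
    if xy: "x \<in> state_space \<Sigma>" "y \<in> state_space \<Sigma>" "normX \<Sigma> x < R" "normX \<Sigma> y < R" for x y
  proof (rule W_le)
    fix i
    have n: "0 \<le> L * normX \<Sigma> (diffv x y)" using L(1) X.norm_nonneg[OF X.diff_mem[OF xy(1,2)]] by simp
    have "V i (x i) \<le> S i * W y + 1 * (L * normX \<Sigma> (diffv x y))"
      using L(2)[OF xy, of i] V_le_W[OF xy(2), of i] by linarith
    also have "\<dots> \<le> S i * W y + S i * (L * normX \<Sigma> (diffv x y))"
      using S(1)[of i] n by (intro add_left_mono mult_right_mono)
    finally show "V i (x i) \<le> S i * (W y + L * normX \<Sigma> (diffv x y))" by (simp add: distrib_left)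
  qed
  show thesis
  proof (rule that[OF L(1)])
    fix x y assume xy: "x \<in> state_space \<Sigma>" "y \<in> state_space \<Sigma>" "normX \<Sigma> x < R" "normX \<Sigma> y < R"
    show "\<bar>W x - W y\<bar> \<le> L * normX \<Sigma> (diffv x y)"
      using one_sided[OF xy] one_sided[OF xy(2,1,4,3)] X.norm_diff_commute[OF xy(1,2)] by (simp add: abs_le_iff)
  qed
qed

lemma W_Lipschitz_on_bounded:
  assumes B: "B \<subseteq> state_space \<Sigma>" "\<And>x. x \<in> B \<Longrightarrow> normX \<Sigma> x \<le> R"
  shows "Lipschitz_continuous_map (submetric (metricX \<Sigma>) B) euclidean_metric W"
proof -
  have R: "0 < \<bar>R\<bar> + 1" by simp
  obtain L where L: "0 < L" "\<And>x y. x \<in> state_space \<Sigma> \<Longrightarrow> y \<in> state_space \<Sigma> \<Longrightarrow> normX \<Sigma> x < \<bar>R\<bar> + 1 \<Longrightarrow>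
    normX \<Sigma> y < \<bar>R\<bar> + 1 \<Longrightarrow> \<bar>W x - W y\<bar> \<le> L * normX \<Sigma> (diffv x y)"
    using W_Lipschitz_on_ball[OF R] by blast
  have "\<bar>W x - W y\<bar> \<le> L * linf_dist (state_dim \<Sigma>) (state_norm \<Sigma>) x y" if "x \<in> B" "y \<in> B" for x y
  proof -
    have "x \<in> state_space \<Sigma>" "y \<in> state_space \<Sigma>" using B(1) that by auto
    moreover have "normX \<Sigma> x < \<bar>R\<bar> + 1" "normX \<Sigma> y < \<bar>R\<bar> + 1"
      using B(2)[OF that(1)] B(2)[OF that(2)] by auto
    ultimately show ?thesis using L(2)[of x y] by (simp add: linf_dist_def)
  qed
  then show ?thesis
    using B(1) unfolding Lipschitz_continuous_map_def
    by (auto simp: linf_metric_def dist_real_def intro!: exI[of _ L])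
qed

lemma W_continuous: "continuous_map (mtopology_of (metricX \<Sigma>)) euclideanreal W"
proof -
  have "continuous_map X.M.mtopology euclideanreal W"
    unfolding continuous_map_def
  proof (intro conjI allI impI)
    fix A :: "real set" assume "openin euclideanreal A"
    then have A: "open A" by simp
    show "openin X.M.mtopology {x \<in> topspace X.M.mtopology. W x \<in> A}"
      unfolding X.M.openin_mtopology
    proof (intro conjI allI impI)
      fix x assume "x \<in> {x \<in> topspace X.M.mtopology. W x \<in> A}"
      then have x: "x \<in> state_space \<Sigma>" "W x \<in> A" by auto
      obtain e where e: "e > 0" "\<And>r. \<bar>r - W x\<bar> < e \<Longrightarrow> r \<in> A"
        using A x(2) unfolding open_dist dist_real_def by blast
      define R where "R = normX \<Sigma> x + 1"
      have R: "0 < R" using X.norm_nonneg[OF x(1)] by (simp add: R_def)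
      obtain L where L: "0 < L" "\<And>x y. x \<in> state_space \<Sigma> \<Longrightarrow> y \<in> state_space \<Sigma> \<Longrightarrow> normX \<Sigma> x < R \<Longrightarrow>
        normX \<Sigma> y < R \<Longrightarrow> \<bar>W x - W y\<bar> \<le> L * normX \<Sigma> (diffv x y)"
        using W_Lipschitz_on_ball[OF R] by blast
      have "W y \<in> A" if y: "y \<in> state_space \<Sigma>" and d: "normX \<Sigma> (diffv x y) < min 1 (e / L)" for y
      proof -
        have "normX \<Sigma> y < R"
          using X.norm_triangle[OF y x(1)] X.norm_diff_commute[OF x(1) y] d by (simp add: R_def)
        then have "\<bar>W y - W x\<bar> \<le> L * normX \<Sigma> (diffv x y)"
          using L(2)[OF x(1) y] by (simp add: R_def abs_minus_commute)
        also have "\<dots> < e" using d L(1) by (simp add: field_simps)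
        finally show ?thesis by (rule e(2))
      qed
      then have "X.M.mball x (min 1 (e / L)) \<subseteq> {x \<in> topspace X.M.mtopology. W x \<in> A}"
        by (auto simp: linf_dist_def)
      moreover have "0 < min 1 (e / L)" using e L(1) by simp
      ultimately show "\<exists>r>0. X.M.mball x r \<subseteq> {x \<in> topspace X.M.mtopology. W x \<in> A}" by blast
    qed auto
  qed auto
  then show ?thesis by (simp add: linf_metric_def)
qed

text \<open>This is where the small-gain condition enters: \<open>V\<^sub>j (x\<^sub>j)\<close> is at most \<open>W x\<close> times \<open>S\<^sub>j\<close>, the factor
\<open>W x\<close> is pulled out by homogeneity, and what remains is the gain at the decay point.\<close>

lemma aggregated_gain_le:
  assumes x: "x \<in> state_space \<Sigma>"
  shows "aggregated_gain \<mu> \<gamma> (\<lambda>j. V j (x j)) i \<le> ennreal (c * (S i * W x))"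
proof -
  have "aggregated_gain \<mu> \<gamma> (\<lambda>j. V j (x j)) i \<le> aggregated_gain \<mu> \<gamma> (\<lambda>j. W x * S j) i"
    using V_le_W[OF x] by (intro aggregated_gain_mono V_nonneg X.component x) (simp add: mult.commute)
  also have "\<dots> = ennreal (W x) * aggregated_gain \<mu> \<gamma> S i"
    by (rule aggregated_gain_scale) (simp_all add: W_nonneg[OF x] less_imp_le[OF S_pos])
  also have "\<dots> \<le> ennreal (W x) * ennreal (c * S i)" by (rule mult_left_mono[OF decay_point]) simp
  also have "\<dots> = ennreal (W x * (c * S i))"
    using W_nonneg[OF x] c S_pos[of i] by (simp add: ennreal_mult)
  also have "W x * (c * S i) = c * (S i * W x)" by simp
  finally show ?thesis .
qed

text \<open>The assumption \<open>0 < V i\<close> keeps the component away from the origin, where \<open>V i\<close> need not be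
differentiable.\<close>

lemma component_decrease:
  assumes sol: "is_solution \<Sigma> x0 u T lam" and \<tau>: "0 \<le> \<tau>" and b: "ereal b \<le> T"
    and u: "continuous_map (top_of_set {\<tau>..<b}) (mtopology_of (metricU \<Sigma>)) u"
    and h: "0 < h" "\<tau> + h < b"
    and pos: "\<And>t. \<tau> < t \<Longrightarrow> t < \<tau> + h \<Longrightarrow> 0 < V i (lam t i)"
    and decrease: "\<And>t. \<tau> < t \<Longrightarrow> t < \<tau> + h \<Longrightarrow>
      gradient_times (state_dim \<Sigma> i) (V i) (lam t i) (network_rhs \<Sigma> (lam t) (u t) i) \<le> - m"
  shows "V i (lam (\<tau> + h) i) \<le> V i (lam \<tau> i) - h * m"
proof -
  have T: "ereal t < T" if "t < b" for t using that b by (meson ereal_less(2) less_ereal.simps(1) less_le_trans)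
  have mem: "lam t i \<in> Rn (state_dim \<Sigma> i)" if "\<tau> \<le> t" "t < b" for t
    using solution_state[OF sol _ T] X.component that \<tau> by simp
  let ?f = "\<lambda>t. V i (lam t i) + m * t"
  have "?f (\<tau> + h) \<le> ?f \<tau>"
  proof (rule DERIV_nonpos_imp_decreasing_open[where f = ?f and a = \<tau> and b = "\<tau> + h"])
    have lam: "continuous_map (top_of_set {\<tau>..\<tau> + h}) (mtopology_of (metricX \<Sigma>)) lam"
      by (rule continuous_map_from_subtopology_mono[OF solution_continuous[OF sol]]) (use T \<tau> h in auto)
    have "continuous_on {\<tau>..\<tau> + h} (\<lambda>t. lam t i)"
      by (intro continuous_on_coordinatewise_then_product X.continuous_map_linf_coordinate[OF lam])
    then have "continuous_on {\<tau>..\<tau> + h} (\<lambda>t. V i (lam t i))"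
      by (rule continuous_on_compose2[OF V_continuous]) (use mem h in auto)
    then show "continuous_on {\<tau>..\<tau> + h} ?f" by (intro continuous_intros)
    fix t assume t: "\<tau> < t" "t < \<tau> + h"
    let ?D = "gradient_times (state_dim \<Sigma> i) (V i) (lam t i) (network_rhs \<Sigma> (lam t) (u t) i)"
    have "((\<lambda>t. V i (lam t i)) has_real_derivative ?D) (at t)"
    proof (rule C1_off_origin_chain[OF V_C1])
      have "\<forall>\<^sub>F s in at t. s \<in> {\<tau><..<\<tau> + h}" by (rule eventually_at_in_open') (use t in auto)
      then show "\<forall>\<^sub>F s in at t. lam s i \<in> Rn (state_dim \<Sigma> i)"
        by eventually_elim (use mem h in auto)
      show "lam t i \<in> Rn (state_dim \<Sigma> i)" using mem t h by simp
      have "V i (\<lambda>_. 0) \<le> 0"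
        using V_bounds[OF Rn_zero, of i] X.comp.zero[of i] classes(2)
        by (simp add: class_K_inf_def class_K_def class_P_def)
      then show "lam t i \<noteq> (\<lambda>_. 0)" using pos[OF t] by auto
      show "((\<lambda>t. lam t i k) has_real_derivative network_rhs \<Sigma> (lam t) (u t) i k) (at t)" for k
        by (rule solution_deriv[OF sol \<tau> b u]) (use t h in auto)
    qed
    then have "(?f has_real_derivative (?D + m)) (at t)" by (auto intro!: derivative_eq_intros)
    then show "\<exists>y. (?f has_real_derivative y) (at t) \<and> y \<le> 0"
      using decrease[OF t] by (intro exI[of _ "?D + m"]) simp
  qed (use h in simp)
  then show ?thesis by (simp add: algebra_simps)
qed

lemma active_component_dissipates:
  assumes x: "x \<in> state_space \<Sigma>" and u: "u \<in> input_space \<Sigma>"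
    and above: "c * (S i * W x) < V i (x i)" "\<gamma>max (normU \<Sigma> u) < V i (x i)"
  shows "gradient_times (state_dim \<Sigma> i) (V i) (x i) (network_rhs \<Sigma> x u i) \<le> - \<alpha>min (V i (x i))"
proof -
  have n: "0 \<le> input_norm \<Sigma> i (u i)" by (intro U.comp.nonneg U.component u)
  have "\<gamma>max (input_norm \<Sigma> i (u i)) \<le> \<gamma>max (normU \<Sigma> u)"
    by (intro class_K_mono[OF classes(3)] U.upper u n)
  then have "\<gamma>max (input_norm \<Sigma> i (u i)) < V i (x i)" using above(2) by simp
  moreover have "0 \<le> \<gamma>max (input_norm \<Sigma> i (u i))"
    using class_P_nonneg[OF class_K_imp_P[OF classes(3)] n] .
  ultimately have "ennreal (\<gamma>max (input_norm \<Sigma> i (u i))) < ennreal (V i (x i))"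
    by (simp add: ennreal_less_iff)
  moreover have "0 \<le> c * (S i * W x)" using c S_pos[of i] W_nonneg[OF x] by simp
  then have "ennreal (c * (S i * W x)) < ennreal (V i (x i))"
    using above(1) by (simp add: ennreal_less_iff)
  then have "aggregated_gain \<mu> \<gamma> (\<lambda>j. V j (x j)) i < ennreal (V i (x i))"
    using aggregated_gain_le[OF x] by (rule le_less_trans[rotated])
  ultimately show ?thesis unfolding network_rhs_def by (intro dissipation[OF x u]) simp
qed

text \<open>Let \<open>w\<close> be the value of \<open>W\<close> at time \<open>\<tau>\<close>. The interval between \<open>c\<close> and 1 is divided at \<open>(1 + c) / 2\<close> and
\<open>(3 + c) / 4\<close>. A component is active if its value at time \<open>\<tau>\<close> is at least \<open>(3 + c) / 4\<close> of the possible
maximum \<open>S i * w\<close>. On a short time interval no \<open>V i\<close> moves by more than \<open>\<epsilon>\<close>, where \<open>2 \<epsilon> / w\<close> is the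
distance both from \<open>(3 + c) / 4\<close> down to \<open>(1 + c) / 2\<close> and from \<open>(3 + c) / 4\<close> up to 1.
Active components therefore stay above the fraction \<open>(1 + c) / 2\<close>, hence above the aggregated gain and the
gain of the input, and dissipate. The other components stay below the maximum by at least \<open>\<epsilon>\<close>, and
\<open>W\<close> may decrease by that much before they matter.\<close>

lemma W_decay:
  obtains \<alpha> where "\<alpha> \<in> class_P"
    "\<And>x0 u T lam \<tau>. u \<in> input_functions \<Sigma> \<Longrightarrow> is_solution \<Sigma> x0 u T lam \<Longrightarrow> 0 \<le> \<tau> \<Longrightarrow> ereal \<tau> < T \<Longrightarrow>
      2 / (1 + c) * \<gamma>max (norm_input \<Sigma> u) < W (lam \<tau>) \<Longrightarrow>
      \<exists>d>0. \<forall>h. 0 < h \<and> h < d \<longrightarrow> W (lam (\<tau> + h)) \<le> W (lam \<tau>) - h * \<alpha> (W (lam \<tau>))"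
proof -
  have "0 < (1 + c) / 2" "(1 + c) / 2 \<le> 2 * Smax" using c Smax_ge_1 by auto
  then obtain \<alpha>' where \<alpha>': "\<alpha>' \<in> class_P"
    "\<And>r y. 0 \<le> r \<Longrightarrow> (1 + c) / 2 * r \<le> y \<Longrightarrow> y \<le> 2 * Smax * r \<Longrightarrow> \<alpha>' r \<le> \<alpha>min y"
    using class_P_envelope[OF classes(4)] by blast
  \<comment> \<open>A decrease of \<open>V i\<close> by \<open>\<alpha>' w\<close> lowers \<open>V i / S i\<close> by at least this much, as \<open>S i \<le> Smax\<close>.\<close>
  define \<alpha> where "\<alpha> r = 1 / Smax * \<alpha>' r" for r
  have \<alpha>: "\<alpha> \<in> class_P" using \<alpha>'(1) Smax_ge_1 by (auto simp: \<alpha>_def class_P_def intro!: continuous_intros)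
  show thesis
  proof (rule that[OF \<alpha>])
    fix x0 u T lam \<tau>
    assume u: "u \<in> input_functions \<Sigma>" and sol: "is_solution \<Sigma> x0 u T lam" and \<tau>: "0 \<le> \<tau>" "ereal \<tau> < T"
      and large: "2 / (1 + c) * \<gamma>max (norm_input \<Sigma> u) < W (lam \<tau>)"
    define w where "w = W (lam \<tau>)"
    have \<gamma>0: "0 \<le> \<gamma>max (norm_input \<Sigma> u)"
      by (intro class_P_nonneg[OF class_K_imp_P[OF classes(3)]] norm_input_nonneg u)
    have "0 \<le> 2 / (1 + c) * \<gamma>max (norm_input \<Sigma> u)" using \<gamma>0 c by simp
    then have w: "0 < w" using large by (simp add: w_def)
    have \<gamma>w: "\<gamma>max (norm_input \<Sigma> u) < (1 + c) / 2 * w" using large c by (simp add: w_def field_simps)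
    define \<epsilon> where "\<epsilon> = (1 - c) * w / 8"
    have \<epsilon>: "0 < \<epsilon>" using c w by (simp add: \<epsilon>_def)
    \<comment> \<open>States within distance 1 stay in this ball, which has one Lipschitz constant for all components.\<close>
    define R where "R = normX \<Sigma> (lam \<tau>) + 1"
    have \<tau>X: "lam \<tau> \<in> state_space \<Sigma>" by (rule solution_state[OF sol \<tau>])
    have R: "0 < R" using X.norm_nonneg[OF \<tau>X] by (simp add: R_def)
    obtain L where L: "0 < L" "\<And>x y i. x \<in> state_space \<Sigma> \<Longrightarrow> y \<in> state_space \<Sigma> \<Longrightarrow> normX \<Sigma> x < R \<Longrightarrow>
      normX \<Sigma> y < R \<Longrightarrow> \<bar>V i (x i) - V i (y i)\<bar> \<le> L * normX \<Sigma> (diffv x y)"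
      using V_Lipschitz_on_ball[OF R] by blast
    have "0 < min 1 (\<epsilon> / L)" using \<epsilon> L(1) by simp
    then obtain \<delta> where \<delta>: "\<delta> > 0" "\<And>t. 0 \<le> t \<Longrightarrow> ereal t < T \<Longrightarrow> \<bar>t - \<tau>\<bar> < \<delta> \<Longrightarrow>
        normX \<Sigma> (diffv (lam t) (lam \<tau>)) < min 1 (\<epsilon> / L)"
      using solution_continuous[OF sol, unfolded X.continuous_map_linf_iff] \<tau> by blast
    obtain b1 where b1: "\<tau> < b1" "continuous_map (top_of_set {\<tau>..<b1}) (mtopology_of (metricU \<Sigma>)) u"
      using input_right_continuous[OF u \<tau>(1)] .
    obtain b2 where b2: "\<tau> < b2" "ereal b2 < T" using ereal_dense2[OF \<tau>(2)] by auto
    define b where "b = min b1 (min b2 (\<tau> + \<delta>))"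
    have b: "\<tau> < b" "b \<le> b1" "b \<le> b2" "b \<le> \<tau> + \<delta>" using b1 b2 \<delta> by (auto simp: b_def)
    have bT: "ereal b \<le> T" using b(3) b2(2) by (meson ereal_less_eq(3) less_imp_le order_trans)
    have ub: "continuous_map (top_of_set {\<tau>..<b}) (mtopology_of (metricU \<Sigma>)) u"
      by (rule continuous_map_from_subtopology_mono[OF b1(2)]) (use b in auto)
    have X: "lam t \<in> state_space \<Sigma>" and near: "\<bar>V i (lam t i) - V i (lam \<tau> i)\<bar> \<le> \<epsilon>"
      if t: "\<tau> \<le> t" "t < b" for t i
    proof -
      have tT: "0 \<le> t" "ereal t < T" using t \<tau> bT by (auto intro: less_le_trans[of _ "ereal b"])
      show tX: "lam t \<in> state_space \<Sigma>" by (rule solution_state[OF sol tT])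
      have d: "normX \<Sigma> (diffv (lam t) (lam \<tau>)) < min 1 (\<epsilon> / L)" using t b by (intro \<delta>(2) tT) auto
      then have "normX \<Sigma> (lam t) < R" using X.norm_triangle[OF tX \<tau>X] by (simp add: R_def)
      then have "\<bar>V i (lam t i) - V i (lam \<tau> i)\<bar> \<le> L * normX \<Sigma> (diffv (lam t) (lam \<tau>))"
        by (intro L(2) tX \<tau>X) (simp_all add: R_def)
      also have "\<dots> \<le> \<epsilon>" using d L(1) by (simp add: field_simps)
      finally show "\<bar>V i (lam t i) - V i (lam \<tau> i)\<bar> \<le> \<epsilon>" .
    qed
    have S\<epsilon>: "\<epsilon> \<le> S i * \<epsilon>" for i using S(1)[of i] \<epsilon> by simp
    have Wt: "W (lam t) \<le> w + \<epsilon>" if t: "\<tau> \<le> t" "t < b" for t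
    proof (rule W_le)
      fix i
      show "V i (lam t i) \<le> S i * (w + \<epsilon>)"
        using near[OF t, of i] V_le_W[OF \<tau>X, of i] S\<epsilon>[of i] unfolding w_def distrib_left by linarith
    qed
    have active: "V i (lam (\<tau> + h) i) \<le> S i * (w - h * \<alpha> w)"
      if i: "S i * ((3 + c) / 4 * w) \<le> V i (lam \<tau> i)" and h: "0 < h" "\<tau> + h < b" for i h
    proof -
      have Vt: "S i * ((1 + c) / 2 * w + \<epsilon>) \<le> V i (lam t i)" "V i (lam t i) \<le> S i * (w + \<epsilon>)"
        if t: "\<tau> < t" "t < \<tau> + h" for t
      proof -
        have tb: "\<tau> \<le> t" "t < b" using t h by auto
        have "S i * ((3 + c) / 4 * w) = S i * ((1 + c) / 2 * w + \<epsilon>) + S i * \<epsilon>"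
          by (simp add: \<epsilon>_def field_simps)
        then show "S i * ((1 + c) / 2 * w + \<epsilon>) \<le> V i (lam t i)"
          using near[OF tb, of i] i S\<epsilon>[of i] by linarith
        show "V i (lam t i) \<le> S i * (w + \<epsilon>)"
          using V_le_W[OF X[OF tb], of i] Wt[OF tb] S_pos[of i] by (meson mult_left_mono less_imp_le order_trans)
      qed
      have low: "(1 + c) / 2 * w < V i (lam t i)" if t: "\<tau> < t" "t < \<tau> + h" for t
      proof -
        have "1 * ((1 + c) / 2 * w + \<epsilon>) \<le> S i * ((1 + c) / 2 * w + \<epsilon>)"
          using S(1)[of i] c w \<epsilon> by (intro mult_right_mono) auto
        then show ?thesis using Vt(1)[OF t] \<epsilon> by simp
      qed
      have "V i (lam (\<tau> + h) i) \<le> V i (lam \<tau> i) - h * \<alpha>' w"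
      proof (rule component_decrease[OF sol \<tau>(1) bT ub h])
        fix t assume t: "\<tau> < t" "t < \<tau> + h"
        then have tb: "\<tau> \<le> t" "t < b" using h by auto
        have "0 < (1 + c) / 2 * w" using c w by simp
        then show "0 < V i (lam t i)" using low[OF t] by simp
        have uX: "u t \<in> input_space \<Sigma>" using input_space_value[OF u] tb \<tau> by simp
        have "gradient_times (state_dim \<Sigma> i) (V i) (lam t i) (network_rhs \<Sigma> (lam t) (u t) i) \<le> - \<alpha>min (V i (lam t i))"
        proof (rule active_component_dissipates[OF X[OF tb] uX])
          have "c * W (lam t) \<le> c * (w + \<epsilon>)" using Wt[OF tb] c by simp
          also have "\<dots> < (1 + c) / 2 * w + \<epsilon>"
          proof -
            have "c * \<epsilon> < 1 * \<epsilon>" "c * w < (1 + c) / 2 * w" using c \<epsilon> w by (auto intro!: mult_strict_right_mono)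
            then show ?thesis by (simp add: distrib_left)
          qed
          finally have "S i * (c * W (lam t)) < S i * ((1 + c) / 2 * w + \<epsilon>)"
            using S_pos[of i] by (rule mult_strict_left_mono)
          then show "c * (S i * W (lam t)) < V i (lam t i)" using Vt(1)[OF t] by (simp add: mult.left_commute)
          have "\<gamma>max (normU \<Sigma> (u t)) \<le> \<gamma>max (norm_input \<Sigma> u)"
            by (intro class_K_mono[OF classes(3)] U.norm_nonneg uX input_norm_le u) (use tb \<tau> in simp)
          then show "\<gamma>max (normU \<Sigma> (u t)) < V i (lam t i)" using \<gamma>w low[OF t] by linarith
        qed
        moreover have "\<alpha>' w \<le> \<alpha>min (V i (lam t i))"
        proof (rule \<alpha>'(2))
          have "V i (lam t i) \<le> S i * (2 * w)"
          proof (rule order_trans[OF Vt(2)[OF t]], rule mult_left_mono)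
            have "(1 - c) * w \<le> 1 * w" using c w by (intro mult_right_mono) auto
            then show "w + \<epsilon> \<le> 2 * w" using w by (simp add: \<epsilon>_def)
          qed (use S_pos[of i] in simp)
          also have "\<dots> \<le> Smax * (2 * w)" using S(2) w by (intro mult_right_mono) auto
          finally show "V i (lam t i) \<le> 2 * Smax * w" by (simp add: mult_ac)
        qed (use low[OF t] w in auto)
        ultimately show "gradient_times (state_dim \<Sigma> i) (V i) (lam t i) (network_rhs \<Sigma> (lam t) (u t) i) \<le> - \<alpha>' w"
          by linarith
      qed
      also have "\<dots> \<le> S i * w - h * \<alpha>' w" using V_le_W[OF \<tau>X, of i] by (simp add: w_def)
      also have "\<dots> \<le> S i * (w - h * \<alpha> w)"
      proof -
        have "S i * \<alpha> w \<le> Smax * \<alpha> w"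
          using S(2) class_P_nonneg[OF \<alpha> less_imp_le[OF w]] by (rule mult_right_mono)
        also have "\<dots> = \<alpha>' w" using Smax_ge_1 by (simp add: \<alpha>_def)
        finally have "h * (S i * \<alpha> w) \<le> h * \<alpha>' w" using h by simp
        then show ?thesis by (simp add: algebra_simps)
      qed
      finally show ?thesis .
    qed
    \<comment> \<open>The second bound keeps the decrease of \<open>W\<close> below the margin \<open>\<epsilon>\<close> of the inactive components.\<close>
    define d where "d = min (b - \<tau>) (\<epsilon> / (\<alpha> w + 1))"
    have \<alpha>w: "0 \<le> \<alpha> w" using class_P_nonneg[OF \<alpha> less_imp_le[OF w]] .
    have "W (lam (\<tau> + h)) \<le> w - h * \<alpha> w" if h: "0 < h" "h < d" for h
    proof (rule W_le)
      fix i
      have hb: "\<tau> + h < b" using h by (simp add: d_def)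
      have "h * (\<alpha> w + 1) < \<epsilon>" using h \<alpha>w by (simp add: d_def field_simps)
      then have h\<epsilon>: "h * \<alpha> w \<le> \<epsilon>" using h by (simp add: distrib_left)
      show "V i (lam (\<tau> + h) i) \<le> S i * (w - h * \<alpha> w)"
      proof (cases "S i * ((3 + c) / 4 * w) \<le> V i (lam \<tau> i)")
        case True
        then show ?thesis using h(1) hb by (rule active)
      next
        case False
        then have "V i (lam (\<tau> + h) i) \<le> S i * ((3 + c) / 4 * w) + S i * \<epsilon>"
          using near[of "\<tau> + h" i] h(1) hb S\<epsilon>[of i] by (simp add: abs_le_iff)
        also have "\<dots> = S i * (w - \<epsilon>)" by (simp add: \<epsilon>_def field_simps)
        also have "\<dots> \<le> S i * (w - h * \<alpha> w)" using h\<epsilon> S_pos[of i] by simp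
        finally show ?thesis .
      qed
    qed
    moreover have "0 < d" using b \<epsilon> \<alpha>w by (simp add: d_def)
    ultimately show "\<exists>d>0. \<forall>h. 0 < h \<and> h < d \<longrightarrow> W (lam (\<tau> + h)) \<le> W (lam \<tau>) - h * \<alpha> (W (lam \<tau>))"
      unfolding w_def by blast
  qed
qed

lemma W_lyapunov_and_iss:
  assumes wp: "well_posed \<Sigma>" and bic: "bounded_implies_continuation \<Sigma>"
  shows "iss_lyapunov_function \<Sigma> W" "iss \<Sigma>"
proof -
  obtain \<alpha> where \<alpha>: "\<alpha> \<in> class_P"
    "\<And>x0 u T lam \<tau>. u \<in> input_functions \<Sigma> \<Longrightarrow> is_solution \<Sigma> x0 u T lam \<Longrightarrow> 0 \<le> \<tau> \<Longrightarrow> ereal \<tau> < T \<Longrightarrow>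
      2 / (1 + c) * \<gamma>max (norm_input \<Sigma> u) < W (lam \<tau>) \<Longrightarrow>
      \<exists>d>0. \<forall>h. 0 < h \<and> h < d \<longrightarrow> W (lam (\<tau> + h)) \<le> W (lam \<tau>) - h * \<alpha> (W (lam \<tau>))"
    using W_decay by blast
  interpret decay_along_solutions \<Sigma> W "\<lambda>r. 1 / Smax * \<psi>1 r" \<psi>2 "\<lambda>r. 2 / (1 + c) * \<gamma>max r" \<alpha>
  proof
    show "(\<lambda>r. 1 / Smax * \<psi>1 r) \<in> class_K_inf" using Smax_ge_1 by (intro class_K_inf_scale classes) simp
    show "(\<lambda>r. 2 / (1 + c) * \<gamma>max r) \<in> class_K" using c by (intro class_K_scale classes) simp
  qed (use wp W_continuous classes \<alpha> W_bounds in auto)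
  show "iss_lyapunov_function \<Sigma> W" by (rule lyapunov)
  show "iss \<Sigma>" by (rule iss[OF bic])
qed

end

section \<open>The small-gain theorem\<close>

theorem theorem11:
  fixes \<Sigma> :: network
    and V :: "nat \<Rightarrow> rvec \<Rightarrow> real"
    and \<psi>lo \<psi>hi :: "nat \<Rightarrow> real \<Rightarrow> real"
    and \<mu> :: "nat \<Rightarrow> (nat \<Rightarrow>\<^sub>C real) \<Rightarrow> ennreal"
    and \<gamma> :: "nat \<Rightarrow> nat \<Rightarrow> real"
    and \<gamma>u \<alpha> :: "nat \<Rightarrow> real \<Rightarrow> real"
  assumes network: "infinite_network \<Sigma>"
    and i: "well_posed \<Sigma>" "bounded_implies_continuation \<Sigma>"
    and V_nonneg: "\<And>i. V i \<in> Rn (state_dim \<Sigma> i) \<rightarrow> {0..}"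
    and V_cont: "\<And>i. continuous_on (Rn (state_dim \<Sigma> i)) (V i)"
    and V_C1: "\<And>i. C1_off_origin (state_dim \<Sigma> i) (V i)"
    and L1_class: "\<And>i. \<psi>lo i \<in> class_K_inf" "\<And>i. \<psi>hi i \<in> class_K_inf"
    and L1: "\<And>i \<xi>. \<xi> \<in> Rn (state_dim \<Sigma> i) \<Longrightarrow>
          \<psi>lo i (state_norm \<Sigma> i \<xi>) \<le> V i \<xi> \<and> V i \<xi> \<le> \<psi>hi i (state_norm \<Sigma> i \<xi>)"
    and L2_mu: "\<And>i. aggregation_function (\<mu> i)"
    and L2_gamma: "\<And>i j. 0 \<le> \<gamma> i j" "\<And>i j. j \<notin> neighbours \<Sigma> i \<Longrightarrow> \<gamma> i j = 0"
    and L2_class: "\<And>i. \<gamma>u i \<in> class_K" "\<And>i. \<alpha> i \<in> class_P"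
    and L2: "\<And>i x u. x \<in> state_space \<Sigma> \<Longrightarrow> u \<in> input_space \<Sigma> \<Longrightarrow>
          ennreal (V i (x i)) > max (aggregated_gain \<mu> \<gamma> (\<lambda>j. V j (x j)) i)
                                    (ennreal (\<gamma>u i (input_norm \<Sigma> i (u i)))) \<Longrightarrow>
          gradient_times (state_dim \<Sigma> i) (V i) (x i)
              (rhs \<Sigma> i (x i) (restrict_to (neighbours \<Sigma> i) x) (u i))
            \<le> - \<alpha> i (V i (x i))"
    and ii_uniform: "\<exists>\<psi>1\<in>class_K_inf. \<exists>\<psi>2\<in>class_K_inf. \<forall>i. \<forall>r\<ge>0. \<psi>1 r \<le> \<psi>lo i r \<and> \<psi>hi i r \<le> \<psi>2 r"
    and iii_gain: "gain_well_defined \<mu> \<gamma>"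
    and iii_input: "\<exists>\<gamma>max\<in>class_K. \<forall>i. \<forall>r\<ge>0. \<gamma>u i r \<le> \<gamma>max r"
    and iv: "cone_spectral_radius (gain_operator \<mu> \<gamma>) < 1"
    and v: "\<forall>R>0. \<exists>L>0. \<forall>i. \<forall>\<xi>\<in>Rn (state_dim \<Sigma> i). \<forall>\<eta>\<in>Rn (state_dim \<Sigma> i).
          state_norm \<Sigma> i \<xi> < R \<longrightarrow> state_norm \<Sigma> i \<eta> < R \<longrightarrow>
          \<bar>V i \<xi> - V i \<eta>\<bar> \<le> L * state_norm \<Sigma> i (\<lambda>k. \<xi> k - \<eta> k)"
    and vi: "\<exists>\<alpha>min\<in>class_P. \<forall>i. \<forall>r\<ge>0. \<alpha> i r \<ge> \<alpha>min r"
  shows "(\<exists>s0\<in>interior linf_cone.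
            let W = (\<lambda>x. SUP i. 1 / apply_bcontfun s0 i * V i (x i)) in
              iss_lyapunov_function \<Sigma> W \<and>
              (\<forall>B\<subseteq>state_space \<Sigma>. (\<exists>R. \<forall>x\<in>B. normX \<Sigma> x \<le> R) \<longrightarrow>
                 Lipschitz_continuous_map (submetric (metricX \<Sigma>) B) euclidean_metric W)) \<and>
         iss \<Sigma>"
proof -
  obtain \<psi>1 \<psi>2 where \<psi>: "\<psi>1 \<in> class_K_inf" "\<psi>2 \<in> class_K_inf"
    "\<And>i r. 0 \<le> r \<Longrightarrow> \<psi>1 r \<le> \<psi>lo i r \<and> \<psi>hi i r \<le> \<psi>2 r"
    using ii_uniform by blast
  obtain \<gamma>max where \<gamma>max: "\<gamma>max \<in> class_K" "\<And>i r. 0 \<le> r \<Longrightarrow> \<gamma>u i r \<le> \<gamma>max r"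
    using iii_input by blast
  obtain \<alpha>min where \<alpha>min: "\<alpha>min \<in> class_P" "\<And>i r. 0 \<le> r \<Longrightarrow> \<alpha>min r \<le> \<alpha> i r"
    using vi by blast
  interpret admissible_network \<Sigma> by unfold_locales (rule network)
  interpret finite_gain \<mu> \<gamma> "neighbours \<Sigma>"
    using L2_mu L2_gamma network by unfold_locales (auto simp: infinite_network_def)
  interpret gain: monotone_cone_operator "gain_operator \<mu> \<gamma>"
    by (rule monotone_cone_operator_gain[OF iii_gain])
  obtain s c where s: "s \<in> linf_cone" "one_seq \<sqsubseteq> s" and c: "0 < c" "c < 1"
    and decay: "gain_operator \<mu> \<gamma> s \<sqsubseteq> c *\<^sub>R s"
    using gain.strict_decay_point[OF iv] .
  interpret small_gain_network \<Sigma> \<mu> \<gamma> V \<psi>1 \<psi>2 \<gamma>max \<alpha>min "apply_bcontfun s" "norm s" c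
  proof
    fix i
    show "1 \<le> apply_bcontfun s i"
      using s(2) by (simp add: pointwise_le_def const_bcontfun.rep_eq)
    show "apply_bcontfun s i \<le> norm s"
      using norm_bounded[of s i] by simp
    show "aggregated_gain \<mu> \<gamma> (apply_bcontfun s) i \<le> ennreal (c * apply_bcontfun s i)"
      using decay unfolding gain_operator_apply(1)[OF iii_gain s(1), symmetric] pointwise_le_def
      by (simp add: ennreal_leI)
  next
    fix i \<xi> assume \<xi>: "\<xi> \<in> Rn (state_dim \<Sigma> i)"
    show "\<psi>1 (state_norm \<Sigma> i \<xi>) \<le> V i \<xi> \<and> V i \<xi> \<le> \<psi>2 (state_norm \<Sigma> i \<xi>)"
      using L1[OF \<xi>] \<psi>(3)[OF X.comp.nonneg[OF \<xi>], of i] by linarith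
  next
    fix x u i
    assume x: "x \<in> state_space \<Sigma>" and u: "u \<in> input_space \<Sigma>"
      and large: "max (aggregated_gain \<mu> \<gamma> (\<lambda>j. V j (x j)) i) (ennreal (\<gamma>max (input_norm \<Sigma> i (u i)))) < ennreal (V i (x i))"
    have "ennreal (\<gamma>u i (input_norm \<Sigma> i (u i))) \<le> ennreal (\<gamma>max (input_norm \<Sigma> i (u i)))"
      by (intro ennreal_leI \<gamma>max(2) U.comp.nonneg U.component u)
    then have "gradient_times (state_dim \<Sigma> i) (V i) (x i)
        (rhs \<Sigma> i (x i) (restrict_to (neighbours \<Sigma> i) x) (u i)) \<le> - \<alpha> i (V i (x i))"
      using large by (intro L2[OF x u]) auto
    moreover have "\<alpha>min (V i (x i)) \<le> \<alpha> i (V i (x i))"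
      using V_nonneg[of i] X.component[OF x, of i] by (intro \<alpha>min(2)) auto
    ultimately show "gradient_times (state_dim \<Sigma> i) (V i) (x i)
        (rhs \<Sigma> i (x i) (restrict_to (neighbours \<Sigma> i) x) (u i)) \<le> - \<alpha>min (V i (x i))"
      by linarith
  qed (use V_cont V_C1 \<psi> \<gamma>max \<alpha>min v c in auto)
  have W_eq: "(\<lambda>x. SUP i. 1 / apply_bcontfun s i * V i (x i)) = W"
    by (simp add: fun_eq_iff W_def)
  have "s \<in> interior linf_cone" by (rule interior_linf_cone[OF s(2)])
  moreover have "iss_lyapunov_function \<Sigma> W" "iss \<Sigma>"
    using W_lyapunov_and_iss[OF i] by auto
  ultimately show ?thesis
    using W_Lipschitz_on_bounded
    by (intro conjI bexI[of _ s]) (simp_all only: Let_def W_eq, auto)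
qed

end
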